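(* Let $\lambda$ be a partition and $n\ge 2$. Then \[\mathrm{SVT}^n(\lambda)\cong\bigoplus_\mu B(\mu)^{\oplus F^\lambda_\mu}\] as $U_q(\mathfrak{sl}_n)$-crystals, where the sum is over partitions $\mu\supseteq\lambda$ and $F^\lambda_\mu$ is the number of flagged increasing tableaux of shape $\mu/\lambda$.
   Context: A semistandard set-valued tableau of shape $\lambda$ (English convention) is a filling of the boxes by nonempty finite sets of positive integers such that every choice of one integer per box gives a semistandard tableau (rows weakly increasing, columns strictly increasing); $\mathrm{SVT}^n(\lambda)$ is the set of those with entries at most $n$, and $\mathrm{SSYT}^n(\lambda)$ the subset with all sets singletons. Crystal operators, $1\le i<n$: write $+$ above each column containing (in some box) $i$ but not $i+1$, $-$ above each column containing $i+1$ but not $i$; reading columns left to right, repeatedly delete adjacent pairs $-+$. If no $+$ remains, $f_iT=0$; otherwise let $\mathsf b$ be the box containing $i$ in the column of the rightmost remaining $+$ and $\mathsf b^{\rightarrow}$ the box immediately right; if $i\notin\mathsf b^{\rightarrow}$, $f_iT$ replaces $i$ by $i+1$ in $\mathsf b$, otherwise removes $i$ from $\mathsf b^{\rightarrow}$ and adds $i+1$ to $\mathsf b$. If no $-$ remains, $e_iT=0$; otherwise let $\mathsf b$ be the box containing $i+1$ in the column of the leftmost remaining $-$ and $\mathsf b^{\leftarrow}$ the box immediately left; if $i+1\notin\mathsf b^{\leftarrow}$, $e_iT$ replaces $i+1$ by $i$ in $\mathsf b$, otherwise removes $i+1$ from $\mathsf b^{\leftarrow}$ and adds $i$ to $\mathsf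 b$. Weight: $\mathrm{wt}(T)=(c_1,\dots,c_n)$, $c_j$ = number of boxes containing $j$. $B(\mu)$ is $\mathrm{SSYT}^n(\mu)$ with the restricted operators (the crystal of the irreducible highest weight module of highest weight $\mu$; it is empty if $\mu$ has more than $n$ parts). An increasing tableau of shape $\mu/\lambda$ is a filling of the skew diagram by positive integers strictly increasing along rows (left to right) and columns (top to bottom); it is flagged if every entry in row $r$ (top row is row $1$) is at most $r-1$. Crystal isomorphism: weight-preserving bijection commuting with all $e_i,f_i$. *)

theory Defs
  imports Main
begin

definition is_partition :: "nat list \<Rightarrow> bool" where
  "is_partition la \<longleftrightarrow> sorted_wrt (\<ge>) la \<and> 0 \<notin> set la"

text \<open>Boxes are pairs (row, column) in English convention, both numbered from 1.\<close>

type_synonym box = "nat \<times> nat"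

definition diagram :: "nat list \<Rightarrow> box set" where
  "diagram la = {(r, c). 1 \<le> r \<and> r \<le> length la \<and> 1 \<le> c \<and> c \<le> la ! (r - 1)}"

definition ncols :: "nat list \<Rightarrow> nat" where
  "ncols la = (if la = [] then 0 else hd la)"

definition semistandard :: "nat list \<Rightarrow> (box \<Rightarrow> nat) \<Rightarrow> bool" where
  "semistandard la t \<longleftrightarrow>
     (\<forall>r c c'. (r, c) \<in> diagram la \<and> (r, c') \<in> diagram la \<and> c < c' \<longrightarrow> t (r, c) \<le> t (r, c')) \<and>
     (\<forall>r r' c. (r, c) \<in> diagram la \<and> (r', c) \<in> diagram la \<and> r < r' \<longrightarrow> t (r, c) < t (r', c))"

text \<open>A tableau is a total function on boxes, taking the value \<open>{}\<close> outside its shape, so that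
  equal fillings are equal functions.\<close>

type_synonym tableau = "box \<Rightarrow> nat set"

definition SVT :: "nat \<Rightarrow> nat list \<Rightarrow> tableau set" where
  "SVT n la = {T. (\<forall>b\<in>diagram la. T b \<noteq> {} \<and> T b \<subseteq> {1..n}) \<and>
                  (\<forall>b. b \<notin> diagram la \<longrightarrow> T b = {}) \<and>
                  (\<forall>t. (\<forall>b\<in>diagram la. t b \<in> T b) \<longrightarrow> semistandard la t)}"

definition SSYT :: "nat \<Rightarrow> nat list \<Rightarrow> tableau set" where
  "SSYT n la = {T \<in> SVT n la. \<forall>b\<in>diagram la. is_singleton (T b)}"

definition content :: "nat \<Rightarrow> tableau \<Rightarrow> nat list" where
  "content n T = map (\<lambda>j. card {b. j \<in> T b}) [1..<Suc n]"


datatype sign = Plus | Minus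

definition in_column :: "tableau \<Rightarrow> nat \<Rightarrow> nat \<Rightarrow> bool" where
  "in_column T c j \<longleftrightarrow> (\<exists>r. j \<in> T (r, c))"

text \<open>The signs above the columns, left to right, each recorded with its column.\<close>

definition signature :: "nat list \<Rightarrow> nat \<Rightarrow> tableau \<Rightarrow> (sign \<times> nat) list" where
  "signature la i T =
     map (\<lambda>c. (if in_column T c i then Plus else Minus, c))
       (filter (\<lambda>c. in_column T c i \<noteq> in_column T c (Suc i)) [1..<Suc (ncols la)])"

text \<open>One deletion of an adjacent pair \<open>-+\<close>; \<open>cancel\<close> computes the word left when no
  deletion is possible any more, see \<open>cancel_deletions\<close> and \<open>cancel_final\<close> (the order of the
  deletions is irrelevant, see \<open>cancel_unique\<close>).\<close>

inductive delete_pair :: "(sign \<times> nat) list \<Rightarrow> (sign \<times> nat) list \<Rightarrow> bool" where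
  "delete_pair (u @ (Minus, c) # (Plus, d) # v) (u @ v)"

fun push :: "sign \<times> nat \<Rightarrow> (sign \<times> nat) list \<Rightarrow> (sign \<times> nat) list" where
  "push (Minus, c) ((Plus, d) # w) = w"
| "push x w = x # w"

fun cancel :: "(sign \<times> nat) list \<Rightarrow> (sign \<times> nat) list" where
  "cancel [] = []"
| "cancel (x # w) = push x (cancel w)"

lemma delete_pair_Cons: "delete_pair v w \<Longrightarrow> delete_pair (x # v) (x # w)"
  by (induction rule: delete_pair.induct) (metis append_Cons delete_pair.intros)

lemma push_deletions: "delete_pair\<^sup>*\<^sup>* (x # w) (push x w)"
  by (cases "(x, w)" rule: push.cases)
    (use delete_pair.intros[of "[]"] in \<open>auto intro: r_into_rtranclp\<close>)

lemma cancel_deletions: "delete_pair\<^sup>*\<^sup>* w (cancel w)"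
proof (induction w)
  case (Cons x w)
  have "delete_pair\<^sup>*\<^sup>* (x # w) (x # cancel w)"
    using Cons.IH by (induction rule: rtranclp_induct)
      (auto intro: rtranclp.rtrancl_into_rtrancl delete_pair_Cons)
  then show ?case
    using push_deletions[of x "cancel w"] by simp
qed simp

lemma delete_pair_ConsD:
  assumes "delete_pair (x # w) v"
  shows "(\<exists>v'. delete_pair w v') \<or> (\<exists>c d w'. x = (Minus, c) \<and> w = (Plus, d) # w')"
  using assms
proof cases
  case (1 u c d v)
  then show ?thesis by (cases u) (auto intro: delete_pair.intros)
qed

lemma cancel_final: "\<not> delete_pair (cancel w) v"
proof (induction w arbitrary: v)
  case Nil
  show ?case by (auto elim: delete_pair.cases)
next
  case (Cons x w)
  show ?case
  proof
    assume *: "delete_pair (cancel (x # w)) v"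
    show False
    proof (cases "\<exists>c d w'. x = (Minus, c) \<and> cancel w = (Plus, d) # w'")
      case True
      then show ?thesis
          using * Cons.IH delete_pair_Cons by fastforce
    next
      case False
      then have "cancel (x # w) = x # cancel w"
        by (cases "(x, cancel w)" rule: push.cases) auto
      then show ?thesis
        using * False Cons.IH delete_pair_ConsD by metis
    qed
  qed
qed

lemma cancel_delete: "delete_pair v w \<Longrightarrow> cancel v = cancel w"
proof (induction rule: delete_pair.induct)
  case (1 u c d v)
  then show ?case by (induction u) auto
qed

lemma cancel_unique:
  assumes "delete_pair\<^sup>*\<^sup>* w v" and "\<nexists>v'. delete_pair v v'"
  shows "v = cancel w"
proof -
  have "cancel w = cancel v"
    using assms(1) by (induction rule: rtranclp_induct) (auto dest: cancel_delete)
  moreover have "cancel v = v"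
    using cancel_deletions[of v] assms(2) by (metis converse_rtranclpE)
  ultimately show ?thesis by simp
qed

text \<open>\<open>None\<close> plays the role of \<open>0\<close>. By strict increase down columns, each integer occurs in at
  most one box of a column.\<close>

definition f_op :: "nat list \<Rightarrow> nat \<Rightarrow> tableau \<Rightarrow> tableau option" where
  "f_op la i T =
     (let ps = [c. (s, c) \<leftarrow> cancel (signature la i T), s = Plus] in
      if ps = [] then None
      else let c = last ps; r = (THE r. i \<in> T (r, c)) in
        Some (if i \<notin> T (r, c + 1)
              then T((r, c) := insert (i + 1) (T (r, c) - {i}))
              else T((r, c + 1) := T (r, c + 1) - {i}, (r, c) := insert (i + 1) (T (r, c)))))"

text \<open>For \<open>c = 1\<close> the box \<open>(r, c - 1)\<close> lies outside every diagram and contains nothing.\<close>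

definition e_op :: "nat list \<Rightarrow> nat \<Rightarrow> tableau \<Rightarrow> tableau option" where
  "e_op la i T =
     (let ms = [c. (s, c) \<leftarrow> cancel (signature la i T), s = Minus] in
      if ms = [] then None
      else let c = hd ms; r = (THE r. i + 1 \<in> T (r, c)) in
        Some (if i + 1 \<notin> T (r, c - 1)
              then T((r, c) := insert i (T (r, c) - {i + 1}))
              else T((r, c - 1) := T (r, c - 1) - {i + 1}, (r, c) := insert i (T (r, c)))))"


record 'a crystal =
  elems :: "'a set"
  wt :: "'a \<Rightarrow> nat list"
  e_of :: "nat \<Rightarrow> 'a \<Rightarrow> 'a option"
  f_of :: "nat \<Rightarrow> 'a \<Rightarrow> 'a option"

definition SVT_crystal :: "nat \<Rightarrow> nat list \<Rightarrow> tableau crystal" where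
  "SVT_crystal n la = \<lparr>elems = SVT n la, wt = content n, e_of = e_op la, f_of = f_op la\<rparr>"

definition B_crystal :: "nat \<Rightarrow> nat list \<Rightarrow> tableau crystal" where
  "B_crystal n mu = (SVT_crystal n mu)\<lparr>elems := SSYT n mu\<rparr>"

definition direct_sum :: "'i set \<Rightarrow> ('i \<Rightarrow> 'a crystal) \<Rightarrow> ('i \<times> 'a) crystal" where
  "direct_sum I C =
     \<lparr>elems = (SIGMA k:I. elems (C k)),
      wt = (\<lambda>(k, x). wt (C k) x),
      e_of = (\<lambda>i (k, x). map_option (Pair k) (e_of (C k) i x)),
      f_of = (\<lambda>i (k, x). map_option (Pair k) (f_of (C k) i x))\<rparr>"

definition multiple :: "nat \<Rightarrow> 'a crystal \<Rightarrow> (nat \<times> 'a) crystal" where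
  "multiple m C = direct_sum {..<m} (\<lambda>_. C)"

text \<open>Since \<open>\<psi>\<close> is meaningful only on \<open>A\<close>, commuting includes that the operator does not
  lead out of \<open>A\<close>.\<close>

definition commutes_on :: "'a set \<Rightarrow> ('a \<Rightarrow> 'b) \<Rightarrow> ('a \<Rightarrow> 'a option) \<Rightarrow> ('b \<Rightarrow> 'b option) \<Rightarrow> bool" where
  "commutes_on A \<psi> g h \<longleftrightarrow> (\<forall>x\<in>A. set_option (g x) \<subseteq> A \<and> map_option \<psi> (g x) = h (\<psi> x))"

text \<open>The operators of a crystal of type \<open>sl\<^sub>n\<close> are those with index \<open>1 \<le> i < n\<close>.\<close>

definition crystal_isomorphism :: "nat \<Rightarrow> 'a crystal \<Rightarrow> 'b crystal \<Rightarrow> ('a \<Rightarrow> 'b) \<Rightarrow> bool" where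
  "crystal_isomorphism n C D \<psi> \<longleftrightarrow>
     bij_betw \<psi> (elems C) (elems D) \<and>
     (\<forall>x\<in>elems C. wt D (\<psi> x) = wt C x) \<and>
     (\<forall>i\<in>{1..<n}. commutes_on (elems C) \<psi> (e_of C i) (e_of D i) \<and>
                  commutes_on (elems C) \<psi> (f_of C i) (f_of D i))"

definition isomorphic_crystals :: "nat \<Rightarrow> 'a crystal \<Rightarrow> 'b crystal \<Rightarrow> bool" where
  "isomorphic_crystals n C D \<longleftrightarrow> (\<exists>\<psi>. crystal_isomorphism n C D \<psi>)"


text \<open>Fillings of the skew diagram \<open>mu/la\<close>, extended by \<open>0\<close> outside it.\<close>

definition increasing_tableaux :: "nat list \<Rightarrow> nat list \<Rightarrow> (box \<Rightarrow> nat) set" where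
  "increasing_tableaux la mu =
     {U. (let S = diagram mu - diagram la in
          (\<forall>b\<in>S. 0 < U b) \<and> (\<forall>b. b \<notin> S \<longrightarrow> U b = 0) \<and>
          (\<forall>r c c'. (r, c) \<in> S \<and> (r, c') \<in> S \<and> c < c' \<longrightarrow> U (r, c) < U (r, c')) \<and>
          (\<forall>r r' c. (r, c) \<in> S \<and> (r', c) \<in> S \<and> r < r' \<longrightarrow> U (r, c) < U (r', c)))}"

definition flagged_increasing_tableaux :: "nat list \<Rightarrow> nat list \<Rightarrow> (box \<Rightarrow> nat) set" where
  "flagged_increasing_tableaux la mu =
     {U \<in> increasing_tableaux la mu. \<forall>(r, c)\<in>diagram mu - diagram la. U (r, c) \<le> r - 1}"

definition num_flagged :: "nat list \<Rightarrow> nat list \<Rightarrow> nat" where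
  "num_flagged la mu = card (flagged_increasing_tableaux la mu)"

end

theory Submission imports Defs begin

text \<open>A set-valued tableau is encoded by a marked Gelfand--Tsetlin pattern: \<open>M r j\<close> is the number of
  boxes of row \<open>r\<close> with minimum at most \<open>j\<close>, and \<open>X r j\<close> says that \<open>j\<close> occurs in row \<open>r\<close> as a
  nonminimal entry of some box (which happens at most once). The boxes of row \<open>r\<close> containing \<open>j\<close> are
  then those in the columns \<open>lft M X r j < c \<le> M r j\<close>, and the set-valued tableau conditions become
  \<open>M (r + 1) j \<le> lft M X r j\<close>.

  Uncrowding proceeds row by row from the bottom. The nonminimal entries of row \<open>q\<close> are inserted
  into row \<open>q + 1\<close> (which has singletons only): an entry \<open>x\<close> joins the leftmost box whose entry
  exceeds \<open>x\<close>, or goes into one new box at the end of the row. The entries bumped by row insertion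
  are exactly the nonminimal entries of the new row \<open>q + 1\<close>, so the process continues with this row.
  Scanning the letters in increasing order this is a transducer with one bit of memory (\<open>carry\<close>),
  which makes it invertible and makes commutation with \<open>f\<^sub>i\<close> a check on the letters \<open>i\<close> and \<open>i + 1\<close>
  of two rows. A box created in row \<open>r\<close> by entries originating in row \<open>p\<close> is labelled \<open>r - p\<close>.\<close>

section \<open>Marked patterns and their crystal operators\<close>

text \<open>The obstacle is that the signature is read by columns while the bumping is done by rows.
  A common height function links the two: the column reading, stopped at column
  \<open>lft M X r (Suc i)\<close>, has the same partial sum as the reading of the rows from the
  bottom, stopped after the plus signs of row r. So \<open>f\<^sub>i\<close> acts in the row where
  \<open>peak\<close> is first maximal. One downward step touches two adjacent rows, keeps their
  joint content, and so can alter only two peaks. The operator stays in its row, unless the entry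
  that it changes is itself being moved down; then it follows that entry into the next row. The
  labels do more than count new boxes. Entries originating in row p extend row r with the label r -
  p, which exceeds every label already present in that row, so the inverse process sees from the
  last label of a row whether the row was just extended. Strict increase and the flag bound r - 1
  are what this leaves once p has come down to 1.\<close>

definition lft :: "(nat \<Rightarrow> nat \<Rightarrow> int) \<Rightarrow> (nat \<Rightarrow> nat \<Rightarrow> bool) \<Rightarrow> nat \<Rightarrow> nat \<Rightarrow> int" where
  "lft M X r j = M r (j - 1) - of_bool (X r j)"

text \<open>The first \<open>lft M X r j\<close> boxes of row \<open>r\<close> are those whose
  minimum is below \<open>j\<close> and which do not contain \<open>j\<close>. Asking for all
  \<open>j\<close> that the boxes of row \<open>r + 1\<close> with minimum at most \<open>j\<close>
  lie under them is column strictness. Row 0 is an empty dummy row, exempt from this.\<close>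

locale pattern =
  fixes n :: nat and M :: "nat \<Rightarrow> nat \<Rightarrow> int" and X :: "nat \<Rightarrow> nat \<Rightarrow> bool"
  assumes M_0: "M r 0 = 0"
    and M_row0: "M 0 j = 0"
    and M_mono1: "M r j \<le> M r (Suc j)"
    and M_stable: "n \<le> j \<Longrightarrow> M r j = M r n"
    and X_range: "X r j \<Longrightarrow> 1 \<le> r \<and> 1 \<le> j \<and> j \<le> n"
    and M_le_lft: "1 \<le> r \<Longrightarrow> 1 \<le> j \<Longrightarrow> M (Suc r) j \<le> lft M X r j"
begin

lemma M_mono: "j \<le> k \<Longrightarrow> M r j \<le> M r k"
  by (induction k rule: dec_induct) (auto intro: order_trans M_mono1)

lemma M_nonneg: "0 \<le> M r j"
  using M_mono[of 0 j r] M_0 by simp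

lemma lft_le_pred: "lft M X r j \<le> M r (j - 1)"
  by (simp add: lft_def)

lemma lft_le: "lft M X r j \<le> M r j"
  using lft_le_pred[of r j] M_mono[of "j - 1" j r] by linarith

lemma lft_nonneg: "0 \<le> lft M X r j"
proof (cases "X r j")
  case True
  then have "1 \<le> r" "1 \<le> j" using X_range by auto
  then show ?thesis using M_le_lft[of r j] M_nonneg[of "Suc r" j] by linarith
next
  case False
  then show ?thesis by (simp add: lft_def M_nonneg)
qed

lemma M_antimono:
  assumes "1 \<le> r" "r \<le> r'" shows "M r' j \<le> M r j"
  using assms(2)
proof (induction r' rule: dec_induct)
  case (step k)
  show ?case
  proof (cases j)
    case 0 then show ?thesis by (simp add: M_0)
  next
    case (Suc j')
    then show ?thesis
      using step assms(1) M_le_lft[of k j] lft_le[of k j] by simp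
  qed
qed simp

lemma M_le_lft': "1 \<le> r \<Longrightarrow> r < r' \<Longrightarrow> 1 \<le> j \<Longrightarrow> M r' j \<le> lft M X r j"
  using M_antimono[of "Suc r" r' j] M_le_lft[of r j] by simp

lemma M_zero: "j < r \<Longrightarrow> M r j = 0"
proof (induction j arbitrary: r)
  case (Suc j)
  then obtain r' where r': "r = Suc r'" "j < r'" by (cases r) auto
  have "M r (Suc j) \<le> M r' j"
    using M_le_lft[of r' "Suc j"] lft_le_pred[of r' "Suc j"] r' by simp
  then show ?case using Suc.IH[OF r'(2)] M_nonneg[of r "Suc j"] by simp
qed (simp add: M_0)

lemma M_zero_row: "n < r \<Longrightarrow> M r j = 0"
  using M_zero[of n r] M_stable[of j r] M_mono[of j n r] M_nonneg[of r j]
  by (cases "n \<le> j") auto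

text \<open>A nonminimal \<open>j\<close> shares its box with a smaller entry, which is at least
  \<open>r\<close> by \<open>M_zero\<close>. Hence row \<open>n\<close> is never marked, and moving
  entries down can stop there.\<close>

lemma X_row_less: assumes "X r j" shows "r < j" "r < n"
proof -
  have r: "1 \<le> r" "1 \<le> j" "j \<le> n" using X_range[OF assms] by auto
  have "1 \<le> M r (j - 1)" using lft_nonneg[of r j] assms by (simp add: lft_def)
  then show "r < j" using M_zero[of "j - 1" r] r by force
  then show "r < n" using r by simp
qed

end

type_synonym pat = "(nat \<Rightarrow> nat \<Rightarrow> int) \<times> (nat \<Rightarrow> nat \<Rightarrow> bool)"

definition cnt :: "(nat \<Rightarrow> nat \<Rightarrow> int) \<Rightarrow> (nat \<Rightarrow> nat \<Rightarrow> bool) \<Rightarrow> nat \<Rightarrow> nat \<Rightarrow> int" where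
  "cnt M X j r = M r j - lft M X r j"

text \<open>The number of boxes of row \<open>r\<close> with \<open>i\<close> but not
  \<open>i + 1\<close>. The difference of the left ends is -1 exactly when the row has no
  \<open>i\<close> and \<open>i + 1\<close> is nonminimal; the truncation discards this case, and
  the last summand of \<open>rminus\<close> picks it up as a minus sign.\<close>

definition rplus :: "(nat \<Rightarrow> nat \<Rightarrow> int) \<Rightarrow> (nat \<Rightarrow> nat \<Rightarrow> bool) \<Rightarrow> nat \<Rightarrow> nat \<Rightarrow> int" where
  "rplus M X i r = max 0 (lft M X r (Suc i) - lft M X r i)"

definition rminus :: "(nat \<Rightarrow> nat \<Rightarrow> int) \<Rightarrow> (nat \<Rightarrow> nat \<Rightarrow> bool) \<Rightarrow> nat \<Rightarrow> nat \<Rightarrow> int" where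
  "rminus M X i r = M r (Suc i) - M r i + max 0 (lft M X r i - lft M X r (Suc i))"

text \<open>In the row reading, row \<open>k\<close> contributes \<open>rplus\<close> signs \<open>+\<close> followed by \<open>rminus\<close> signs \<open>-\<close>
  (boxes containing both letters are dropped), rows being read from the bottom; \<open>peak\<close> is the partial
  sum after the \<open>+\<close> signs of row \<open>r\<close>.\<close>

definition peak :: "nat \<Rightarrow> nat \<Rightarrow> (nat \<Rightarrow> nat \<Rightarrow> int) \<Rightarrow> (nat \<Rightarrow> nat \<Rightarrow> bool) \<Rightarrow> nat \<Rightarrow> int" where
  "peak n i M X r = (\<Sum>k\<in>{r<..n}. cnt M X i k - cnt M X (Suc i) k) + rplus M X i r"

text \<open>The rightmost surviving plus is the step by which the partial sums first reach their
  maximum. Rows are read from \<open>n\<close> down to 1, so being first is strictness against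
  larger indices.\<close>

definition frow :: "nat \<Rightarrow> nat \<Rightarrow> (nat \<Rightarrow> nat \<Rightarrow> int) \<Rightarrow> (nat \<Rightarrow> nat \<Rightarrow> bool) \<Rightarrow> nat \<Rightarrow> bool" where
  "frow n i M X r \<longleftrightarrow> 1 \<le> r \<and> r \<le> n \<and> 0 < peak n i M X r \<and>
     (\<forall>k. r < k \<and> k \<le> n \<longrightarrow> peak n i M X k < peak n i M X r) \<and>
     (\<forall>k. 1 \<le> k \<and> k < r \<longrightarrow> peak n i M X k \<le> peak n i M X r)"

text \<open>The row in which the maximum is left for good. In row 1 no later peak witnesses the
  descent, whence the demand that \<open>rminus\<close> be positive.\<close>

definition erow :: "nat \<Rightarrow> nat \<Rightarrow> (nat \<Rightarrow> nat \<Rightarrow> int) \<Rightarrow> (nat \<Rightarrow> nat \<Rightarrow> bool) \<Rightarrow> nat \<Rightarrow> bool" where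
  "erow n i M X r \<longleftrightarrow> 1 \<le> r \<and> r \<le> n \<and> 0 \<le> peak n i M X r \<and> 0 < rminus M X i r \<and>
     (\<forall>k. r < k \<and> k \<le> n \<longrightarrow> peak n i M X k \<le> peak n i M X r) \<and>
     (\<forall>k. 1 \<le> k \<and> k < r \<longrightarrow> peak n i M X k < peak n i M X r)"

text \<open>Lowering \<open>M r i\<close> covers both cases of the rule for \<open>f_op\<close>. The
  last box with minimum \<open>i\<close> gets minimum \<open>i + 1\<close>; if it contained
  \<open>i + 1\<close> already, the mark slips to the box on its left, which amounts to removing
  \<open>i\<close> on the right and adding \<open>i + 1\<close> on the left. If no box has minimum
  \<open>i\<close>, the only \<open>i\<close> of the row is a mark, which is renamed.\<close>

definition frow_act :: "nat \<Rightarrow> nat \<Rightarrow> pat \<Rightarrow> pat" where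
  "frow_act i r = (\<lambda>(M, X). if M r i \<noteq> M r (i - 1) then (M(r := (M r)(i := M r i - 1)), X)
     else (M, X(r := (X r)(i := False, Suc i := True))))"

text \<open>The mark is renamed exactly in the case truncated in \<open>rplus\<close>:
  \<open>i + 1\<close> is nonminimal in a row without \<open>i\<close>.\<close>

definition erow_act :: "nat \<Rightarrow> nat \<Rightarrow> pat \<Rightarrow> pat" where
  "erow_act i r = (\<lambda>(M, X). if X r (Suc i) \<and> \<not> X r i \<and> M r i = M r (i - 1)
     then (M, X(r := (X r)(i := True, Suc i := False)))
     else (M(r := (M r)(i := M r i + 1)), X))"

definition f_pat :: "nat \<Rightarrow> nat \<Rightarrow> pat \<Rightarrow> pat option" where
  "f_pat n i = (\<lambda>(M, X). if \<exists>r. frow n i M X r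
     then Some (frow_act i (THE r. frow n i M X r) (M, X)) else None)"

definition e_pat :: "nat \<Rightarrow> nat \<Rightarrow> pat \<Rightarrow> pat option" where
  "e_pat n i = (\<lambda>(M, X). if \<exists>r. erow n i M X r
     then Some (erow_act i (THE r. erow n i M X r) (M, X)) else None)"

lemma frow_unique: "frow n i M X r \<Longrightarrow> frow n i M X r' \<Longrightarrow> r = r'"
  unfolding frow_def by (metis linorder_neqE_nat not_le)

lemma erow_unique: "erow n i M X r \<Longrightarrow> erow n i M X r' \<Longrightarrow> r = r'"
  unfolding erow_def by (metis linorder_neqE_nat not_le)

lemma f_pat_frow: "frow n i M X r \<Longrightarrow> f_pat n i (M, X) = Some (frow_act i r (M, X))"
  unfolding f_pat_def by (auto dest: frow_unique intro!: arg_cong2[where f = "\<lambda>r. frow_act i r"] the_equality)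

lemma e_pat_erow: "erow n i M X r \<Longrightarrow> e_pat n i (M, X) = Some (erow_act i r (M, X))"
  unfolding e_pat_def by (auto dest: erow_unique intro!: arg_cong2[where f = "\<lambda>r. erow_act i r"] the_equality)

lemma f_pat_None: "\<nexists>r. frow n i M X r \<Longrightarrow> f_pat n i (M, X) = None"
  by (simp add: f_pat_def)

lemma e_pat_None: "\<nexists>r. erow n i M X r \<Longrightarrow> e_pat n i (M, X) = None"
  by (simp add: e_pat_def)

lemma f_pat_SomeE:
  assumes "f_pat n i (M, X) = Some p"
  obtains r where "frow n i M X r" "p = frow_act i r (M, X)"
  using assms f_pat_frow f_pat_None by (metis option.discI option.inject)

lemma e_pat_SomeE:
  assumes "e_pat n i (M, X) = Some p"
  obtains r where "erow n i M X r" "p = erow_act i r (M, X)"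
  using assms e_pat_erow e_pat_None by (metis option.discI option.inject)

lemma peak_Suc:
  assumes "Suc r \<le> n"
  shows "peak n i M X r = peak n i M X (Suc r) - rminus M X i (Suc r) + rplus M X i r"
proof -
  have "{r<..n} = insert (Suc r) {Suc r<..n}" using assms by auto
  then show ?thesis
    by (simp add: peak_def rminus_def rplus_def cnt_def max_def)
qed

context pattern begin

lemma rminus_nonneg: "0 \<le> rminus M X i r"
  using M_mono1[of r i] by (simp add: rminus_def)

text \<open>The peak of \<open>r\<close> exceeds that of the row below, so by
  \<open>peak_Suc\<close> row \<open>r\<close> has more plus signs than row \<open>r + 1\<close> has
  minus signs. Combined with \<open>M_le_lft\<close> for the letter \<open>i\<close>, this makes
  room for one more \<open>i + 1\<close> in row \<open>r\<close> above row
  \<open>r + 1\<close>.\<close>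

lemma frow_lft:
  assumes "frow n i M X r" and "1 \<le> i"
  shows "M (Suc r) (Suc i) < lft M X r (Suc i)" and "lft M X r i < lft M X r (Suc i)"
proof -
  have r: "1 \<le> r" "r \<le> n" using assms(1) by (auto simp: frow_def)
  have *: "rminus M X i (Suc r) < rplus M X i r"
  \<comment> \<open>Row \<open>n\<close> is read first; there the comparison is with the start of
    the reading, at height 0.\<close>
  proof (cases "r = n")
    case True
    then have "M (Suc r) j = 0" for j using M_zero_row by simp
    moreover have "lft M X (Suc r) j = 0" for j
      using lft_le[of "Suc r" j] lft_nonneg[of "Suc r" j] calculation[of j] by simp
    ultimately have "rminus M X i (Suc r) = 0" by (simp add: rminus_def)
    then show ?thesis using assms(1) True by (simp add: frow_def peak_def)
  next
    case False
    then show ?thesis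
      using assms(1) peak_Suc[of r n i M X] r by (auto simp: frow_def)
  qed
  then show "lft M X r i < lft M X r (Suc i)"
    using rminus_nonneg[of i "Suc r"] by (auto simp: rplus_def max_def split: if_splits)
  then show "M (Suc r) (Suc i) < lft M X r (Suc i)"
    using * M_le_lft[of r i] r assms(2) by (auto simp: rplus_def rminus_def max_def split: if_splits)
qed

lemma frow_X:
  assumes "frow n i M X r" and "1 \<le> i" and "M r i = M r (i - 1)"
  shows "X r i" "\<not> X r (Suc i)"
  using frow_lft(2)[OF assms(1,2)] assms(3) by (auto simp: lft_def split: if_splits)

end

lemma pattern_frow_act:
  assumes "pattern n M X" "frow n i M X r" "1 \<le> i" "i < n" "frow_act i r (M, X) = (M', X')"
  shows "pattern n M' X'"
proof -
  interpret pattern n M X by fact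
  have r: "1 \<le> r" "r \<le> n" using assms(2) by (auto simp: frow_def)
  note l = frow_lft[OF assms(2,3)]
  show ?thesis
  proof (cases "M r i = M r (i - 1)")
    case False
    then have eq: "M' = M(r := (M r)(i := M r i - 1))" "X' = X"
      using assms(5) by (auto simp: frow_act_def)
    have lt: "M r (i - 1) < M r i" using False M_mono[of "i - 1" i r] by simp
    show ?thesis
    proof
      fix k j
      show "M' k 0 = 0" using assms(3) by (simp add: eq M_0)
      show "M' 0 j = 0" using r by (simp add: eq M_row0)
      show "M' k j \<le> M' k (Suc j)"
        using M_mono1[of k j] lt assms(3) by (auto simp: eq) 
      show "M' k j = M' k n" if "n \<le> j"
        using that M_stable[of j k] assms(4) by (auto simp: eq)
      show "1 \<le> k \<and> 1 \<le> j \<and> j \<le> n" if "X' k j" using that X_range by (simp add: eq)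
      show "M' (Suc k) j \<le> lft M' X' k j" if kj: "1 \<le> k" "1 \<le> j"
        using M_le_lft[OF kj] l kj assms(3)
        by (cases j; cases "k = r"; cases "Suc k = r"; cases "j = Suc i"; cases "j = i")
          (simp_all add: eq lft_def)
    qed
  next
    case True
    then have eq: "M' = M" "X' = X(r := (X r)(i := False, Suc i := True))"
      using assms(5) by (auto simp: frow_act_def)
    note x = frow_X[OF assms(2,3) True]
    show ?thesis
    proof
      fix k j
      show "M' k 0 = 0" by (simp add: eq M_0)
      show "M' 0 j = 0" using r by (simp add: eq M_row0)
      show "M' k j \<le> M' k (Suc j)" by (simp add: eq M_mono1)
      show "M' k j = M' k n" if "n \<le> j" using that M_stable[of j k] by (simp add: eq)
      show "1 \<le> k \<and> 1 \<le> j \<and> j \<le> n" if "X' k j"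
        using that X_range[of k j] r assms(4) by (auto simp: eq split: if_splits)
      show "M' (Suc k) j \<le> lft M' X' k j" if kj: "1 \<le> k" "1 \<le> j"
        using M_le_lft[OF kj] l kj x assms(3) by (auto simp: eq lft_def)
    qed
  qed
qed

section \<open>The raising operator on patterns\<close>

context pattern begin

text \<open>The mirror image of \<open>frow_lft\<close>, with the row above: its peak is smaller, so
  it has fewer plus signs than row \<open>r\<close> has minus signs, and one more box with minimum
  \<open>i\<close> fits into row \<open>r\<close>.\<close>

lemma erow_lft:
  assumes "erow n i M X r" and "1 \<le> i" and ns: "\<not> (X r (Suc i) \<and> \<not> X r i \<and> M r i = M r (i - 1))"
  shows "M r i < M r (Suc i)" and "r = Suc k \<Longrightarrow> 1 \<le> k \<Longrightarrow> M r i < lft M X k i"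
proof -
  have "M r (i - 1) \<le> M r i" by (rule M_mono) simp
  then have le: "lft M X r i \<le> lft M X r (Suc i)"
    using ns by (auto simp: lft_def)
  then have rm: "rminus M X i r = M r (Suc i) - M r i" by (simp add: rminus_def)
  then show "M r i < M r (Suc i)" using assms(1) by (simp add: erow_def)
  assume k: "r = Suc k" "1 \<le> k"
  have "rplus M X i k < rminus M X i r"
    using assms(1) peak_Suc[of k n i M X] k by (auto simp: erow_def)
  then show "M r i < lft M X k i"
    using rm M_le_lft[of k "Suc i"] k by (simp add: rplus_def)
qed

lemma erow_swap:
  assumes "erow n i M X r" and "1 \<le> i" and "X r (Suc i)" "M r i = M r (i - 1)"
  shows "M (Suc r) i < M r (i - 1)"
proof -
  have "M (Suc r) i \<le> M (Suc r) (Suc i)" by (rule M_mono1)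
  also have "\<dots> \<le> lft M X r (Suc i)" using assms by (intro M_le_lft) (auto simp: erow_def)
  finally show ?thesis using assms by (simp add: lft_def)
qed

end

lemma pattern_erow_act:
  assumes "pattern n M X" "erow n i M X r" "1 \<le> i" "i < n" "erow_act i r (M, X) = (M', X')"
  shows "pattern n M' X'"
proof -
  interpret pattern n M X by fact
  have r: "1 \<le> r" "r \<le> n" using assms(2) by (auto simp: erow_def)
  show ?thesis
  proof (cases "X r (Suc i) \<and> \<not> X r i \<and> M r i = M r (i - 1)")
    case False
    then have eq: "M' = M(r := (M r)(i := M r i + 1))" "X' = X"
      using assms(5) by (auto simp: erow_act_def)
    note l = erow_lft[OF assms(2,3) False]
    have lt: "M r (i - 1) \<le> M r i" by (rule M_mono) simp
    show ?thesis
    proof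
      fix k j
      show "M' k 0 = 0" using assms(3) by (simp add: eq M_0)
      show "M' 0 j = 0" using r by (simp add: eq M_row0)
      show "M' k j \<le> M' k (Suc j)"
        using M_mono1[of k j] l(1) assms(3) by (auto simp: eq) 
      show "M' k j = M' k n" if "n \<le> j"
        using that M_stable[of j k] assms(4) by (auto simp: eq)
      show "1 \<le> k \<and> 1 \<le> j \<and> j \<le> n" if "X' k j" using that X_range by (simp add: eq)
      show "M' (Suc k) j \<le> lft M' X' k j" if kj: "1 \<le> k" "1 \<le> j"
        using M_le_lft[OF kj] l(1) l(2)[of k] kj assms(3)
        by (cases j; cases "k = r"; cases "Suc k = r"; cases "j = Suc i"; cases "j = i")
          (simp_all add: eq lft_def)
    qed
  next
    case True
    then have eq: "M' = M" "X' = X(r := (X r)(i := True, Suc i := False))"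
      using assms(5) by (auto simp: erow_act_def)
    note x = erow_swap[OF assms(2,3)]
    show ?thesis
    proof
      fix k j
      show "M' k 0 = 0" by (simp add: eq M_0)
      show "M' 0 j = 0" using r by (simp add: eq M_row0)
      show "M' k j \<le> M' k (Suc j)" by (simp add: eq M_mono1)
      show "M' k j = M' k n" if "n \<le> j" using that M_stable[of j k] by (simp add: eq)
      show "1 \<le> k \<and> 1 \<le> j \<and> j \<le> n" if "X' k j"
        using that X_range[of k j] r assms(3,4) by (auto simp: eq split: if_splits)
      show "M' (Suc k) j \<le> lft M' X' k j" if kj: "1 \<le> k" "1 \<le> j"
        using M_le_lft[OF kj] x True kj assms(3) by (auto simp: eq lft_def split: if_splits)
    qed
  qed
qed

section \<open>Lowering and raising are mutually inverse\<close>

text \<open>Here \<open>d\<close> is 1 for \<open>f\<^sub>i\<close> and -1 for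
  \<open>e\<^sub>i\<close>. Turning an \<open>i\<close> into \<open>i + 1\<close> in row
  \<open>r\<close> lowers all sums read after that row by 2, while the peak of \<open>r\<close>
  itself sees only the plus signs of the row.\<close>

lemma peak_change:
  assumes eq: "\<And>k. k \<noteq> r \<Longrightarrow> M' k = M k" "\<And>k. k \<noteq> r \<Longrightarrow> X' k = X k"
    and r: "1 \<le> r" "r \<le> n"
    and cnt: "cnt M' X' i r - cnt M' X' (Suc i) r = cnt M X i r - cnt M X (Suc i) r - 2 * d"
  shows "r < k \<Longrightarrow> peak n i M' X' k = peak n i M X k"
    and "peak n i M' X' r = peak n i M X r + rplus M' X' i r - rplus M X i r"
    and "k < r \<Longrightarrow> peak n i M' X' k = peak n i M X k - 2 * d"
proof -
  have c: "cnt M' X' j k = cnt M X j k" "rplus M' X' i k = rplus M X i k" if "k \<noteq> r" for j k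
    using eq that by (simp_all add: cnt_def rplus_def lft_def)
  show "peak n i M' X' k = peak n i M X k" if "r < k"
    using that by (simp add: peak_def c)
  show "peak n i M' X' r = peak n i M X r + rplus M' X' i r - rplus M X i r"
    by (simp add: peak_def c)
  show "peak n i M' X' k = peak n i M X k - 2 * d" if "k < r"
  proof -
    have "r \<in> {k<..n}" using that r by simp
    note sr = sum.remove[OF finite_greaterThanAtMost this]
    show ?thesis
      using that cnt by (simp add: peak_def c sr)
  qed
qed

text \<open>The peaks of lower rows stay, that of \<open>r\<close> drops by 1, and those of higher
  rows drop by 2. As peaks are integers, the first maximum thereby becomes the last one.\<close>

lemma erow_frow_act:
  assumes "pattern n M X" "frow n i M X r" "1 \<le> i" "frow_act i r (M, X) = (M', X')"
  shows "erow n i M' X' r" "erow_act i r (M', X') = (M, X)"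
proof -
  interpret pattern n M X by fact
  have r: "1 \<le> r" "r \<le> n" using assms(2) by (auto simp: frow_def)
  note l = frow_lft(2)[OF assms(2,3)]
  have m: "M r (i - 1) \<le> M r i" "M r i \<le> M r (Suc i)" by (rule M_mono; simp)+
  have i': "i - Suc 0 \<noteq> i" using assms(3) by simp
  have *: "erow_act i r (M', X') = (M, X) \<and> 0 < rminus M' X' i r \<and>
     rplus M' X' i r = rplus M X i r - 1 \<and> (\<forall>k. k \<noteq> r \<longrightarrow> M' k = M k \<and> X' k = X k) \<and>
     cnt M' X' i r - cnt M' X' (Suc i) r = cnt M X i r - cnt M X (Suc i) r - 2 * 1"
  proof (cases "M r i = M r (i - 1)")
    case False
    then have eq: "M' = M(r := (M r)(i := M r i - 1))" "X' = X"
      using assms(4) by (auto simp: frow_act_def)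
    have l': "lft M' X' r i = lft M X r i" "lft M' X' r (Suc i) = lft M X r (Suc i) - 1"
      "M' r i = M r i - 1" "M' r (Suc i) = M r (Suc i)"
      using assms(3) by (auto simp: eq lft_def)
    have "\<not> (X r (Suc i) \<and> \<not> X r i \<and> M r i - 1 = M r (i - 1))"
      using l by (auto simp: lft_def)
    then have "erow_act i r (M', X') = (M, X)"
      using i' by (auto simp: eq erow_act_def)
    then show ?thesis using l m by (simp add: l' rminus_def rplus_def cnt_def) (simp add: eq)
  next
    case True
    then have eq: "M' = M" "X' = X(r := (X r)(i := False, Suc i := True))"
      using assms(4) by (auto simp: frow_act_def)
    note x = frow_X[OF assms(2,3) True]
    show ?thesis using l m True x assms(3)
      by (auto simp: eq erow_act_def rminus_def rplus_def cnt_def lft_def max_def fun_eq_iff)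
  qed
  then show "erow_act i r (M', X') = (M, X)" by blast
  have rp: "rplus M' X' i r = rplus M X i r - 1" and eq: "\<And>k. k \<noteq> r \<Longrightarrow> M' k = M k" "\<And>k. k \<noteq> r \<Longrightarrow> X' k = X k"
    and c: "cnt M' X' i r - cnt M' X' (Suc i) r = cnt M X i r - cnt M X (Suc i) r - 2 * 1"
    using * by blast+
  note pc = peak_change[OF eq r c]
  have pk: "r < k \<Longrightarrow> peak n i M' X' k = peak n i M X k"
    "peak n i M' X' r = peak n i M X r - 1"
    "k < r \<Longrightarrow> peak n i M' X' k = peak n i M X k - 2" for k
    using pc(1) pc(2) pc(3)[of k] rp by simp_all
  show "erow n i M' X' r"
    unfolding erow_def
  proof (intro conjI allI impI)
    fix k
    show "peak n i M' X' k \<le> peak n i M' X' r" if "r < k \<and> k \<le> n"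
      using assms(2) that pk(1)[of k] pk(2) by (auto simp: frow_def)
    show "peak n i M' X' k < peak n i M' X' r" if "1 \<le> k \<and> k < r"
    proof -
      have "peak n i M X k \<le> peak n i M X r" using assms(2) that by (simp add: frow_def)
      then show ?thesis using that pk(2) pk(3)[of k] by simp
    qed
  qed (use assms(2) * pk(2) in \<open>auto simp: frow_def\<close>)
qed

lemma frow_erow_act:
  assumes "pattern n M X" "erow n i M X r" "1 \<le> i" "erow_act i r (M, X) = (M', X')"
  shows "frow n i M' X' r" "frow_act i r (M', X') = (M, X)"
proof -
  interpret pattern n M X by fact
  have r: "1 \<le> r" "r \<le> n" using assms(2) by (auto simp: erow_def)
  have m: "M r (i - 1) \<le> M r i" "M r i \<le> M r (Suc i)" by (rule M_mono; simp)+
  have i': "i - Suc 0 \<noteq> i" using assms(3) by simp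
  have *: "frow_act i r (M', X') = (M, X) \<and>
     rplus M' X' i r = rplus M X i r + 1 \<and> (\<forall>k. k \<noteq> r \<longrightarrow> M' k = M k \<and> X' k = X k) \<and>
     cnt M' X' i r - cnt M' X' (Suc i) r = cnt M X i r - cnt M X (Suc i) r - 2 * (-1)"
  proof (cases "X r (Suc i) \<and> \<not> X r i \<and> M r i = M r (i - 1)")
    case False
    then have eq: "M' = M(r := (M r)(i := M r i + 1))" "X' = X"
      using assms(4) by (auto simp: erow_act_def)
    have l': "lft M' X' r i = lft M X r i" "lft M' X' r (Suc i) = lft M X r (Suc i) + 1"
      "M' r i = M r i + 1" "M' r (Suc i) = M r (Suc i)"
      using assms(3) by (auto simp: eq lft_def)
    have "frow_act i r (M', X') = (M, X)"
      using i' m by (simp add: eq frow_act_def)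
    moreover have "lft M X r i \<le> lft M X r (Suc i)" using False m by (auto simp: lft_def)
    ultimately show ?thesis using m by (simp add: l' rplus_def cnt_def) (simp add: eq)
  next
    case True
    then have eq: "M' = M" "X' = X(r := (X r)(i := True, Suc i := False))"
      using assms(4) by (auto simp: erow_act_def)
    have l': "lft M' X' r i = lft M X r i - 1" "lft M' X' r (Suc i) = lft M X r (Suc i) + 1"
      "lft M X r i = M r i" "lft M X r (Suc i) = M r i - 1"
      using assms(3) True by (auto simp: eq lft_def)
    have "frow_act i r (M', X') = (M, X)"
      using i' True by (auto simp: eq frow_act_def fun_eq_iff)
    then show ?thesis using m by (simp add: l' rplus_def cnt_def) (simp add: eq)
  qed
  then show "frow_act i r (M', X') = (M, X)" by blast
  have rp: "rplus M' X' i r = rplus M X i r + 1" and eq: "\<And>k. k \<noteq> r \<Longrightarrow> M' k = M k" "\<And>k. k \<noteq> r \<Longrightarrow> X' k = X k"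
    and c: "cnt M' X' i r - cnt M' X' (Suc i) r = cnt M X i r - cnt M X (Suc i) r - 2 * (-1)"
    using * by blast+
  note pc = peak_change[OF eq r c]
  have pk: "r < k \<Longrightarrow> peak n i M' X' k = peak n i M X k"
    "peak n i M' X' r = peak n i M X r + 1"
    "k < r \<Longrightarrow> peak n i M' X' k = peak n i M X k + 2" for k
    using pc(1) pc(2) pc(3)[of k] rp by simp_all
  show "frow n i M' X' r"
    unfolding frow_def
  proof (intro conjI allI impI)
    fix k
    show "peak n i M' X' k < peak n i M' X' r" if "r < k \<and> k \<le> n"
    proof -
      have "peak n i M X k \<le> peak n i M X r" using assms(2) that by (simp add: erow_def)
      then show ?thesis using that pk(1)[of k] pk(2) by simp
    qed
    show "peak n i M' X' k \<le> peak n i M' X' r" if "1 \<le> k \<and> k < r"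
    proof -
      have "peak n i M X k < peak n i M X r" using assms(2) that by (simp add: erow_def)
      then show ?thesis using that pk(2) pk(3)[of k] by simp
    qed
  qed (use assms(2) pk(2) in \<open>auto simp: erow_def\<close>)
qed

lemma f_pat_pattern:
  assumes "pattern n M X" "1 \<le> i" "i < n" "f_pat n i (M, X) = Some (M', X')"
  shows "pattern n M' X'" "e_pat n i (M', X') = Some (M, X)"
proof -
  obtain r where r: "frow n i M X r" "frow_act i r (M, X) = (M', X')"
    using assms(4) by (auto elim: f_pat_SomeE)
  show "pattern n M' X'" by (rule pattern_frow_act[OF assms(1) r(1) assms(2,3) r(2)])
  show "e_pat n i (M', X') = Some (M, X)"
    using erow_frow_act[OF assms(1) r(1) assms(2) r(2)] by (simp add: e_pat_erow)
qed

lemma e_pat_pattern: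
  assumes "pattern n M X" "1 \<le> i" "i < n" "e_pat n i (M, X) = Some (M', X')"
  shows "pattern n M' X'" "f_pat n i (M', X') = Some (M, X)"
proof -
  obtain r where r: "erow n i M X r" "erow_act i r (M, X) = (M', X')"
    using assms(4) by (auto elim: e_pat_SomeE)
  show "pattern n M' X'" by (rule pattern_erow_act[OF assms(1) r(1) assms(2,3) r(2)])
  show "f_pat n i (M', X') = Some (M, X)"
    using frow_erow_act[OF assms(1) r(1) assms(2) r(2)] by (simp add: f_pat_frow)
qed

section \<open>Moving nonminimal entries down one row\<close>

text \<open>The bit is on after \<open>j\<close> if some inserted letter at most \<open>j\<close>
  has joined a box whose old entry, if any, exceeds \<open>j\<close>. An old entry
  \<open>j + 1\<close> switches it off, an inserted letter \<open>j + 1\<close> switches it on.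
  While it is on, the new row has one more box with small minimum than the old one.\<close>

primrec carry :: "(nat \<Rightarrow> bool) \<Rightarrow> (nat \<Rightarrow> int) \<Rightarrow> nat \<Rightarrow> bool" where
  "carry x m 0 = False"
| "carry x m (Suc j) = (x (Suc j) \<or> carry x m j \<and> m (Suc j) = m j)"

definition slide_M :: "(nat \<Rightarrow> bool) \<Rightarrow> (nat \<Rightarrow> int) \<Rightarrow> nat \<Rightarrow> int" where
  "slide_M x m j = m j + of_bool (carry x m j)"

text \<open>With a letter pending, \<open>j\<close> becomes nonminimal in two ways: as the old entry
  of the joined box, or as a further letter joining the same box. If both an old and an inserted
  \<open>j\<close> are present, the old one becomes nonminimal and the inserted one is pending for
  the next box.\<close>

definition slide_X :: "(nat \<Rightarrow> bool) \<Rightarrow> (nat \<Rightarrow> int) \<Rightarrow> nat \<Rightarrow> bool" where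
  "slide_X x m j \<longleftrightarrow> j \<noteq> 0 \<and> carry x m (j - 1) \<and> (x j \<or> m j \<noteq> m (j - 1))"

definition slide :: "nat \<Rightarrow> pat \<Rightarrow> pat" where
  "slide q = (\<lambda>(M, X). (M(Suc q := slide_M (X q) (M (Suc q))),
     X(q := (\<lambda>_. False), Suc q := slide_X (X q) (M (Suc q)))))"

context pattern begin

text \<open>The box gained by row \<open>q + 1\<close> needs a box with smaller minimum above it.
  There is one when the letter leaves row \<open>q\<close>, because its mark lowers
  \<open>lft\<close>; it remains available while the bit survives, since row \<open>q + 1\<close>
  does not grow meanwhile.\<close>

lemma carry_le_lft:
  assumes "1 \<le> q"
  shows "carry (X q) (M (Suc q)) j \<Longrightarrow> M (Suc q) j + 1 \<le> M q (j - 1)"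
proof (induction j)
  case (Suc j)
  show ?case
  proof (cases "X q (Suc j)")
    case True
    then show ?thesis using M_le_lft[of q "Suc j"] assms by (simp add: lft_def)
  next
    case False
    then show ?thesis
      using Suc M_mono[of "j - 1" j q] by simp
  qed
qed simp

lemma carry_stable: "n \<le> j \<Longrightarrow> carry (X q) (M (Suc q)) j = carry (X q) (M (Suc q)) n"
proof (induction j rule: dec_induct)
  case (step j)
  then have "\<not> X q (Suc j)" "M (Suc q) (Suc j) = M (Suc q) j"
    using X_range[of q "Suc j"] M_stable[of j "Suc q"] M_stable[of "Suc j" "Suc q"] by auto
  then show ?case using step by simp
qed simp

lemma pattern_slide:
  assumes q: "1 \<le> q" "\<And>j. \<not> X (Suc q) j" and "slide q (M, X) = (M', X')"
  shows "pattern n M' X'"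
proof -
  let ?s = "carry (X q) (M (Suc q))"
  have eq: "M' = M(Suc q := slide_M (X q) (M (Suc q)))"
     "X' = X(q := (\<lambda>_. False), Suc q := slide_X (X q) (M (Suc q)))"
    using assms(3) by (auto simp: slide_def)
  show ?thesis
  proof
    fix k j
    show "M' k 0 = 0" by (simp add: eq slide_M_def M_0)
    show "M' 0 j = 0" by (simp add: eq M_row0)
    show "M' k j \<le> M' k (Suc j)"
      using M_mono1[of k j] by (auto simp: eq slide_M_def)
    show "M' k j = M' k n" if "n \<le> j"
      using that M_stable[of j] carry_stable[of j q] by (simp add: eq slide_M_def)
    show "1 \<le> k \<and> 1 \<le> j \<and> j \<le> n" if x: "X' k j"
    proof (cases "k = Suc q")
      case True
      then have *: "j \<noteq> 0" "X q j \<or> M k j \<noteq> M k (j - 1)"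
        using x by (auto simp: eq slide_X_def)
      then have "j \<le> n"
        using X_range[of q j] M_stable[of j k] M_stable[of "j - 1" k] by (cases "j \<le> n") auto
      then show ?thesis using * True by simp
    next
      case False
      then show ?thesis using x X_range[of k j] by (auto simp: eq split: if_splits)
    qed
    show "M' (Suc k) j \<le> lft M' X' k j" if kj: "1 \<le> k" "1 \<le> j"
    proof -
      consider "k = q" | "k = Suc q" | "k \<noteq> q" "k \<noteq> Suc q" by blast
      then show ?thesis
      proof cases
        case 1
        then show ?thesis
          using carry_le_lft[OF q(1), of j] order_trans[OF M_le_lft lft_le_pred, of q j] kj
          by (auto simp: eq lft_def slide_M_def)
      next
        case 2
        then show ?thesis
          using M_le_lft[of k j] kj q by (auto simp: eq lft_def slide_M_def slide_X_def)
      next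
        case 3
        then show ?thesis using M_le_lft[of k j] kj by (auto simp: eq lft_def)
      qed
    qed
  qed
qed

end

section \<open>Compatibility of one downward step with the lowering operator\<close>

text \<open>The operator changes data at \<open>i\<close> and \<open>i + 1\<close> only. If the two
  scans agree after \<open>i + 1\<close>, they agree from there on, so only the bit at
  \<open>i\<close> needs inspection.\<close>

lemma carry_cong:
  assumes "\<And>j. j \<noteq> i \<Longrightarrow> j \<noteq> Suc i \<Longrightarrow> x' j = x j" "\<And>j. j \<noteq> i \<Longrightarrow> m' j = m j"
    and "carry x' m' (Suc i) = carry x m (Suc i)" and "j \<noteq> i"
  shows "carry x' m' j = carry x m j"
proof (cases "j < i")
  case True
  then show ?thesis by (induction j) (simp_all add: assms)
next
  case False
  then have "Suc i \<le> j" using assms(4) by simp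
  then show ?thesis
  proof (induction j rule: dec_induct)
    case base
    show ?case by fact
  qed (simp add: assms(1,2))
qed

lemma slide_frow_act_other:
  assumes "r \<noteq> q" "r \<noteq> Suc q"
  shows "slide q (frow_act i r (M, X)) = frow_act i r (slide q (M, X))"
  using assms by (auto simp: slide_def frow_act_def fun_upd_twist)

text \<open>Of row \<open>q\<close>, the step reads the marks but not the minima.\<close>

lemma slide_frow_act_upper:
  assumes "M q i \<noteq> M q (i - 1)"
  shows "slide q (frow_act i q (M, X)) = frow_act i q (slide q (M, X))"
  using assms by (simp add: slide_def frow_act_def fun_upd_twist)

text \<open>The case in which the box of row \<open>q\<close> changed by the operator is moved to row \<open>q + 1\<close>.\<close>

lemma slide_frow_act_moved:
  assumes i: "1 \<le> i" and x: "X q i" "\<not> X q (Suc i)" and m: "M q i = M q (i - 1)"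
    and b: "M (Suc q) (Suc i) = M (Suc q) i" "M (Suc q) (i - 1) \<le> M (Suc q) i"
  shows "slide q (frow_act i q (M, X)) = frow_act i (Suc q) (slide q (M, X))"
proof -
  obtain h where h: "i = Suc h" using i by (cases i) auto
  let ?m = "M (Suc q)" and ?x = "X q" and ?x' = "(X q)(i := False, Suc i := True)"
  have si: "carry ?x ?m i" by (simp add: h x[unfolded h])
  \<comment> \<open>A mark \<open>i\<close> switches the bit on, and it survives
    \<open>i + 1\<close> because row \<open>q + 1\<close> has no minimal \<open>i + 1\<close>; the
    renamed mark switches it on at \<open>i + 1\<close>. Either way it is on after
    \<open>i + 1\<close>.\<close>
  then have s: "carry ?x' ?m j = carry ?x ?m j" if "j \<noteq> i" for j
    by (intro carry_cong[OF _ _ _ that]) (simp_all add: b)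
  have si': "carry ?x' ?m i \<longleftrightarrow> carry ?x ?m h \<and> ?m i = ?m h"
    using s[of h] by (simp add: h)
  \<comment> \<open>Whether the new row \<open>q + 1\<close> has a minimal \<open>i\<close> decides
    between the two branches of \<open>frow_act\<close>; this is governed by the bit at
    \<open>i\<close> of the scan with the renamed mark.\<close>
  have nz: "slide_M ?x ?m i = slide_M ?x ?m (i - 1) \<longleftrightarrow> carry ?x' ?m i"
    using b si s[of h] by (auto simp: si' slide_M_def h)
  have M': "slide_M ?x' ?m = (if carry ?x' ?m i then slide_M ?x ?m
      else (slide_M ?x ?m)(i := slide_M ?x ?m i - 1))"
  proof
    fix j
    show "slide_M ?x' ?m j = (if carry ?x' ?m i then slide_M ?x ?m
      else (slide_M ?x ?m)(i := slide_M ?x ?m i - 1)) j"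
      using s[of j] si by (cases "j = i") (simp_all add: slide_M_def)
  qed
  have X': "slide_X ?x' ?m = (if carry ?x' ?m i
      then (slide_X ?x ?m)(i := False, Suc i := True) else slide_X ?x ?m)"
  proof
    fix j
    consider "j = i" | "j = Suc i" | "j \<noteq> i" "j \<noteq> Suc i" by blast
    then show "slide_X ?x' ?m j = (if carry ?x' ?m i
      then (slide_X ?x ?m)(i := False, Suc i := True) else slide_X ?x ?m) j"
    proof cases
      case 1
      then show ?thesis using s[of h] si' x by (auto simp: slide_X_def h)
    next
      case 2
      then show ?thesis using b(1) x by (auto simp: slide_X_def)
    next
      case 3
      then show ?thesis using s[of "j - 1"] by (cases j) (auto simp: slide_X_def)
    qed
  qed
  have "frow_act i q (M, X) = (M, X(q := ?x'))" using m by (simp add: frow_act_def)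
  then show ?thesis
    using nz by (auto simp: slide_def frow_act_def M' X')
qed

text \<open>The last hypothesis excludes the situation of \<open>slide_frow_act_moved\<close>: an
  \<open>i\<close> comes down from row \<open>q\<close> and neither a marked \<open>i + 1\<close> in
  row \<open>q\<close> nor a minimal \<open>i + 1\<close> in row \<open>q + 1\<close> follows
  it.\<close>

lemma slide_frow_act_lower:
  assumes i: "1 \<le> i" and x: "\<And>j. \<not> X (Suc q) j" and m: "M (Suc q) i \<noteq> M (Suc q) (i - 1)"
    and mono: "M (Suc q) (i - 1) \<le> M (Suc q) i" "M (Suc q) i \<le> M (Suc q) (Suc i)"
    and b: "X q i \<Longrightarrow> X q (Suc i) \<or> M (Suc q) (Suc i) \<noteq> M (Suc q) i"
  shows "slide q (frow_act i (Suc q) (M, X)) = frow_act i (Suc q) (slide q (M, X))"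
proof -
  obtain h where h: "i = Suc h" using i by (cases i) auto
  let ?m = "M (Suc q)" and ?m' = "(M (Suc q))(i := M (Suc q) i - 1)" and ?x = "X q"
  have si: "carry ?x ?m i \<longleftrightarrow> ?x i" using m by (simp add: h)
  have sSi: "carry ?x ?m (Suc i) \<longleftrightarrow> ?x (Suc i)" using b si by auto
  have s: "carry ?x ?m' j = carry ?x ?m j" if "j \<noteq> i" for j
    using mono(2) sSi by (intro carry_cong[OF _ _ _ that]) auto
  have si': "carry ?x ?m' i \<longleftrightarrow> ?x i \<or> (carry ?x ?m h \<and> ?m i = ?m h + 1)"
    using s[of h] by (auto simp: h)
  \<comment> \<open>The only old \<open>i\<close> of row \<open>q + 1\<close> is joined by a smaller
    pending letter and no new \<open>i\<close> arrives. In the new row \<open>i\<close> is then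
    merely nonminimal, so the operator, which changed a minimum before the step, renames a mark
    after it.\<close>
  define sw where "sw \<longleftrightarrow> carry ?x ?m h \<and> ?m i = ?m h + 1 \<and> \<not> ?x i"
  have nz: "slide_M ?x ?m i = slide_M ?x ?m (i - 1) \<longleftrightarrow> sw"
    using m mono si by (auto simp: sw_def slide_M_def h)
  have M': "slide_M ?x ?m' = (if sw then slide_M ?x ?m
      else (slide_M ?x ?m)(i := slide_M ?x ?m i - 1))"
  proof
    fix j
    show "slide_M ?x ?m' j = (if sw then slide_M ?x ?m
      else (slide_M ?x ?m)(i := slide_M ?x ?m i - 1)) j"
      using s[of j] si si' by (cases "j = i") (auto simp: slide_M_def sw_def)
  qed
  have X': "slide_X ?x ?m' = (if sw
      then (slide_X ?x ?m)(i := False, Suc i := True) else slide_X ?x ?m)"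
  proof
    fix j
    consider "j = i" | "j = Suc i" | "j \<noteq> i" "j \<noteq> Suc i" by blast
    then show "slide_X ?x ?m' j = (if sw
      then (slide_X ?x ?m)(i := False, Suc i := True) else slide_X ?x ?m) j"
    proof cases
      case 1
      then show ?thesis using s[of h] m by (auto simp: slide_X_def h sw_def)
    next
      case 2
      then show ?thesis using b mono(2) si si' by (auto simp: slide_X_def sw_def)
    next
      case 3
      then show ?thesis using s[of "j - 1"] by (cases j) (auto simp: slide_X_def)
    qed
  qed
  have "frow_act i (Suc q) (M, X) = (M(Suc q := ?m'), X)" using m by (simp add: frow_act_def)
  then show ?thesis
    using nz by (auto simp: slide_def frow_act_def M' X')
qed

lemma slide_apply:
  assumes "slide q (M, X) = (M', X')"
  shows "k \<noteq> Suc q \<Longrightarrow> M' k = M k" "M' (Suc q) = slide_M (X q) (M (Suc q))"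
    "k \<noteq> q \<Longrightarrow> k \<noteq> Suc q \<Longrightarrow> X' k = X k" "X' q = (\<lambda>_. False)"
    "X' (Suc q) = slide_X (X q) (M (Suc q))"
  using assms by (auto simp: slide_def)

text \<open>Inserted letters go from row \<open>q\<close> to row \<open>q + 1\<close>, and the
  bumped ones stay in their boxes as nonminimal entries.\<close>

lemma cnt_slide:
  assumes s: "slide q (M, X) = (M', X')" and x: "\<And>j. \<not> X (Suc q) j" and j: "1 \<le> j"
  shows "cnt M' X' j q + cnt M' X' j (Suc q) = cnt M X j q + cnt M X j (Suc q)"
proof -
  obtain h where "j = Suc h" using j by (cases j) auto
  then show ?thesis
    using x by (auto simp: cnt_def lft_def slide_apply[OF s] slide_M_def slide_X_def)
qed

lemma peak_slide_other:
  assumes s: "slide q (M, X) = (M', X')" and x: "\<And>j. \<not> X (Suc q) j"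
    and i: "1 \<le> i" and q: "1 \<le> q" "Suc q \<le> n" and k: "k \<noteq> q" "k \<noteq> Suc q"
  shows "peak n i M' X' k = peak n i M X k"
proof -
  have c: "cnt M' X' j l = cnt M X j l" "rplus M' X' i l = rplus M X i l"
    if "l \<noteq> q" "l \<noteq> Suc q" for j l
    using that by (simp_all add: cnt_def rplus_def lft_def slide_apply[OF s])
  have "(\<Sum>l\<in>{k<..n}. cnt M' X' i l - cnt M' X' (Suc i) l)
      = (\<Sum>l\<in>{k<..n}. cnt M X i l - cnt M X (Suc i) l)"
  proof (cases "k < q")
    case True
    then have *: "{q, Suc q} \<subseteq> {k<..n}" using q by auto
    show ?thesis
      unfolding sum.subset_diff[OF * finite_greaterThanAtMost]
      using cnt_slide[OF s x i] cnt_slide[OF s x, of "Suc i"]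
      by (simp add: c)
  next
    case False
    then show ?thesis using k by (intro sum.cong) (auto simp: c)
  qed
  then show ?thesis using k by (simp add: peak_def c)
qed

text \<open>Under \<open>mv\<close>, the plus sign of a descending \<open>i\<close> is read one row
  earlier, and row \<open>q + 1\<close> reaches the old peak of row \<open>q\<close> if row
  \<open>q\<close> has no minimal \<open>i\<close>. Otherwise only the peak of row \<open>q\<close>
  can change, and it drops only if row \<open>q + 1\<close>, read earlier, was at least as high, so
  that the first maximum is not concerned.\<close>

lemma peak_slide:
  assumes p: "pattern n M X" and s: "slide q (M, X) = (M', X')" and x: "\<And>j. \<not> X (Suc q) j"
    and i: "1 \<le> i" and q: "1 \<le> q" "Suc q \<le> n"
  defines "u \<equiv> peak n i M X" and "v \<equiv> peak n i M' X'"
  defines "mv \<equiv> X q i \<and> \<not> X q (Suc i) \<and> M (Suc q) (Suc i) = M (Suc q) i"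
  shows "mv \<Longrightarrow> v q = u q \<and> v (Suc q) = u (Suc q) + 1 \<and> u q = v (Suc q) + (M q i - M q (i - 1))"
    and "\<not> mv \<Longrightarrow> v (Suc q) = u (Suc q) \<and> (v q = u q \<or> v q < u q \<and> u q \<le> u (Suc q))"
proof -
  interpret pattern n M X by fact
  obtain h where h: "i = Suc h" using i by (cases i) auto
  have c: "cnt M' X' j l = cnt M X j l" if "l \<noteq> q" "l \<noteq> Suc q" for j l
    using that by (simp_all add: cnt_def lft_def slide_apply[OF s])
  have v: "v (Suc q) = u (Suc q) + rplus M' X' i (Suc q) - rplus M X i (Suc q)"
    by (simp add: u_def v_def peak_def c)
  have uq: "u q = u (Suc q) - rminus M X i (Suc q) + rplus M X i q"
    unfolding u_def using q(2) by (rule peak_Suc)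
  have vq: "v q = v (Suc q) - rminus M' X' i (Suc q) + rplus M' X' i q"
    unfolding v_def using q(2) by (rule peak_Suc)
  have m: "M q h \<le> M q i" "M (Suc q) h \<le> M (Suc q) i" "M (Suc q) i \<le> M (Suc q) (Suc i)"
    unfolding h by (rule M_mono1)+
  \<comment> \<open>The letters below \<open>i\<close> enter only through this bit. Together with
    the marks and the presence of minimal letters \<open>i\<close> and \<open>i + 1\<close> it
    resolves every truncation, leaving linear arithmetic.\<close>
  define c0 where "c0 = carry (X q) (M (Suc q)) h"
  note df = v uq vq rplus_def rminus_def lft_def slide_apply[OF s] slide_M_def slide_X_def h
  show "v q = u q \<and> v (Suc q) = u (Suc q) + 1 \<and> u q = v (Suc q) + (M q i - M q (i - 1))"
    if mv
    using that m x unfolding mv_def by (cases c0) (auto simp: df c0_def)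
  show "v (Suc q) = u (Suc q) \<and> (v q = u q \<or> v q < u q \<and> u q \<le> u (Suc q))" if "\<not> mv"
    using that m x unfolding mv_def
    by (cases c0; cases "X q i"; cases "X q (Suc i)"; cases "M (Suc q) (Suc i) = M (Suc q) i";
        cases "M (Suc q) i = M (Suc q) h"; cases "M q i = M q h")
      (simp_all add: df c0_def)
qed

lemma ex_frow_iff: "(\<exists>r. frow n i M X r) \<longleftrightarrow> (\<exists>k. 1 \<le> k \<and> k \<le> n \<and> 0 < peak n i M X k)"
proof
  let ?u = "peak n i M X"
  assume "\<exists>k. 1 \<le> k \<and> k \<le> n \<and> 0 < ?u k"
  then obtain k where k: "k \<in> {1..n}" "0 < ?u k" by auto
  define m where "m = Max (?u ` {1..n})"
  have m: "?u l \<le> m" if "l \<in> {1..n}" for l using that by (simp add: m_def)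
  define R where "R = {l \<in> {1..n}. ?u l = m}"
  have "m \<in> ?u ` {1..n}" unfolding m_def using k(1) by (intro Max_in) auto
  then have "R \<noteq> {}" "finite R" by (auto simp: R_def)
  then have R: "Max R \<in> R" "\<And>l. l \<in> R \<Longrightarrow> l \<le> Max R" by simp_all
  \<comment> \<open>The largest index among the rows of maximal peak is the one read first.\<close>
  have "frow n i M X (Max R)"
    unfolding frow_def
  proof (intro conjI allI impI)
    fix l
    show "?u l < ?u (Max R)" if "Max R < l \<and> l \<le> n"
    proof -
      have l: "l \<in> {1..n}" "l \<notin> R" using that R(2)[of l] by auto
      then show ?thesis using m[OF l(1)] R(1) by (auto simp: R_def)
    qed
    show "?u l \<le> ?u (Max R)" if "1 \<le> l \<and> l < Max R"
      using that m[of l] R(1) by (auto simp: R_def)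
  qed (use R(1) m[OF k(1)] k(2) in \<open>auto simp: R_def\<close>)
  then show "\<exists>r. frow n i M X r" ..
qed (auto simp: frow_def)

text \<open>No new peak exceeds the old maximum, and this maximum is first attained in the same row
  as before, unless the operator renames a mark \<open>i\<close> of row \<open>q\<close>. That mark
  has come down, and the maximum is then first attained in row \<open>q + 1\<close>.\<close>

lemma f_pat_slide:
  assumes p: "pattern n M X" and x: "\<And>j. \<not> X (Suc q) j"
    and i: "1 \<le> i" and q: "1 \<le> q" "Suc q \<le> n"
  shows "f_pat n i (slide q (M, X)) = map_option (slide q) (f_pat n i (M, X))"
proof -
  interpret pattern n M X by fact
  obtain M' X' where s: "slide q (M, X) = (M', X')" by fastforce
  note other = peak_slide_other[OF s x i q]
  note pk = peak_slide[OF p s x i q]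
  have m: "M k (i - 1) \<le> M k i" "M k i \<le> M k (Suc i)" for k by (rule M_mono; simp)+
  define mv where "mv \<longleftrightarrow> X q i \<and> \<not> X q (Suc i) \<and> M (Suc q) (Suc i) = M (Suc q) i"
  let ?u = "peak n i M X" and ?v = "peak n i M' X'"
  have le: "?v k \<le> ?u k \<or> mv \<and> k = Suc q \<and> ?v k \<le> ?u q" for k
    using pk[folded mv_def] m[of q] other[of k] by (cases mv; cases "k = q"; cases "k = Suc q") auto
  show ?thesis
  proof (cases "\<exists>r. frow n i M X r")
    case False
    have "\<not> (\<exists>r. frow n i M' X' r)"
    proof
      assume "\<exists>r. frow n i M' X' r"
      then obtain k where "1 \<le> k" "k \<le> n" "0 < ?v k" unfolding ex_frow_iff by blast
      then have "\<exists>k. 1 \<le> k \<and> k \<le> n \<and> 0 < ?u k" using le[of k] q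
        by (metis Suc_leD less_le_trans)
      then show False using False unfolding ex_frow_iff by blast
    qed
    then show ?thesis using False by (simp add: s f_pat_None)
  next
    case True
    then obtain r where r: "frow n i M X r" ..
    have rr: "1 \<le> r" "r \<le> n" "0 < ?u r" "\<And>k. r < k \<Longrightarrow> k \<le> n \<Longrightarrow> ?u k < ?u r"
      "\<And>k. 1 \<le> k \<Longrightarrow> k < r \<Longrightarrow> ?u k \<le> ?u r"
      using r by (auto simp: frow_def)
    have same: "frow n i M' X' r" if eq: "?v r = ?u r" and rq: "r = q \<Longrightarrow> ?v (Suc q) < ?u q"
      unfolding frow_def
    proof (intro conjI allI impI)
      fix k
      show "?v k < ?v r" if k: "r < k \<and> k \<le> n"
      proof (cases "mv \<and> k = Suc q \<and> ?v k \<le> ?u q")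
        case True
        then show ?thesis using rr(4)[of q] q rq k eq by (cases "r = q") auto
      next
        case False
        then show ?thesis using le[of k] rr(4)[of k] k eq by auto
      qed
      show "?v k \<le> ?v r" if k: "1 \<le> k \<and> k < r"
        using le[of k] rr(5)[of k] rr(5)[of q] q k eq by auto
    qed (use rr(1-3) eq in auto)
    consider "r \<noteq> q" "r \<noteq> Suc q" | "r = q" "M q i \<noteq> M q (i - 1)"
      | "r = q" "M q i = M q (i - 1)" | "r = Suc q" by blast
    then have "\<exists>r'. frow n i M' X' r' \<and> slide q (frow_act i r (M, X)) = frow_act i r' (M', X')"
    proof cases
      case 1
      then show ?thesis using same other slide_frow_act_other[OF 1] s by metis
    next
      case 2
      have "?v q = ?u q" "?v (Suc q) < ?u q"
        using pk[folded mv_def] rr(4)[of "Suc q"] q 2 m[of q] by (cases mv; auto)+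
      then show ?thesis using same 2 slide_frow_act_upper s by metis
    next
      case 3
      note fx = frow_X[OF r i, unfolded \<open>r = q\<close>, OF 3(2)]
      have "?u q = ?u (Suc q) - rminus M X i (Suc q) + rplus M X i q"
        using q(2) by (rule peak_Suc)
      moreover have "rplus M X i q = 1" using fx 3 by (simp add: rplus_def lft_def)
      \<comment> \<open>For row \<open>q\<close> to exceed the peak of row \<open>q + 1\<close>, its
        single plus sign must outweigh the minus signs of row \<open>q + 1\<close>, so there are
        none.\<close>
      ultimately have b: "M (Suc q) (Suc i) = M (Suc q) i"
        using rr(4)[of "Suc q"] q 3 m[of "Suc q"] by (auto simp: rminus_def)
      then have mv: mv using fx by (simp add: mv_def)
      have v: "?v (Suc q) = ?u q" using pk(1)[folded mv_def] mv 3 by simp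
      have "frow n i M' X' (Suc q)"
        unfolding frow_def
      proof (intro conjI allI impI)
        fix k
        show "?v k < ?v (Suc q)" if "Suc q < k \<and> k \<le> n"
          using that v rr(4)[of k] 3 other[of k] by simp
        show "?v k \<le> ?v (Suc q)" if "1 \<le> k \<and> k < Suc q"
          using that v rr(5)[of k] 3 le[of k] by (cases "k = q") auto
      qed (use rr(3) v q 3 in auto)
      then show ?thesis
        using slide_frow_act_moved[of i X q M] i fx 3 b m[of "Suc q"] s by auto
    next
      case 4
      \<comment> \<open>A descending \<open>i\<close> as in \<open>mv\<close> would mean that the
        old peak of row \<open>q\<close> exceeded that of row \<open>q + 1\<close>.\<close>
      have nmv: "\<not> mv" using pk(1)[folded mv_def] rr(5)[of q] q 4 m[of q] by auto
      then have "?v r = ?u r" using pk(2)[folded mv_def] 4 by simp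
      then have "frow n i M' X' (Suc q)" using same 4 by simp
      moreover have "M (Suc q) i \<noteq> M (Suc q) (i - 1)"
        using frow_X(1)[OF r i] x 4 by auto
      moreover have "X q i \<Longrightarrow> X q (Suc i) \<or> M (Suc q) (Suc i) \<noteq> M (Suc q) i"
        using nmv by (auto simp: mv_def)
      ultimately show ?thesis
        using slide_frow_act_lower[of i X q M] i x m[of "Suc q"] s 4 by auto
    qed
    then show ?thesis using r by (auto simp: s f_pat_frow)
  qed
qed

text \<open>The bits of \<open>carry\<close> recovered from the moved row, scanning the letters downwards from \<open>n\<close>; the
  last bit \<open>b\<close> records whether the row was extended.\<close>

primrec ucarry_down :: "nat \<Rightarrow> bool \<Rightarrow> (nat \<Rightarrow> bool) \<Rightarrow> (nat \<Rightarrow> int) \<Rightarrow> nat \<Rightarrow> bool" where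
  "ucarry_down n b x m 0 = b"
| "ucarry_down n b x m (Suc k) = (x (n - k) \<or> ucarry_down n b x m k \<and> m (n - k) = m (n - Suc k))"

definition ucarry :: "nat \<Rightarrow> bool \<Rightarrow> (nat \<Rightarrow> bool) \<Rightarrow> (nat \<Rightarrow> int) \<Rightarrow> nat \<Rightarrow> bool" where
  "ucarry n b x m j = ucarry_down n b x m (n - j)"

lemma ucarry_ge: "n \<le> j \<Longrightarrow> ucarry n b x m j = b"
  by (simp add: ucarry_def)

lemma ucarry_less:
  assumes "j < n"
  shows "ucarry n b x m j \<longleftrightarrow> x (Suc j) \<or> ucarry n b x m (Suc j) \<and> m (Suc j) = m j"
proof -
  have "n - j = Suc (n - Suc j)" "n - (n - Suc j) = Suc j" "n - Suc (n - Suc j) = j"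
    using assms by auto
  then show ?thesis by (simp add: ucarry_def)
qed

definition unslide_M :: "nat \<Rightarrow> bool \<Rightarrow> (nat \<Rightarrow> bool) \<Rightarrow> (nat \<Rightarrow> int) \<Rightarrow> nat \<Rightarrow> int" where
  "unslide_M n b x m j = m j - of_bool (ucarry n b x m j)"

definition unslide_X :: "nat \<Rightarrow> bool \<Rightarrow> (nat \<Rightarrow> bool) \<Rightarrow> (nat \<Rightarrow> int) \<Rightarrow> nat \<Rightarrow> bool" where
  "unslide_X n b x m j \<longleftrightarrow>
     1 \<le> j \<and> j \<le> n \<and> ucarry n b x m j \<and> (x j \<or> m j \<noteq> m (j - 1))"

definition unslide :: "nat \<Rightarrow> bool \<Rightarrow> nat \<Rightarrow> pat \<Rightarrow> pat" where
  "unslide n b q = (\<lambda>(M, X).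
     (M(Suc q := unslide_M n b (X (Suc q)) (M (Suc q))),
      X(q := unslide_X n b (X (Suc q)) (M (Suc q)), Suc q := (\<lambda>_. False))))"

context pattern begin

text \<open>If the forward bit was on before \<open>j + 1\<close>, either \<open>j + 1\<close>
  became a mark, or nothing happened at \<open>j + 1\<close> and the bit is still on with no jump in
  the row. If it was off and is on after \<open>j + 1\<close>, the inserted letter causes a jump. So
  marks and jumps of the new row determine the bits backwards.\<close>

lemma ucarry_slide:
  assumes "b = carry (X q) (M (Suc q)) n"
  shows "ucarry n b (slide_X (X q) (M (Suc q))) (slide_M (X q) (M (Suc q))) j
    = carry (X q) (M (Suc q)) j" (is "?u j = ?s j")
proof (cases "n \<le> j")
  case True
  then show ?thesis using assms carry_stable[of j q] by (simp add: ucarry_ge)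
next
  case False
  then have "j \<le> n" by simp
  then show ?thesis
  proof (induction j rule: inc_induct)
    case (step j)
    then show ?case
      using M_mono1[of "Suc q" j]
      by (auto simp: ucarry_less slide_X_def slide_M_def)
  qed (simp add: ucarry_ge assms)
qed

lemma unslide_slide:
  assumes q: "1 \<le> q" "\<And>j. \<not> X (Suc q) j" and b: "b = carry (X q) (M (Suc q)) n"
  shows "unslide n b q (slide q (M, X)) = (M, X)"
proof -
  let ?x = "slide_X (X q) (M (Suc q))" and ?m = "slide_M (X q) (M (Suc q))"
  note u = ucarry_slide[OF b]
  have "unslide_M n b ?x ?m = M (Suc q)"
    by (simp add: fun_eq_iff unslide_M_def u slide_M_def)
  moreover have "unslide_X n b ?x ?m = X q"
  proof
    fix j
    show "unslide_X n b ?x ?m j = X q j"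
    proof (cases "1 \<le> j \<and> j \<le> n")
      case True
      then obtain h where "j = Suc h" by (cases j) auto
      then show ?thesis
        using True M_mono1[of "Suc q" h]
        by (auto simp: unslide_X_def u slide_X_def slide_M_def)
    next
      case False
      then show ?thesis using X_range[of q j] by (auto simp: unslide_X_def)
    qed
  qed
  moreover have "X (Suc q) = (\<lambda>_. False)" using q(2) by auto
  ultimately show ?thesis by (auto simp: unslide_def slide_def fun_eq_iff)
qed

lemma ucarry_pos:
  assumes "b \<Longrightarrow> 0 < M (Suc q) n"
  shows "ucarry n b (X (Suc q)) (M (Suc q)) j \<Longrightarrow> 0 < M (Suc q) j" (is "?u j \<Longrightarrow> _")
proof (cases "n \<le> j")
  case True
  then show "?u j \<Longrightarrow> ?thesis" using assms M_stable[of j "Suc q"] by (simp add: ucarry_ge)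
next
  case False
  then have "j \<le> n" by simp
  then show "?u j \<Longrightarrow> ?thesis"
  proof (induction j rule: inc_induct)
    case (step j)
    have "1 \<le> M (Suc q) j" if "X (Suc q) (Suc j)"
      using lft_nonneg[of "Suc q" "Suc j"] that by (simp add: lft_def)
    then show ?case using step by (auto simp: ucarry_less)
  qed (use assms in \<open>simp add: ucarry_ge\<close>)
qed

text \<open>Row \<open>q + 2\<close> must still fit after a box of row \<open>q + 1\<close> is taken
  back. At the letter \<open>n\<close> this is the assumption that the last box is a corner; where a
  mark starts a bit, \<open>M_le_lft\<close> is strict enough by the mark.\<close>

lemma ucarry_below:
  assumes "b \<Longrightarrow> M (Suc (Suc q)) n < M (Suc q) n"
  shows "ucarry n b (X (Suc q)) (M (Suc q)) j \<Longrightarrow> M (Suc (Suc q)) (Suc j) < M (Suc q) j"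
    (is "?u j \<Longrightarrow> _")
proof (cases "n \<le> j")
  case True
  then show "?u j \<Longrightarrow> ?thesis"
    using assms M_stable[of j "Suc q"] M_stable[of "Suc j" "Suc (Suc q)"] by (simp add: ucarry_ge)
next
  case False
  then have "j \<le> n" by simp
  then show "?u j \<Longrightarrow> ?thesis"
  proof (induction j rule: inc_induct)
    case base
    then show ?case using assms M_stable[of "Suc n" "Suc (Suc q)"] by (simp add: ucarry_ge)
  next
    case (step j)
    have "M (Suc (Suc q)) (Suc j) < M (Suc q) j" if "X (Suc q) (Suc j)"
      using M_le_lft[of "Suc q" "Suc j"] that by (simp add: lft_def)
    then show ?case
      using step M_mono1[of "Suc (Suc q)" "Suc j"] by (auto simp: ucarry_less)
  qed
qed

lemma carry_unslide:
  assumes b: "b \<Longrightarrow> 0 < M (Suc q) n"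
  defines "x \<equiv> X (Suc q)" and "m \<equiv> M (Suc q)"
  shows "carry (unslide_X n b x m) (unslide_M n b x m) j = ucarry n b x m j" (is "_ = ?u j")
proof (induction j)
  case 0
  \<comment> \<open>The forward scan starts with the bit off, so the backward scan has to end with
    it off: a bit that is on needs a box, and no box has minimum at most 0.\<close>
  show ?case using ucarry_pos[of b q 0, OF b] M_0[of "Suc q"] by (auto simp: x_def m_def)
next
  case (Suc j)
  have mono: "m j \<le> m (Suc j)" by (simp add: m_def M_mono1)
  show ?case
  proof (cases "j < n")
    case True
    then show ?thesis
      using mono Suc by (auto simp: unslide_X_def unslide_M_def ucarry_less[of j])
  next
    case False
    then have "m (Suc j) = m j" using M_stable[of j "Suc q"] M_stable[of "Suc j" "Suc q"]
      by (simp add: m_def)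
    then show ?thesis
      using False Suc by (auto simp: unslide_X_def unslide_M_def ucarry_ge)
  qed
qed

lemma slide_unslide:
  assumes b: "b \<Longrightarrow> 0 < M (Suc q) n" and x: "\<And>j. \<not> X q j"
  shows "slide q (unslide n b q (M, X)) = (M, X)"
proof -
  let ?x = "X (Suc q)" and ?m = "M (Suc q)"
  let ?ux = "unslide_X n b ?x ?m" and ?um = "unslide_M n b ?x ?m"
  note c = carry_unslide[of b q, OF b]
  have "slide_M ?ux ?um = ?m"
    by (simp add: fun_eq_iff slide_M_def c unslide_M_def)
  moreover have "slide_X ?ux ?um = ?x"
  proof
    fix j
    show "slide_X ?ux ?um j = ?x j"
    proof (cases j)
      case 0
      then show ?thesis using X_range[of "Suc q" 0] by (auto simp: slide_X_def)
    next
      case (Suc h)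
      have mono: "?m h \<le> ?m (Suc h)" by (simp add: M_mono1)
      show ?thesis
      proof (cases "h < n")
        case True
        then show ?thesis
          using Suc mono by (auto simp: slide_X_def c unslide_X_def unslide_M_def ucarry_less[of h])
      next
        case False
        then have "\<not> ?x j" "?m (Suc h) = ?m h"
          using X_range[of "Suc q" j] Suc M_stable[of h "Suc q"] M_stable[of "Suc h" "Suc q"] by auto
        then show ?thesis
          using Suc False by (auto simp: slide_X_def c unslide_X_def unslide_M_def ucarry_ge)
      qed
    qed
  qed
  moreover have "X q = (\<lambda>_. False)" using x by auto
  ultimately show ?thesis by (auto simp: unslide_def slide_def fun_eq_iff)
qed

lemma pattern_unslide:
  assumes q: "1 \<le> q" "\<And>j. \<not> X q j" and b: "b \<Longrightarrow> M (Suc (Suc q)) n < M (Suc q) n"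
    and u: "unslide n b q (M, X) = (M', X')"
  shows "pattern n M' X'"
proof -
  let ?u = "ucarry n b (X (Suc q)) (M (Suc q))"
  have b': "b \<Longrightarrow> 0 < M (Suc q) n" using b M_nonneg[of "Suc (Suc q)" n] by simp
  have eq: "M' = M(Suc q := unslide_M n b (X (Suc q)) (M (Suc q)))"
    "X' = X(q := unslide_X n b (X (Suc q)) (M (Suc q)), Suc q := (\<lambda>_. False))"
    using u by (auto simp: unslide_def)
  show ?thesis
  proof
    fix k j
    show "M' k 0 = 0" using ucarry_pos[of b q 0, OF b'] by (auto simp: eq unslide_M_def M_0)
    show "M' 0 j = 0" by (simp add: eq M_row0)
    show "M' k j \<le> M' k (Suc j)"
    proof (cases "k = Suc q")
      case True
      then show ?thesis
        using M_mono1[of k j] 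
        by (cases "j < n") (auto simp: eq unslide_M_def ucarry_less[of j] ucarry_ge)
    next
      case False
      then show ?thesis using M_mono1[of k j] by (simp add: eq)
    qed
    show "M' k j = M' k n" if "n \<le> j"
      using that M_stable[of j] by (simp add: eq unslide_M_def ucarry_ge)
    show "1 \<le> k \<and> 1 \<le> j \<and> j \<le> n" if x: "X' k j"
      using x q X_range[of k j] by (auto simp: eq unslide_X_def split: if_splits)
    show "M' (Suc k) j \<le> lft M' X' k j" if kj: "1 \<le> k" "1 \<le> j"
    proof -
      consider "k = q" | "k = Suc q" | "k \<noteq> q" "k \<noteq> Suc q" by blast
      then show ?thesis
      proof cases
        case 1
        then show ?thesis
          using M_le_lft[of q j] lft_le_pred[of q j] kj q(2)[of j]
          by (auto simp: eq lft_def unslide_M_def unslide_X_def)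
      next
        case 2
        obtain h where "j = Suc h" using kj by (cases j) auto
        then show ?thesis
          using 2 order_trans[OF M_le_lft lft_le_pred, of k j] kj ucarry_below[of b q h, OF b]
          by (auto simp: eq lft_def unslide_M_def split: if_splits)
      next
        case 3
        then show ?thesis using M_le_lft[of k j] kj by (auto simp: eq lft_def)
      qed
    qed
  qed
qed

end

text \<open>A stage constrains a pattern only through its row lengths and its marked rows.
  Preserving both keeps the operator inside the stage with the recording tableau untouched.\<close>

lemma f_pat_frame:
  assumes "pattern n M X" "1 \<le> i" "i < n" "f_pat n i (M, X) = Some (M', X')"
  shows "M' r n = M r n" "X' r j \<Longrightarrow> \<exists>j. X r j"
proof -
  interpret pattern n M X by fact
  obtain k where k: "frow n i M X k" "frow_act i k (M, X) = (M', X')"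
    using assms(4) by (auto elim: f_pat_SomeE)
  show "M' r n = M r n" using k assms(3) by (auto simp: frow_act_def split: if_splits)
  show "\<exists>j. X r j" if "X' r j"
    using that k(2) frow_X(1)[OF k(1) assms(2)]
    by (auto simp: frow_act_def split: if_splits)
qed

lemma e_pat_frame:
  assumes "1 \<le> i" "i < n" "e_pat n i (M, X) = Some (M', X')"
  shows "M' r n = M r n" "X' r j \<Longrightarrow> \<exists>j. X r j"
proof -
  obtain k where k: "erow n i M X k" "erow_act i k (M, X) = (M', X')"
    using assms(3) by (auto elim: e_pat_SomeE)
  show "M' r n = M r n" using k assms(2) by (auto simp: erow_act_def split: if_splits)
  show "\<exists>j. X r j" if "X' r j"
    using that k(2) by (auto simp: erow_act_def split: if_splits)
qed

section \<open>Uncrowding with recording tableaux\<close>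

type_synonym state = "(nat \<Rightarrow> nat \<Rightarrow> int) \<times> (nat \<Rightarrow> nat \<Rightarrow> bool) \<times> (box \<Rightarrow> nat)"

text \<open>\<open>a\<close> gives the inner row lengths and \<open>M r n\<close> the outer ones. A
  positive label doubles as membership in the skew diagram.\<close>

definition skew_increasing :: "nat \<Rightarrow> (nat \<Rightarrow> nat) \<Rightarrow> (nat \<Rightarrow> nat \<Rightarrow> int) \<Rightarrow> (box \<Rightarrow> nat) \<Rightarrow> bool" where
  "skew_increasing n a M U \<longleftrightarrow>
     (\<forall>r. int (a r) \<le> M r n) \<and>
     (\<forall>r c. 0 < U (r, c) \<longleftrightarrow> a r < c \<and> int c \<le> M r n) \<and>
     (\<forall>r c c'. 0 < U (r, c) \<and> 0 < U (r, c') \<and> c < c' \<longrightarrow> U (r, c) < U (r, c')) \<and>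
     (\<forall>r r' c. 0 < U (r, c) \<and> 0 < U (r', c) \<and> r < r' \<longrightarrow> U (r, c) < U (r', c))"

text \<open>Intermediate stages of uncrowding: the nonminimal entries of all rows below row \<open>p\<close> have been
  removed, and those of row \<open>p\<close> have been moved down to row \<open>q\<close>.\<close>

definition stage :: "nat \<Rightarrow> (nat \<Rightarrow> nat) \<Rightarrow> nat \<Rightarrow> nat \<Rightarrow> state set" where
  "stage n a p q = {(M, X, U). pattern n M X \<and> skew_increasing n a M U \<and>
     (\<forall>r j. X r j \<longrightarrow> r < p \<or> r = q) \<and>
     (\<forall>r c. 0 < U (r, c) \<longrightarrow> U (r, c) + p + of_bool (q < r) \<le> r)}"

definition uncrowd :: "nat \<Rightarrow> nat \<Rightarrow> nat \<Rightarrow> state \<Rightarrow> state" where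
  "uncrowd n p q = (\<lambda>(M, X, U). let (M', X') = slide q (M, X) in
     (M', X', if carry (X q) (M (Suc q)) n then U((Suc q, nat (M' (Suc q) n)) := Suc q - p) else U))"

definition recrowd :: "nat \<Rightarrow> nat \<Rightarrow> nat \<Rightarrow> state \<Rightarrow> state" where
  "recrowd n p q = (\<lambda>(M, X, U).
     let b = (U (Suc q, nat (M (Suc q) n)) = Suc q - p); (M', X') = unslide n b q (M, X) in
     (M', X', if b then U((Suc q, nat (M (Suc q) n)) := 0) else U))"

text \<open>Rows not yet reached have labels at most \<open>r - p - 1\<close>, one less than the
  bound for rows already passed. So the new label \<open>Suc q - p\<close> is the largest of its
  row; it also exceeds all labels above it, whose rows are smaller. That no other label of the row
  attains it gives the inverse.\<close>

lemma uncrowd_stage: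
  assumes s: "(M, X, U) \<in> stage n a p q" and q: "1 \<le> p" "p \<le> q" "Suc q \<le> n"
  shows "uncrowd n p q (M, X, U) \<in> stage n a p (Suc q)" (is ?A)
    and "recrowd n p q (uncrowd n p q (M, X, U)) = (M, X, U)" (is ?B)
proof -
  from s interpret pattern n M X by (simp add: stage_def)
  have x: "\<not> X (Suc q) j" for j using s q by (auto simp: stage_def)
  have U: "0 < U (r, c) \<longleftrightarrow> a r < c \<and> int c \<le> M r n" for r c
    using s by (simp add: stage_def skew_increasing_def)
  have Urow: "0 < U (r, c) \<Longrightarrow> 0 < U (r, c') \<Longrightarrow> c < c' \<Longrightarrow> U (r, c) < U (r, c')" for r c c'
    using s by (simp add: stage_def skew_increasing_def)
  have Ucol: "0 < U (r, c) \<Longrightarrow> 0 < U (r', c) \<Longrightarrow> r < r' \<Longrightarrow> U (r, c) < U (r', c)" for r r' c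
    using s by (auto simp: stage_def skew_increasing_def)
  have flag: "0 < U (r, c) \<Longrightarrow> U (r, c) + p + of_bool (q < r) \<le> r" for r c
    using s by (simp add: stage_def)
  have a: "int (a r) \<le> M r n" for r using s by (simp add: stage_def skew_increasing_def)
  obtain M' X' where sl: "slide q (M, X) = (M', X')" by fastforce
  have q1: "1 \<le> q" using q by simp
  have p': "pattern n M' X'" by (rule pattern_slide[OF q1 x sl])
  have X': "r < p \<or> r = Suc q" if "X' r j" for r j
    using that s slide_apply[OF sl] by (cases "r = q"; cases "r = Suc q") (auto simp: stage_def)
  let ?b = "carry (X q) (M (Suc q)) n" and ?l = "Suc q - p"
  have l: "0 < ?l" using q by simp
  have M'n: "M' r n = M r n + of_bool (r = Suc q \<and> ?b)" for r
    using slide_apply[OF sl] by (cases "r = Suc q") (auto simp: slide_M_def)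
  define d where "d = nat (M' (Suc q) n)"
  have un: "unslide n ?b q (M', X') = (M, X)"
    using unslide_slide[OF q1 x refl] by (simp add: sl)
  have lastU: "U (Suc q, c) < ?l" for c
    using flag[of "Suc q" c] l by (cases "0 < U (Suc q, c)") auto
  show ?A
  proof (cases ?b)
    case False
    have "skew_increasing n a M' U"
      using s False by (simp add: stage_def skew_increasing_def M'n)
    moreover have "U (r, c) + p + of_bool (Suc q < r) \<le> r" if "0 < U (r, c)" for r c
      using flag[OF that] by (auto split: if_splits)
    ultimately show ?thesis
      using False p' X' by (auto simp: uncrowd_def sl stage_def)
  next
    case True
    have d: "int d = M (Suc q) n + 1" using M'n[of "Suc q"] True M_nonneg[of "Suc q" n]
      by (simp add: d_def)
    let ?U = "U((Suc q, d) := ?l)"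
    have d0: "U (Suc q, d) = 0" using U[of "Suc q" d] d by auto
    have flag': "?U (r, c) + p + of_bool (Suc q < r) \<le> r" if "0 < ?U (r, c)" for r c
      using that flag[of r c] q by (cases "(r, c) = (Suc q, d)") (auto split: if_splits)
    have "skew_increasing n a M' ?U"
      unfolding skew_increasing_def
    proof (intro conjI allI impI)
      fix r r' c c'
      show "int (a r) \<le> M' r n" using a[of r] by (auto simp: M'n)
      show "0 < ?U (r, c) \<longleftrightarrow> a r < c \<and> int c \<le> M' r n"
        using U[of r c] d l a[of "Suc q"] True by (auto simp: M'n)
      show "?U (r, c) < ?U (r, c')" if *: "0 < ?U (r, c) \<and> 0 < ?U (r, c') \<and> c < c'"
      proof (cases "r = Suc q")
        case r: True
        show ?thesis
        proof (cases "c = d")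
          case True
          then show ?thesis using * r U[of "Suc q" c'] d by auto
        next
          case False
          then show ?thesis using * r lastU[of c] Urow[of r c c'] by auto
        qed
      next
        case False
        then show ?thesis using * Urow[of r c c'] by auto
      qed
      show "?U (r, c) < ?U (r', c)" if *: "0 < ?U (r, c) \<and> 0 < ?U (r', c) \<and> r < r'"
      proof (cases "c = d")
        case c: True
        consider "r = Suc q" | "r' = Suc q" | "r \<noteq> Suc q" "r' \<noteq> Suc q" by blast
        then show ?thesis
        proof cases
          case 1
          \<comment> \<open>Nothing can lie under the new box: lower rows are at most as long as row
            \<open>q + 1\<close> was before it grew.\<close>
          then have "int d \<le> M r' n" using * c U[of r' d] by auto
          then show ?thesis using 1 * d M_antimono[of "Suc q" r' n] by simp
        next
          case 2
          then show ?thesis using * c flag[of r c] l by auto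
        next
          case 3
          then show ?thesis using * Ucol[of r c r'] by auto
        qed
      next
        case False
        then show ?thesis using * Ucol[of r c r'] by auto
      qed
    qed
    moreover have re: "uncrowd n p q (M, X, U) = (M', X', ?U)"
      using True by (simp add: uncrowd_def sl flip: d_def)
    ultimately show ?thesis
      using p' X' flag' unfolding re stage_def mem_Collect_eq case_prod_conv by blast
  qed
  show ?B
  proof (cases ?b)
    case True
    have d: "int d = M (Suc q) n + 1" using M'n[of "Suc q"] True M_nonneg[of "Suc q" n]
      by (simp add: d_def)
    have d0: "U (Suc q, d) = 0" using U[of "Suc q" d] d by auto
    show ?thesis using True un d0
      by (auto simp: uncrowd_def recrowd_def sl simp flip: d_def)
  next
    case False
    have "U (Suc q, d) \<noteq> ?l" using lastU[of d] by simp
    then show ?thesis using False un by (simp add: uncrowd_def recrowd_def sl flip: d_def)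
  qed
qed

lemma recrowd_stage:
  assumes s: "(M, X, U) \<in> stage n a p (Suc q)" and q: "1 \<le> p" "p \<le> q" "Suc q \<le> n"
    and anti: "\<And>r. 1 \<le> r \<Longrightarrow> a (Suc r) \<le> a r"
  shows "recrowd n p q (M, X, U) \<in> stage n a p q" (is ?A)
    and "uncrowd n p q (recrowd n p q (M, X, U)) = (M, X, U)" (is ?B)
proof -
  from s interpret pattern n M X by (simp add: stage_def)
  have x: "\<not> X q j" for j using s q by (auto simp: stage_def)
  have U: "0 < U (r, c) \<longleftrightarrow> a r < c \<and> int c \<le> M r n" for r c
    using s by (simp add: stage_def skew_increasing_def)
  have Urow: "0 < U (r, c) \<Longrightarrow> 0 < U (r, c') \<Longrightarrow> c < c' \<Longrightarrow> U (r, c) < U (r, c')" for r c c'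
    using s by (simp add: stage_def skew_increasing_def)
  have Ucol: "0 < U (r, c) \<Longrightarrow> 0 < U (r', c) \<Longrightarrow> r < r' \<Longrightarrow> U (r, c) < U (r', c)" for r r' c
    using s by (auto simp: stage_def skew_increasing_def)
  have flag: "0 < U (r, c) \<Longrightarrow> U (r, c) + p + of_bool (Suc q < r) \<le> r" for r c
    using s by (simp add: stage_def)
  have a: "int (a r) \<le> M r n" for r using s by (simp add: stage_def skew_increasing_def)
  have q1: "1 \<le> q" using q by simp
  let ?l = "Suc q - p"
  have l: "0 < ?l" using q by simp
  define d where "d = nat (M (Suc q) n)"
  have d: "int d = M (Suc q) n" by (simp add: d_def M_nonneg)
  define b where "b \<longleftrightarrow> U (Suc q, d) = ?l"
  obtain M' X' where ul: "unslide n b q (M, X) = (M', X')" by fastforce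
  have bpos: "a (Suc q) < d" if b using that U[of "Suc q" d] l by (simp add: b_def)
  \<comment> \<open>A box under the last box would need a label above \<open>Suc q - p\<close>, but
    row \<open>q + 2\<close> has not been reached and its labels are at most
    \<open>Suc q - p\<close>. The monotonicity of \<open>a\<close> guarantees that such a box would
    be labelled at all, that is, lie outside the inner shape.\<close>
  have corner: "M (Suc (Suc q)) n < M (Suc q) n" if b
  proof (rule ccontr)
    assume "\<not> ?thesis"
    then have "int d \<le> M (Suc (Suc q)) n" using d by simp
    then have pos: "0 < U (Suc (Suc q), d)"
      using U[of "Suc (Suc q)" d] bpos[OF that] anti[of "Suc q"] by simp
    then show False
      using Ucol[of "Suc q" d "Suc (Suc q)"] flag[of "Suc (Suc q)" d] that l by (simp add: b_def)
  qed
  have p': "pattern n M' X'" by (rule pattern_unslide[OF q1 x corner ul])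
  have pos: "0 < M (Suc q) n" if b
    using corner[OF that] M_nonneg[of "Suc (Suc q)" n] by simp
  have sl: "slide q (M', X') = (M, X)"
    using slide_unslide[of b q, OF pos x] by (simp add: ul)
  have M': "M' = M(Suc q := unslide_M n b (X (Suc q)) (M (Suc q)))"
    "X' = X(q := unslide_X n b (X (Suc q)) (M (Suc q)), Suc q := (\<lambda>_. False))"
    using ul by (auto simp: unslide_def)
  have M'n: "M' r n = M r n - of_bool (r = Suc q \<and> b)" for r
    by (auto simp: M' unslide_M_def ucarry_ge)
  have X': "r < p \<or> r = q" if "X' r j" for r j
    using that s by (auto simp: M' stage_def split: if_splits)
  have cb: "carry (X' q) (M' (Suc q)) n = b"
    using M'n[of "Suc q"] slide_apply(2)[OF sl] by (auto simp: slide_M_def)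
  have Ul: "U (Suc q, c) < ?l" if "c \<noteq> d \<or> \<not> b" for c
  proof (cases "0 < U (Suc q, c)")
    case True
    have le: "U (Suc q, c) \<le> ?l" using flag[OF True] by simp
    have "U (Suc q, c) < ?l" if "c \<noteq> d"
    proof -
      have "c < d" "0 < U (Suc q, d)" using True that U[of "Suc q"] d by auto
      then show ?thesis using Urow[OF True, of d] flag[of "Suc q" d] by simp
    qed
    then show ?thesis using that le by (cases "c = d") (auto simp: b_def)
  qed (use l in simp)
  let ?U = "if b then U((Suc q, d) := 0) else U"
  have Ueq: "?U (r, c) = (if b \<and> r = Suc q \<and> c = d then 0 else U (r, c))" for r c by auto
  have flag': "?U (r, c) + p + of_bool (q < r) \<le> r" if "0 < ?U (r, c)" for r c
  proof (cases "r = Suc q")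
    case True
    then have "0 < U (r, c)" "c \<noteq> d \<or> \<not> b" using that by (auto split: if_splits)
    then show ?thesis using Ul[of c] True q by (auto simp: Ueq)
  next
    case False
    then show ?thesis using that flag[of r c] by (auto simp: Ueq split: if_splits)
  qed
  have "skew_increasing n a M' ?U"
    unfolding skew_increasing_def
  proof (intro conjI allI impI)
    fix r r' c c'
    show "int (a r) \<le> M' r n" using a[of r] bpos d by (auto simp: M'n)
    show "0 < ?U (r, c) \<longleftrightarrow> a r < c \<and> int c \<le> M' r n"
      using U[of r c] d by (auto simp: Ueq M'n)
    show "?U (r, c) < ?U (r, c')" if *: "0 < ?U (r, c) \<and> 0 < ?U (r, c') \<and> c < c'"
      using * Urow[of r c c'] unfolding Ueq by (auto split: if_splits)
    show "?U (r, c) < ?U (r', c)" if *: "0 < ?U (r, c) \<and> 0 < ?U (r', c) \<and> r < r'"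
      using * Ucol[of r c r'] unfolding Ueq by (auto split: if_splits)
  qed
  moreover have re: "recrowd n p q (M, X, U) = (M', X', ?U)"
    by (simp add: recrowd_def Let_def ul flip: d_def b_def)
  ultimately show ?A
    using p' X' flag' unfolding re stage_def mem_Collect_eq case_prod_conv by blast
  show ?B
    by (simp add: re uncrowd_def sl cb flip: d_def) (simp add: b_def fun_eq_iff)
qed

section \<open>Composition and inversion of crystal isomorphisms\<close>

lemma crystal_isomorphism_comp:
  assumes "crystal_isomorphism n C D \<phi>" and "crystal_isomorphism n D E \<psi>"
  shows "crystal_isomorphism n C E (\<psi> \<circ> \<phi>)"
proof -
  have b: "bij_betw \<phi> (elems C) (elems D)" using assms(1) by (simp add: crystal_isomorphism_def)
  have comm: "commutes_on (elems C) (\<psi> \<circ> \<phi>) g k"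
    if "commutes_on (elems C) \<phi> g h" "commutes_on (elems D) \<psi> h k" for g h k
    using that bij_betwE[OF b] unfolding commutes_on_def
    by (metis comp_apply option.map_comp)
  show ?thesis
    using assms bij_betwE[OF b] unfolding crystal_isomorphism_def
    by (auto intro: bij_betw_trans comm)
qed

lemma isomorphic_crystals_trans:
  "isomorphic_crystals n C D \<Longrightarrow> isomorphic_crystals n D E \<Longrightarrow> isomorphic_crystals n C E"
  unfolding isomorphic_crystals_def using crystal_isomorphism_comp by blast

lemma crystal_isomorphism_id:
  assumes "\<And>i x y. 1 \<le> i \<Longrightarrow> i < n \<Longrightarrow> x \<in> elems C \<Longrightarrow> e_of C i x = Some y \<Longrightarrow> y \<in> elems C"
    and "\<And>i x y. 1 \<le> i \<Longrightarrow> i < n \<Longrightarrow> x \<in> elems C \<Longrightarrow> f_of C i x = Some y \<Longrightarrow> y \<in> elems C"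
  shows "crystal_isomorphism n C C id"
proof -
  have "set_option (e_of C i x) \<subseteq> elems C \<and> set_option (f_of C i x) \<subseteq> elems C"
    if "1 \<le> i" "i < n" "x \<in> elems C" for i x
    using assms(1)[OF that] assms(2)[OF that] by auto
  then show ?thesis by (simp add: crystal_isomorphism_def commutes_on_def option.map_id)
qed

lemma commutes_on_inv_into:
  assumes b: "bij_betw \<psi> A B" and c: "commutes_on A \<psi> g h"
  shows "commutes_on B (inv_into A \<psi>) h g"
  unfolding commutes_on_def
proof
  fix y assume y: "y \<in> B"
  define x where "x = inv_into A \<psi> y"
  have x: "x \<in> A" "\<psi> x = y" using b y by (auto simp: x_def bij_betw_inv_into_right bij_betw_def inv_into_into)
  have h: "h y = map_option \<psi> (g x)" "set_option (g x) \<subseteq> A" using c x by (auto simp: commutes_on_def)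
  show "set_option (h y) \<subseteq> B \<and> map_option (inv_into A \<psi>) (h y) = g (inv_into A \<psi> y)"
    unfolding x_def[symmetric] h(1)
    using h(2) b by (cases "g x") (auto simp: bij_betw_inv_into_left dest: bij_betwE)
qed

lemma isomorphic_crystals_sym:
  assumes "isomorphic_crystals n C D" shows "isomorphic_crystals n D C"
proof -
  obtain \<psi> where p: "crystal_isomorphism n C D \<psi>" using assms by (auto simp: isomorphic_crystals_def)
  then have b: "bij_betw \<psi> (elems C) (elems D)" by (simp add: crystal_isomorphism_def)
  have "wt C (inv_into (elems C) \<psi> y) = wt D y" if "y \<in> elems D" for y
    using p that b unfolding crystal_isomorphism_def
    by (metis bij_betw_imp_surj_on bij_betw_inv_into_right inv_into_into)
  then have "crystal_isomorphism n D C (inv_into (elems C) \<psi>)"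
    using p bij_betw_inv_into[OF b] commutes_on_inv_into[OF b]
    unfolding crystal_isomorphism_def by blast
  then show ?thesis by (auto simp: isomorphic_crystals_def)
qed

definition partial_inverses :: "nat \<Rightarrow> 'a crystal \<Rightarrow> bool" where
  "partial_inverses n C \<longleftrightarrow> (\<forall>i x y. 1 \<le> i \<and> i < n \<and> x \<in> elems C \<longrightarrow>
     (e_of C i x = Some y \<longrightarrow> y \<in> elems C \<and> f_of C i y = Some x) \<and>
     (f_of C i x = Some y \<longrightarrow> y \<in> elems C \<and> e_of C i y = Some x))"

lemma partial_inversesD:
  assumes "partial_inverses n C" "1 \<le> i" "i < n" "x \<in> elems C"
  shows "e_of C i x = Some y \<Longrightarrow> y \<in> elems C" "e_of C i x = Some y \<Longrightarrow> f_of C i y = Some x"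
    and "f_of C i x = Some y \<Longrightarrow> y \<in> elems C" "f_of C i x = Some y \<Longrightarrow> e_of C i y = Some x"
  using assms unfolding partial_inverses_def by blast+

text \<open>As \<open>e\<^sub>i\<close> and \<open>f\<^sub>i\<close> are inverse to each other, it suffices to check \<open>f\<^sub>i\<close>.\<close>

lemma crystal_isomorphism_if_f:
  assumes C: "partial_inverses n C" and D: "partial_inverses n D"
    and b: "bij_betw \<psi> (elems C) (elems D)"
    and w: "\<And>x. x \<in> elems C \<Longrightarrow> wt D (\<psi> x) = wt C x"
    and f: "\<And>i x. 1 \<le> i \<Longrightarrow> i < n \<Longrightarrow> x \<in> elems C \<Longrightarrow> f_of D i (\<psi> x) = map_option \<psi> (f_of C i x)"
  shows "crystal_isomorphism n C D \<psi>"
proof -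
  have "map_option \<psi> (e_of C i x) = e_of D i (\<psi> x)" if i: "1 \<le> i" "i < n" and x: "x \<in> elems C" for i x
  proof (cases "e_of C i x")
    case (Some y)
    then have y: "y \<in> elems C" "f_of C i y = Some x" using partial_inversesD[OF C i x] by auto
    then have "f_of D i (\<psi> y) = Some (\<psi> x)" using f i by simp
    then show ?thesis using partial_inversesD(4)[OF D i, of "\<psi> y"] y(1) bij_betwE[OF b] Some by simp
  next
    case None
    have "e_of D i (\<psi> x) \<noteq> Some z" for z
    proof
      assume "e_of D i (\<psi> x) = Some z"
      then have z: "z \<in> elems D" "f_of D i z = Some (\<psi> x)"
        using partial_inversesD(1,2)[OF D i] x bij_betwE[OF b] by blast+
      then obtain y where y: "y \<in> elems C" "z = \<psi> y" using b by (auto simp: bij_betw_def)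
      then obtain x' where x': "f_of C i y = Some x'" "\<psi> x' = \<psi> x" using z(2) f[OF i y(1)] by auto
      then have "x' \<in> elems C" "e_of C i x' = Some y" using partial_inversesD(3,4)[OF C i y(1)] by auto
      moreover have "x' = x" using x' x calculation(1) b by (auto simp: bij_betw_def inj_on_def)
      ultimately show False using None by simp
    qed
    then show ?thesis using None by (cases "e_of D i (\<psi> x)") auto
  qed
  moreover have "set_option (e_of C i x) \<subseteq> elems C \<and> set_option (f_of C i x) \<subseteq> elems C"
    if "1 \<le> i" "i < n" "x \<in> elems C" for i x
    using partial_inversesD[OF C that] by auto
  ultimately show ?thesis
    using b w f by (simp add: crystal_isomorphism_def commutes_on_def)
qed

section \<open>The stages as isomorphic crystals\<close>

definition pat_wt :: "nat \<Rightarrow> pat \<Rightarrow> nat list" where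
  "pat_wt n = (\<lambda>(M, X). map (\<lambda>j. nat (\<Sum>r\<in>{1..n}. cnt M X j r)) [1..<Suc n])"

definition stage_crystal :: "nat \<Rightarrow> (nat \<Rightarrow> nat) \<Rightarrow> nat \<Rightarrow> nat \<Rightarrow> state crystal" where
  "stage_crystal n a p q = \<lparr>elems = stage n a p q,
     wt = (\<lambda>(M, X, U). pat_wt n (M, X)),
     e_of = (\<lambda>i (M, X, U). map_option (\<lambda>(M', X'). (M', X', U)) (e_pat n i (M, X))),
     f_of = (\<lambda>i (M, X, U). map_option (\<lambda>(M', X'). (M', X', U)) (f_pat n i (M, X)))\<rparr>"

lemma stage_cong:
  assumes "(M, X, U) \<in> stage n a p q" "pattern n M' X'" "\<And>r. M' r n = M r n"
    "\<And>r j. X' r j \<Longrightarrow> \<exists>j. X r j"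
  shows "(M', X', U) \<in> stage n a p q"
  using assms by (simp add: stage_def skew_increasing_def) blast

lemma partial_inverses_stage: "partial_inverses n (stage_crystal n a p q)"
proof -
  have F: "(M', X', U) \<in> stage n a p q \<and> e_pat n i (M', X') = Some (M, X)"
    if "1 \<le> i" "i < n" "(M, X, U) \<in> stage n a p q" "f_pat n i (M, X) = Some (M', X')" for i M X U M' X'
  proof -
    have p: "pattern n M X" using that(3) by (simp add: stage_def)
    show ?thesis
      using stage_cong[OF that(3)] f_pat_pattern[OF p that(1,2,4)] f_pat_frame[OF p that(1,2,4)]
      by blast
  qed
  have E: "(M', X', U) \<in> stage n a p q \<and> f_pat n i (M', X') = Some (M, X)"
    if "1 \<le> i" "i < n" "(M, X, U) \<in> stage n a p q" "e_pat n i (M, X) = Some (M', X')" for i M X U M' X'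
  proof -
    have p: "pattern n M X" using that(3) by (simp add: stage_def)
    show ?thesis
      using stage_cong[OF that(3)] e_pat_pattern[OF p that(1,2,4)] e_pat_frame[OF that(1,2,4)]
      by blast
  qed
  show ?thesis
    unfolding partial_inverses_def
  proof (intro allI impI)
    fix i x y
    assume *: "1 \<le> i \<and> i < n \<and> x \<in> elems (stage_crystal n a p q)"
    obtain M X U where x: "x = (M, X, U)" by (cases x)
    show "(e_of (stage_crystal n a p q) i x = Some y \<longrightarrow>
        y \<in> elems (stage_crystal n a p q) \<and> f_of (stage_crystal n a p q) i y = Some x) \<and>
      (f_of (stage_crystal n a p q) i x = Some y \<longrightarrow>
        y \<in> elems (stage_crystal n a p q) \<and> e_of (stage_crystal n a p q) i y = Some x)"
    proof (intro conjI impI)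
      have i: "1 \<le> i" "i < n" "(M, X, U) \<in> stage n a p q" using * by (auto simp: stage_crystal_def x)
      {
        assume "e_of (stage_crystal n a p q) i x = Some y"
        then obtain M' X' where y: "e_pat n i (M, X) = Some (M', X')" "y = (M', X', U)"
          by (auto simp: stage_crystal_def x)
        show "y \<in> elems (stage_crystal n a p q)" "f_of (stage_crystal n a p q) i y = Some x"
          using E[OF i y(1)] by (simp_all add: stage_crystal_def x y(2))
      next
        assume "f_of (stage_crystal n a p q) i x = Some y"
        then obtain M' X' where y: "f_pat n i (M, X) = Some (M', X')" "y = (M', X', U)"
          by (auto simp: stage_crystal_def x)
        show "y \<in> elems (stage_crystal n a p q)" "e_of (stage_crystal n a p q) i y = Some x"
          using F[OF i y(1)] by (simp_all add: stage_crystal_def x y(2))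
      }
    qed
  qed
qed

lemma uncrowd_isomorphism:
  assumes q: "1 \<le> p" "p \<le> q" "Suc q \<le> n" and anti: "\<And>r. 1 \<le> r \<Longrightarrow> a (Suc r) \<le> a r"
  shows "crystal_isomorphism n (stage_crystal n a p q) (stage_crystal n a p (Suc q)) (uncrowd n p q)"
proof (rule crystal_isomorphism_if_f)
  show "bij_betw (uncrowd n p q) (elems (stage_crystal n a p q)) (elems (stage_crystal n a p (Suc q)))"
    using uncrowd_stage[OF _ q] recrowd_stage[where a = a, OF _ q anti]
    by (intro bij_betw_byWitness[where f' = "recrowd n p q"]) (auto simp: stage_crystal_def)
next
  fix x assume x: "x \<in> elems (stage_crystal n a p q)"
  obtain M X U where xx: "x = (M, X, U)" by (cases x)
  obtain M' X' where s: "slide q (M, X) = (M', X')" by fastforce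
  have p: "pattern n M X" and X: "\<not> X (Suc q) j" for j
    using x q by (auto simp: xx stage_crystal_def stage_def)
  have sum: "(\<Sum>r\<in>{1..n}. cnt M' X' j r) = (\<Sum>r\<in>{1..n}. cnt M X j r)" if "1 \<le> j" for j
  proof -
    have *: "{q, Suc q} \<subseteq> {1..n}" using q by auto
    have "cnt M' X' j l = cnt M X j l" if "l \<noteq> q" "l \<noteq> Suc q" for l
      using that by (simp add: cnt_def lft_def slide_apply[OF s])
    then show ?thesis
      unfolding sum.subset_diff[OF * finite_atLeastAtMost] using cnt_slide[OF s X that] by simp
  qed
  show "wt (stage_crystal n a p (Suc q)) (uncrowd n p q x) = wt (stage_crystal n a p q) x"
    by (simp add: stage_crystal_def xx uncrowd_def s pat_wt_def sum del: upt_Suc One_nat_def)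
  fix i assume i: "1 \<le> i" "i < n"
  have f: "f_pat n i (M', X') = map_option (slide q) (f_pat n i (M, X))"
    using f_pat_slide[OF p X i(1) _ q(3)] q s by simp
  show "f_of (stage_crystal n a p (Suc q)) i (uncrowd n p q x)
      = map_option (uncrowd n p q) (f_of (stage_crystal n a p q) i x)"
  proof (cases "f_pat n i (M, X)")
    case None
    then show ?thesis by (simp add: stage_crystal_def xx uncrowd_def s f)
  next
    case (Some y)
    obtain M2 X2 where y: "y = (M2, X2)" by fastforce
    have y': "f_pat n i (M, X) = Some (M2, X2)" using Some y by simp
    obtain M3 X3 where s2: "slide q (M2, X2) = (M3, X3)" by fastforce
    have X2: "\<not> X2 (Suc q) j" for j using f_pat_frame(2)[OF p i y'] X by blast
    have p': "pattern n M' X'" "pattern n M2 X2"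
      using pattern.pattern_slide[OF p _ X s] q f_pat_pattern[OF p i y'] by auto
    have fr: "M3 (Suc q) n = M' (Suc q) n" "M2 (Suc q) n = M (Suc q) n"
      using f_pat_frame(1)[OF p'(1) i] f_pat_frame(1)[OF p i y'] f y' s2 by auto
    \<comment> \<open>The bit at \<open>n\<close> is the growth of row \<open>q + 1\<close>, and the
      operator keeps the row length before and after the step. Hence the same box is recorded with
      or without the operator.\<close>
    then have "carry (X2 q) (M2 (Suc q)) n = carry (X q) (M (Suc q)) n"
      using slide_apply(2)[OF s] slide_apply(2)[OF s2] by (auto simp: slide_M_def split: if_splits)
    then show ?thesis
      by (simp add: stage_crystal_def xx uncrowd_def s f y' s2 fr)
  qed
qed (rule partial_inverses_stage)+

text \<open>As row \<open>n\<close> cannot be marked, completing row \<open>p + 1\<close> leaves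
  marks in rows up to \<open>p\<close> only, which is where row \<open>p\<close> starts. The two
  label bounds agree in every row up to \<open>n\<close>: for \<open>r > p\<close> they are the same
  inequality, and for \<open>r \<le> p\<close> both exclude positive labels.\<close>

lemma stage_next_row:
  assumes "1 \<le> p" "p < n"
  shows "stage n a (Suc p) n = stage n a p p"
proof -
  have "((\<forall>r j. X r j \<longrightarrow> r < Suc p \<or> r = n) \<and> (\<forall>r c. 0 < U (r, c) \<longrightarrow> U (r, c) + Suc p + of_bool (n < r) \<le> r))
    \<longleftrightarrow> ((\<forall>r j. X r j \<longrightarrow> r < p \<or> r = p) \<and> (\<forall>r c. 0 < U (r, c) \<longrightarrow> U (r, c) + p + of_bool (p < r) \<le> r))"
    if "pattern n M X" "skew_increasing n a M U" for M X U
  proof -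
    interpret pattern n M X by fact
    have x: "(X r j \<longrightarrow> r < Suc p \<or> r = n) \<longleftrightarrow> (X r j \<longrightarrow> r < p \<or> r = p)" for r j
      using X_row_less(2)[of r j] by auto
    have r:  "r \<le> n" if "0 < U (r, c)" for r c
    proof (rule ccontr)
      assume "\<not> r \<le> n"
      then have "M r n = 0" by (simp add: M_zero_row)
      then show False using that \<open>skew_increasing n a M U\<close> by (auto simp: skew_increasing_def)
    qed
    have u: "(0 < U (r, c) \<longrightarrow> U (r, c) + Suc p + of_bool (n < r) \<le> r) \<longleftrightarrow>
        (0 < U (r, c) \<longrightarrow> U (r, c) + p + of_bool (p < r) \<le> r)" for r c
      using r[of r c] by (cases "p < r") auto
    show ?thesis unfolding x u ..
  qed
  then show ?thesis unfolding stage_def by blast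
qed

lemma stages_isomorphic:
  assumes anti: "\<And>r. 1 \<le> r \<Longrightarrow> a (Suc r) \<le> a r" and "1 \<le> n"
  shows "isomorphic_crystals n (stage_crystal n a n n) (stage_crystal n a 1 n)"
proof -
  have row: "isomorphic_crystals n (stage_crystal n a p p) (stage_crystal n a p q)"
    if "1 \<le> p" "p \<le> q" "q \<le> n" for p q
    using that(2,3)
  proof (induction q rule: dec_induct)
    case base
    show ?case
      using crystal_isomorphism_id[of n "stage_crystal n a p p"] partial_inverses_stage[of n a p p]
      unfolding isomorphic_crystals_def partial_inverses_def by blast
  next
    case (step q)
    then show ?case
      using uncrowd_isomorphism[of p q n a] that(1) anti isomorphic_crystals_trans
      unfolding isomorphic_crystals_def by (metis Suc_leD)
  qed
  have "isomorphic_crystals n (stage_crystal n a n n) (stage_crystal n a p n)" if "p \<le> n" "1 \<le> p" for p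
    using that
  proof (induction p rule: inc_induct)
    case base
    show ?case using row[of n n] assms(2) by simp
  next
    case (step p)
    have "stage_crystal n a (Suc p) n = stage_crystal n a p p"
      using stage_next_row[of p n a] step by (simp add: stage_crystal_def)
    then show ?case using step row[of p n] by (auto intro: isomorphic_crystals_trans)
  qed
  then show ?thesis using assms(2) by blast
qed

section \<open>Tableaux and patterns\<close>

definition row_len :: "nat list \<Rightarrow> nat \<Rightarrow> nat" where
  "row_len la r = (if 1 \<le> r \<and> r \<le> length la then la ! (r - 1) else 0)"

lemma diagram_row_len: "(r, c) \<in> diagram la \<longleftrightarrow> 1 \<le> c \<and> c \<le> row_len la r"
  by (auto simp: diagram_def row_len_def)

lemma row_len_antimono:
  assumes "is_partition la" "1 \<le> r"
  shows "row_len la (Suc r) \<le> row_len la r"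
  using assms sorted_wrt_nth_less[of "(\<ge>)" la "r - 1" r]
  by (auto simp: row_len_def is_partition_def)

lemma ncols_row_len: "ncols la = row_len la 1"
  by (simp add: ncols_def row_len_def hd_conv_nth Suc_le_eq)

text \<open>Any two entries of different boxes extend to a choice of one entry per box, so the
  condition on all choices is one on pairs of entries.\<close>

lemma SVT_iff:
  "T \<in> SVT n la \<longleftrightarrow>
     (\<forall>b\<in>diagram la. T b \<noteq> {} \<and> T b \<subseteq> {1..n}) \<and> (\<forall>b. b \<notin> diagram la \<longrightarrow> T b = {}) \<and>
     (\<forall>r c c' x y. c < c' \<and> x \<in> T (r, c) \<and> y \<in> T (r, c') \<longrightarrow> x \<le> y) \<and>
     (\<forall>r r' c x y. r < r' \<and> x \<in> T (r, c) \<and> y \<in> T (r', c) \<longrightarrow> x < y)"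
  (is "_ \<longleftrightarrow> ?A \<and> ?B \<and> ?R \<and> ?C")
proof
  assume T: "T \<in> SVT n la"
  then have A: ?A and B: ?B by (auto simp: SVT_def)
  have dia: "b \<in> diagram la" if "x \<in> T b" for x b using B that by (metis empty_iff)
  have ss: "semistandard la (\<lambda>b. if b = b1 then x else if b = b2 then y else SOME z. z \<in> T b)"
    if "x \<in> T b1" "y \<in> T b2" for b1 b2 x y
  proof -
    have "\<forall>b\<in>diagram la. (if b = b1 then x else if b = b2 then y else SOME z. z \<in> T b) \<in> T b"
      using that A by (auto simp: some_in_eq)
    then show ?thesis using T by (simp add: SVT_def)
  qed
  have ?R
  proof (intro allI impI)
    fix r c c' x y assume *: "c < c' \<and> x \<in> T (r, c) \<and> y \<in> T (r, c')"
    then show "x \<le> y"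
      using ss[of x "(r, c)" y "(r, c')"] dia[of x "(r, c)"] dia[of y "(r, c')"]
      unfolding semistandard_def by force
  qed
  moreover have ?C
  proof (intro allI impI)
    fix r r' c x y assume *: "r < r' \<and> x \<in> T (r, c) \<and> y \<in> T (r', c)"
    then show "x < y"
      using ss[of x "(r, c)" y "(r', c)"] dia[of x "(r, c)"] dia[of y "(r', c)"]
      unfolding semistandard_def by force
  qed
  ultimately show "?A \<and> ?B \<and> ?R \<and> ?C" using A B by blast
next
  assume *: "?A \<and> ?B \<and> ?R \<and> ?C"
  have "semistandard la t" if "\<forall>b\<in>diagram la. t b \<in> T b" for t
    unfolding semistandard_def
  proof (intro conjI allI impI)
    fix r c c' assume "(r, c) \<in> diagram la \<and> (r, c') \<in> diagram la \<and> c < c'"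
    then have "c < c' \<and> t (r, c) \<in> T (r, c) \<and> t (r, c') \<in> T (r, c')" using that by simp
    then show "t (r, c) \<le> t (r, c')" using * by blast
  next
    fix r r' c assume "(r, c) \<in> diagram la \<and> (r', c) \<in> diagram la \<and> r < r'"
    then have "r < r' \<and> t (r, c) \<in> T (r, c) \<and> t (r', c) \<in> T (r', c)" using that by simp
    then show "t (r, c) < t (r', c)" using * by blast
  qed
  then show "T \<in> SVT n la" using * by (simp add: SVT_def)
qed

lemma SVT_D:
  assumes "T \<in> SVT n la"
  shows "\<forall>b\<in>diagram la. T b \<noteq> {} \<and> T b \<subseteq> {1..n}" "\<forall>b. b \<notin> diagram la \<longrightarrow> T b = {}"
    and "\<forall>r c c' x y. c < c' \<and> x \<in> T (r, c) \<and> y \<in> T (r, c') \<longrightarrow> x \<le> y"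
    and "\<forall>r r' c x y. r < r' \<and> x \<in> T (r, c) \<and> y \<in> T (r', c) \<longrightarrow> x < y"
  by (rule conjunct1 conjunct2[THEN conjunct1] conjunct2[THEN conjunct2, THEN conjunct1]
      conjunct2[THEN conjunct2, THEN conjunct2], rule assms[unfolded SVT_iff])+

definition decode :: "pat \<Rightarrow> tableau" where
  "decode = (\<lambda>(M, X) (r, c). {j. lft M X r j < int c \<and> int c \<le> M r j})"

text \<open>A nonminimal \<open>j\<close> can only sit in the last box of its row with minimum below
  \<open>j\<close>, in column \<open>M r (j - 1)\<close>. Without such a box this is column 0,
  outside every diagram.\<close>

definition encode :: "tableau \<Rightarrow> pat" where
  "encode T = (let M = (\<lambda>r j. int (card {c. \<exists>k\<in>T (r, c). k \<le> j})) in
     (M, \<lambda>r j. j \<in> T (r, nat (M r (j - 1)))))"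

definition patterns :: "nat \<Rightarrow> nat list \<Rightarrow> pat set" where
  "patterns n la = {(M, X). pattern n M X \<and> (\<forall>r. M r n = int (row_len la r))}"

lemma decode_iff: "j \<in> decode (M, X) (r, c) \<longleftrightarrow> lft M X r j < int c \<and> int c \<le> M r j"
  by (simp add: decode_def)

context pattern begin

lemma decode_range: "j \<in> decode (M, X) (r, c) \<Longrightarrow> 1 \<le> r \<and> 1 \<le> c \<and> 1 \<le> j \<and> j \<le> n"
proof -
  assume *: "j \<in> decode (M, X) (r, c)"
  then have c: "1 \<le> c" using lft_nonneg[of r j] by (simp add: decode_iff)
  then have "r \<noteq> 0" "j \<noteq> 0" using * M_row0[of j] M_0[of r] by (auto simp: decode_iff intro: ccontr)
  moreover have "j \<le> n"
  proof (rule ccontr)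
    assume "\<not> j \<le> n"
    then have "\<not> X r j" "n \<le> j" "n \<le> j - 1" using X_range[of r j] by auto
    then show False
      using * M_stable[of j r] M_stable[of "j - 1" r] by (simp add: decode_iff lft_def)
  qed
  ultimately show ?thesis using c by simp
qed

lemma ex_decode_le: "(\<exists>k\<in>decode (M, X) (r, c). k \<le> j) \<longleftrightarrow> 1 \<le> c \<and> int c \<le> M r j"
proof
  assume "\<exists>k\<in>decode (M, X) (r, c). k \<le> j"
  then obtain k where k: "k \<in> decode (M, X) (r, c)" "k \<le> j" by blast
  then show "1 \<le> c \<and> int c \<le> M r j"
    using decode_range[OF k(1)] M_mono[OF k(2), of r] by (auto simp: decode_iff)
next
  assume c: "1 \<le> c \<and> int c \<le> M r j"
  \<comment> \<open>The minimum of box \<open>c\<close>: the first letter at which the initial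
    segment of row \<open>r\<close> reaches column \<open>c\<close>.\<close>
  define k where "k = (LEAST k. int c \<le> M r k)"
  have k: "int c \<le> M r k" using c LeastI[of "\<lambda>k. int c \<le> M r k" j] by (simp add: k_def)
  have "k \<le> j" using c Least_le[of "\<lambda>k. int c \<le> M r k" j] by (simp add: k_def)
  moreover have "M r (k - 1) < int c"
  proof (cases k)
    case 0
    then show ?thesis using k c M_0[of r] by simp
  next
    case (Suc h)
    then have "\<not> int c \<le> M r h" using not_less_Least[of h "\<lambda>k. int c \<le> M r k"] by (simp add: k_def)
    then show ?thesis using Suc by simp
  qed
  ultimately show "\<exists>k\<in>decode (M, X) (r, c). k \<le> j"
    using k lft_le_pred[of r k] by (intro bexI[of _ k]) (auto simp: decode_iff)
qed

lemma decode_SVT: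
  assumes len: "\<And>r. M r n = int (row_len la r)"
  shows "decode (M, X) \<in> SVT n la"
  unfolding SVT_iff
proof (intro conjI allI impI ballI)
  fix b assume "b \<in> diagram la"
  moreover obtain r c where "b = (r, c)" by fastforce
  ultimately show "decode (M, X) b \<noteq> {}"
    using ex_decode_le[of r c n] len[of r] by (auto simp: diagram_row_len)
next
  fix b :: box
  obtain r c where "b = (r, c)" by fastforce
  then show "decode (M, X) b \<subseteq> {1..n}" using decode_range[of _ r c] by auto
next
  fix b :: box assume *: "b \<notin> diagram la"
  obtain r c where b: "b = (r, c)" by fastforce
  have "j \<notin> decode (M, X) (r, c)" for j
    using ex_decode_le[of r c n] len[of r] decode_range[of j r c] * by (auto simp: diagram_row_len b)
  then show "decode (M, X) b = {}" by (auto simp: b)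
next
  fix r c c' x y
  assume *: "c < c' \<and> x \<in> decode (M, X) (r, c) \<and> y \<in> decode (M, X) (r, c')"
  show "x \<le> y"
  proof (rule ccontr)
    assume "\<not> x \<le> y"
    then have "M r y \<le> M r (x - 1)" by (intro M_mono) simp
    also have "\<dots> \<le> lft M X r x + 1" by (simp add: lft_def)
    finally show False using * by (simp add: decode_iff)
  qed
next
  fix r r' c x y
  assume *: "r < r' \<and> x \<in> decode (M, X) (r, c) \<and> y \<in> decode (M, X) (r', c)"
  show "x < y"
  proof (rule ccontr)
    assume "\<not> x < y"
    then have "M r' y \<le> M r' x" by (intro M_mono) simp
    also have "\<dots> \<le> lft M X r x" using * decode_range[of x r c] by (intro M_le_lft') auto
    finally show False using * by (simp add: decode_iff)
  qed
qed

lemma encode_decode: "encode (decode (M, X)) = (M, X)"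
proof -
  have "{c. \<exists>k\<in>decode (M, X) (r, c). k \<le> j} = {1..nat (M r j)}" for r j
    unfolding ex_decode_le by auto
  then have M: "int (card {c. \<exists>k\<in>decode (M, X) (r, c). k \<le> j}) = M r j" for r j
    by (simp add: M_nonneg)
  have "j \<in> decode (M, X) (r, nat (M r (j - 1))) \<longleftrightarrow> X r j" for r j
    using M_mono[of "j - 1" j r] M_nonneg[of r "j - 1"] by (auto simp: decode_iff lft_def)
  then show ?thesis by (simp add: encode_def M)
qed

lemma decode_SSYT_iff:
  assumes len: "\<And>r. M r n = int (row_len la r)"
  shows "decode (M, X) \<in> SSYT n la \<longleftrightarrow> (\<forall>r j. \<not> X r j)"
proof
  assume ss: "decode (M, X) \<in> SSYT n la"
  show "\<forall>r j. \<not> X r j"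
  proof (intro allI notI)
    fix r j assume x: "X r j"
    define c where "c = nat (M r (j - 1))"
    have c: "int c = M r (j - 1)" "1 \<le> c"
      using lft_nonneg[of r j] x by (auto simp: c_def lft_def)
    have j: "j \<in> decode (M, X) (r, c)" using x c M_mono[of "j - 1" j r] by (simp add: decode_iff lft_def)
    obtain k where k: "k \<in> decode (M, X) (r, c)" "k \<le> j - 1"
      using ex_decode_le[of r c "j - 1"] c by auto
    have "(r, c) \<in> diagram la"
      using ex_decode_le[of r c n] j decode_range[OF j] len[of r] by (auto simp: diagram_row_len)
    then have "is_singleton (decode (M, X) (r, c))" using ss by (simp add: SSYT_def)
    then have "k = j" using j k by (auto simp: is_singleton_def)
    then show False using k(2) X_range[OF x] by linarith
  qed
next
  assume x: "\<forall>r j. \<not> X r j"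
  have "is_singleton (decode (M, X) b)" if bd: "b \<in> diagram la" for b
  proof -
    obtain r c where b: "b = (r, c)" by fastforce
    obtain k where k: "k \<in> decode (M, X) b"
      using bspec[OF SVT_D(1)[OF decode_SVT[OF len]] bd] by blast
    have "j = k" if "j \<in> decode (M, X) b" for j
    proof (rule ccontr)
      assume "j \<noteq> k"
      then have "M r j \<le> M r (k - 1) \<or> M r k \<le> M r (j - 1)"
        using M_mono[of j "k - 1" r] M_mono[of k "j - 1" r] by linarith
      then show False using that k x by (auto simp: b decode_iff lft_def)
    qed
    then show ?thesis using k by (auto simp: is_singleton_def)
  qed
  then show "decode (M, X) \<in> SSYT n la" using decode_SVT[OF len] by (simp add: SSYT_def)
qed

lemma content_decode: "content n (decode (M, X)) = pat_wt n (M, X)"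
proof -
  have "card {b. j \<in> decode (M, X) b} = nat (\<Sum>r\<in>{1..n}. cnt M X j r)" for j
  proof -
    have "{b. j \<in> decode (M, X) b} = (SIGMA r:{1..n}. {nat (lft M X r j)<..nat (M r j)})"
    proof (intro set_eqI)
      fix b :: box
      obtain r c where b: "b = (r, c)" by fastforce
      have "r \<le> n" if "j \<in> decode (M, X) (r, c)"
        using that decode_range[OF that] M_zero_row[of r j] by (cases "r \<le> n") (auto simp: decode_iff)
      then show "b \<in> {b. j \<in> decode (M, X) b} \<longleftrightarrow>
          b \<in> (SIGMA r:{1..n}. {nat (lft M X r j)<..nat (M r j)})"
        using decode_range[of j r c] lft_nonneg[of r j] M_nonneg[of r j]
        by (auto simp: b decode_iff)
    qed
    then have "card {b. j \<in> decode (M, X) b} = (\<Sum>r\<in>{1..n}. nat (M r j) - nat (lft M X r j))"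
      by simp
    also have "int \<dots> = (\<Sum>r\<in>{1..n}. cnt M X j r)"
      using lft_nonneg lft_le M_nonneg by (auto simp: cnt_def of_nat_diff nat_mono intro!: sum.cong)
    finally show ?thesis by simp
  qed
  then show ?thesis by (simp add: content_def pat_wt_def del: upt_Suc)
qed

end

lemma down_closed_interval:
  assumes "finite S" "0 \<notin> S" "\<And>c c'. c \<in> S \<Longrightarrow> 1 \<le> c' \<Longrightarrow> c' < c \<Longrightarrow> c' \<in> S"
  shows "S = {1..card S}"
proof (cases "S = {}")
  case False
  have "S = {1..Max S}"
  proof (intro set_eqI iffI)
    fix c assume c: "c \<in> S"
    then have "c \<noteq> 0" using assms(2) by metis
    then show "c \<in> {1..Max S}" using c assms(1) by simp
  next
    fix c assume "c \<in> {1..Max S}"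
    then show "c \<in> S" using assms(3)[of "Max S" c] Max_in[OF assms(1) False] by (cases "c = Max S") auto
  qed
  then show ?thesis by (metis card_atLeastAtMost diff_Suc_1)
qed simp

lemma encode_SVT:
  assumes T: "T \<in> SVT n la" and la: "is_partition la" and e: "encode T = (M, X)"
  shows "(M, X) \<in> patterns n la" "decode (M, X) = T"
proof -
  have dia: "1 \<le> c \<and> c \<le> row_len la r \<and> 1 \<le> x \<and> x \<le> n" if x: "x \<in> T (r, c)" for x r c
  proof -
    have d: "(r, c) \<in> diagram la" using x SVT_D(2)[OF T] by (metis empty_iff)
    then have "T (r, c) \<subseteq> {1..n}" using SVT_D(1)[OF T] by blast
    then show ?thesis using d x by (auto simp: diagram_row_len)
  qed
  have row: "c < c' \<Longrightarrow> x \<in> T (r, c) \<Longrightarrow> y \<in> T (r, c') \<Longrightarrow> x \<le> y" for r c c' x y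
    using SVT_D(3)[OF T] by blast
  have col: "r < r' \<Longrightarrow> x \<in> T (r, c) \<Longrightarrow> y \<in> T (r', c) \<Longrightarrow> x < y" for r r' c x y
    using SVT_D(4)[OF T] by blast
  have ne: "\<exists>x. x \<in> T (r, c)" if "1 \<le> c" "c \<le> row_len la r" for r c
  proof -
    have "(r, c) \<in> diagram la" using that by (simp add: diagram_row_len)
    then show ?thesis using SVT_D(1)[OF T] by blast
  qed
  have M_def: "M r j = int (card {c. \<exists>k\<in>T (r, c). k \<le> j})" for r j
    using e by (auto simp: encode_def Let_def)
  have X: "X r j \<longleftrightarrow> j \<in> T (r, nat (M r (j - 1)))" for r j
    using e by (auto simp: encode_def Let_def)
  \<comment> \<open>By weak increase of the row, the boxes having an entry at most \<open>j\<close>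
    form an initial segment, so their number determines them.\<close>
  have E: "(\<exists>k\<in>T (r, c). k \<le> j) \<longleftrightarrow> 1 \<le> c \<and> int c \<le> M r j" for r c j
  proof -
    let ?S = "{c. \<exists>k\<in>T (r, c). k \<le> j}"
    have "?S \<subseteq> {1..row_len la r}" using dia by auto
    then have fin: "finite ?S" "0 \<notin> ?S" by (auto dest: finite_subset)
    have "c' \<in> ?S" if c: "c \<in> ?S" "1 \<le> c'" "c' < c" for c c'
    proof -
      obtain k where k: "k \<in> T (r, c)" "k \<le> j" using c(1) by blast
      then obtain x where x: "x \<in> T (r, c')" using ne[of c' r] dia[OF k(1)] c by fastforce
      then have "x \<le> j" using row[OF c(3) x k(1)] k(2) by simp
      then show ?thesis using x by blast
    qed
    from down_closed_interval[OF fin this] have "c \<in> ?S \<longleftrightarrow> c \<in> {1..card ?S}" by (rule arg_cong)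
    then show ?thesis unfolding M_def atLeastAtMost_iff of_nat_le_iff mem_Collect_eq .
  qed
  have nn: "0 \<le> M r j" for r j by (simp add: M_def)
  have X': "X r j \<longleftrightarrow> j \<in> T (r, c)" if "int c = M r (j - 1)" for r j c
    using X[of r j] that by (metis nat_int)
  have len: "M r n = int (row_len la r)" for r
  proof -
    have "(\<exists>k\<in>T (r, c). k \<le> n) \<longleftrightarrow> c \<in> {1..row_len la r}" for c
      using dia[of _ r c] ne[of c r] by auto
    then have "{c. \<exists>k\<in>T (r, c). k \<le> n} = {1..row_len la r}" by blast
    then show ?thesis by (simp add: M_def)
  qed
  have le_len: "M r j \<le> int (row_len la r)" for r j
  proof (cases "M r j = 0")
    case False
    then have "1 \<le> nat (M r j) \<and> int (nat (M r j)) \<le> M r j" using nn[of r j] by simp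
    then obtain k where "k \<in> T (r, nat (M r j))" using E by blast
    then show ?thesis using dia[of k r "nat (M r j)"] by (simp add: nat_le_iff)
  qed simp
  have mem: "j \<in> T (r, c) \<longleftrightarrow> lft M X r j < int c \<and> int c \<le> M r j" for r c j
  proof
    assume j: "j \<in> T (r, c)"
    then have c: "1 \<le> c" "int c \<le> M r j" using E[of r c j] by auto
    have "lft M X r j < int c"
    proof (cases "int c \<le> M r (j - 1)")
      case True
      \<comment> \<open>Otherwise the last box with an entry below \<open>j\<close> would lie to the
        right of a box containing \<open>j\<close>.\<close>
      have "int c = M r (j - 1)"
      proof (rule ccontr)
        assume "\<not> ?thesis"
        then have "c < nat (M r (j - 1))" using True by simp
        moreover obtain k where k: "k \<in> T (r, nat (M r (j - 1)))" "k \<le> j - 1"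
          using E[of r "nat (M r (j - 1))" "j - 1"] True c by auto
        ultimately have "j \<le> k" using row[OF _ j k(1)] by blast
        then show False using k(2) dia[OF j] by linarith
      qed
      then have "X r j" "M r (j - 1) = int c" using j X'[of c r j] by simp_all
      then show ?thesis by (simp add: lft_def)
    next
      case False
      then show ?thesis by (simp add: lft_def)
    qed
    then show "lft M X r j < int c \<and> int c \<le> M r j" using c by simp
  next
    assume *: "lft M X r j < int c \<and> int c \<le> M r j"
    show "j \<in> T (r, c)"
    proof (cases "M r (j - 1) < int c")
      case True
      then have "1 \<le> c" using nn[of r "j - 1"] by simp
      then obtain k where k: "k \<in> T (r, c)" "k \<le> j" using E[of r c j] * by auto
      have "\<not> k \<le> j - 1" using E[of r c "j - 1"] True k(1) by auto
      then show ?thesis using k by (cases "k = j") auto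
    next
      case False
      then have "X r j" "int c = M r (j - 1)" using * by (cases "X r j"; simp add: lft_def)+
      then show ?thesis using X' by blast
    qed
  qed
  have mono1: "M r j \<le> M r (Suc j)" for r j
  proof (cases "M r j = 0")
    case False
    then have "1 \<le> nat (M r j) \<and> int (nat (M r j)) \<le> M r j" using nn[of r j] by simp
    then have "\<exists>k\<in>T (r, nat (M r j)). k \<le> j" using E by blast
    then have "\<exists>k\<in>T (r, nat (M r j)). k \<le> Suc j" using le_SucI by blast
    then show ?thesis using E[of r "nat (M r j)" "Suc j"] nn[of r j] by simp
  qed (simp add: nn)
  have "pattern n M X"
  proof
    fix r j
    have "{c. \<exists>k\<in>T (r, c). k \<le> 0} = {}" using dia[of 0 r] by auto
    then show "M r 0 = 0" by (simp only: M_def card.empty of_nat_0)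
    show "M 0 j = 0" using le_len[of 0 j] nn[of 0 j] by (simp add: row_len_def)
    show "M r j \<le> M r (Suc j)" by (rule mono1)
    show "M r j = M r n" if "n \<le> j"
    proof -
      have "{c. \<exists>k\<in>T (r, c). k \<le> j} = {c. \<exists>k\<in>T (r, c). k \<le> n}"
      proof (intro Collect_cong bex_cong refl)
        fix c k assume "k \<in> T (r, c)"
        then have "k \<le> n" using dia by blast
        then show "k \<le> j \<longleftrightarrow> k \<le> n" using that by simp
      qed
      then show ?thesis by (simp add: M_def)
    qed
    show "1 \<le> r \<and> 1 \<le> j \<and> j \<le> n" if x: "X r j"
    proof -
      obtain c where "j \<in> T (r, c)" using X[of r j] x by blast
      then show ?thesis using dia[of j r c] by (cases r) (simp_all add: row_len_def)
    qed
    show "M (Suc r) j \<le> lft M X r j" if r: "1 \<le> r" "1 \<le> j"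
    proof (cases "M (Suc r) j = 0")
      case True
      have "1 \<le> M r (j - 1)" if "X r j"
      proof -
        have "j \<in> T (r, nat (M r (j - 1)))" using that X by simp
        then have "1 \<le> nat (M r (j - 1))" using dia by blast
        then show ?thesis by linarith
      qed
      then show ?thesis using True nn[of r "j - 1"] by (simp add: lft_def)
    next
      case False
      define c where "c = nat (M (Suc r) j)"
      have c: "int c = M (Suc r) j" "1 \<le> c" using nn[of "Suc r" j] False by (auto simp: c_def)
      then obtain k where k: "k \<in> T (Suc r, c)" "k \<le> j" using E[of "Suc r" c j] by auto
      have "c \<le> row_len la r" using dia[OF k(1)] row_len_antimono[OF la r(1)] by simp
      then obtain x where x: "x \<in> T (r, c)" using ne c(2) by blast
      have "x < k" using col[OF _ x k(1)] by simp
      then have "int c \<le> M r (j - 1)" using E[of r c "j - 1"] x k(2) by fastforce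
      moreover have "int c \<noteq> M r (j - 1)" if "X r j"
      proof
        assume "int c = M r (j - 1)"
        then have "j \<in> T (r, c)" using that X' by blast
        then show False using col[OF _ _ k(1), of r j] k(2) by simp
      qed
      ultimately show ?thesis using c by (auto simp: lft_def)
    qed
  qed
  then show "(M, X) \<in> patterns n la" using len by (simp add: patterns_def)
  show "decode (M, X) = T" by (auto simp: decode_def fun_eq_iff mem)
qed

lemma bij_betw_decode:
  assumes "is_partition la"
  shows "bij_betw decode (patterns n la) (SVT n la)"
proof (rule bij_betw_byWitness[where f' = encode])
  show "\<forall>p\<in>patterns n la. encode (decode p) = p"
    by (auto simp: patterns_def intro: pattern.encode_decode)
  show "\<forall>T\<in>SVT n la. decode (encode T) = T"
    using encode_SVT(2)[OF _ assms] by (metis surj_pair)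
  show "decode ` patterns n la \<subseteq> SVT n la"
    by (auto simp: patterns_def intro: pattern.decode_SVT)
  show "encode ` SVT n la \<subseteq> patterns n la"
    using encode_SVT(1)[OF _ assms] by (metis image_subsetI surj_pair)
qed

section \<open>The signature rule\<close>

definition height :: "(nat \<Rightarrow> bool) \<Rightarrow> (nat \<Rightarrow> bool) \<Rightarrow> nat \<Rightarrow> nat \<Rightarrow> int" where
  "height p m a c = (\<Sum>k\<in>{a..<c}. of_bool (p k) - of_bool (m k))"

lemma height_le: "c \<le> a \<Longrightarrow> height p m a c = 0"
  by (simp add: height_def)

lemma height_step:
  "a < c \<Longrightarrow> height p m a c = of_bool (p a) - of_bool (m a) + height p m (Suc a) c"
  by (simp add: height_def sum.atLeast_Suc_lessThan)

lemma height_Suc: "a \<le> c \<Longrightarrow> height p m a (Suc c) = height p m a c + of_bool (p c) - of_bool (m c)"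
  by (simp add: height_def)

definition sign_word :: "(nat \<Rightarrow> bool) \<Rightarrow> (nat \<Rightarrow> bool) \<Rightarrow> nat \<Rightarrow> nat \<Rightarrow> (sign \<times> nat) list" where
  "sign_word p m a b = map (\<lambda>c. (if p c then Plus else Minus, c)) (filter (\<lambda>c. p c \<noteq> m c) [a..<b])"

lemma sign_word_step:
  "a < b \<Longrightarrow> sign_word p m a b =
     (if p a \<noteq> m a then (if p a then Plus else Minus, a) # sign_word p m (Suc a) b
      else sign_word p m (Suc a) b)"
  by (simp add: sign_word_def upt_conv_Cons)

text \<open>The rightmost uncancelled \<open>+\<close> is where the height first becomes maximal, the leftmost
  uncancelled \<open>-\<close> where it leaves the maximum for the last time.\<close>

definition reduced :: "(nat \<Rightarrow> bool) \<Rightarrow> (nat \<Rightarrow> bool) \<Rightarrow> nat \<Rightarrow> nat \<Rightarrow> nat list \<Rightarrow> nat list \<Rightarrow> bool" where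
  "reduced p m a b P Q \<longleftrightarrow>
     (P = [] \<longrightarrow> (\<forall>c. c \<le> b \<longrightarrow> height p m a c \<le> 0)) \<and>
     (P \<noteq> [] \<longrightarrow> a \<le> last P \<and> last P < b \<and> p (last P) \<and> \<not> m (last P) \<and>
        height p m a (Suc (last P)) = int (length P) \<and>
        (\<forall>c. c \<le> last P \<longrightarrow> height p m a c < int (length P)) \<and>
        (\<forall>c. c \<le> b \<longrightarrow> height p m a c \<le> int (length P))) \<and>
     (Q = [] \<longrightarrow> height p m a b = int (length P)) \<and>
     (Q \<noteq> [] \<longrightarrow> a \<le> hd Q \<and> hd Q < b \<and> \<not> p (hd Q) \<and> m (hd Q) \<and>
        height p m a (hd Q) = int (length P) \<and>
        (\<forall>c. hd Q < c \<and> c \<le> b \<longrightarrow> height p m a c < int (length P)))"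

text \<open>\<open>cancel\<close> works from the right end, so the induction prepends column
  \<open>a\<close>. This shifts every height beyond \<open>a\<close> by the sign of that column; a
  prepended minus consumes the first plus if there is one.\<close>

lemma cancel_sign_word:
  assumes "a \<le> b"
  shows "\<exists>P Q. cancel (sign_word p m a b) = map (Pair Plus) P @ map (Pair Minus) Q \<and> reduced p m a b P Q"
  using assms
proof (induction a rule: inc_induct)
  case base
  have "reduced p m b b [] []" by (simp add: reduced_def height_le)
  then show ?case by (intro exI[of _ "[]"]) (simp add: sign_word_def)
next
  case (step a)
  let ?h = "height p m a" and ?h' = "height p m (Suc a)"
  obtain P Q where c: "cancel (sign_word p m (Suc a) b) = map (Pair Plus) P @ map (Pair Minus) Q"
    and r: "reduced p m (Suc a) b P Q" using step.IH by blast
  have h: "?h c = (if c \<le> a then 0 else of_bool (p a) - of_bool (m a) + ?h' c)" for c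
    by (simp add: height_le height_step)
  have h': "?h' c = 0" if "c \<le> a" for c using that by (simp add: height_le)
  note w = sign_word_step[OF step.hyps(2), of p m]
  have P0: "P = [] \<Longrightarrow> c \<le> b \<Longrightarrow> ?h' c \<le> 0" for c using r by (simp add: reduced_def)
  have Pn: "P \<noteq> [] \<Longrightarrow> Suc a \<le> last P \<and> last P < b \<and> p (last P) \<and> \<not> m (last P) \<and> ?h' (Suc (last P)) = int (length P)"
    and Pl: "P \<noteq> [] \<Longrightarrow> c \<le> last P \<Longrightarrow> ?h' c < int (length P)"
    and Pg: "P \<noteq> [] \<Longrightarrow> c \<le> b \<Longrightarrow> ?h' c \<le> int (length P)" for c using r by (simp_all add: reduced_def)
  have Q0: "Q = [] \<Longrightarrow> ?h' b = int (length P)" using r by (simp add: reduced_def)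
  have Qn: "Q \<noteq> [] \<Longrightarrow> Suc a \<le> hd Q \<and> hd Q < b \<and> \<not> p (hd Q) \<and> m (hd Q) \<and> ?h' (hd Q) = int (length P)"
    and Qg: "Q \<noteq> [] \<Longrightarrow> hd Q < c \<Longrightarrow> c \<le> b \<Longrightarrow> ?h' c < int (length P)" for c
    using r by (simp_all add: reduced_def)
  consider "p a = m a" | "p a" "\<not> m a" | "\<not> p a" "m a" "P = []" | d P' where "\<not> p a" "m a" "P = d # P'"
    by (cases P) auto
  then show ?case
  proof cases
    case 1
    have "?h c = ?h' c" for c using 1 h[of c] h'[of c] by simp
    then have "reduced p m a b P Q" using r by (simp add: reduced_def) linarith
    then show ?thesis using c w 1 by auto
  next
    case 2
    have hh: "?h c = (if c \<le> a then 0 else 1 + ?h' c)" for c using 2 h by simp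
    have "reduced p m a b (a # P) Q"
      unfolding reduced_def
    proof (intro conjI impI allI)
      fix c
      show "?h c < int (length (a # P))" if "c \<le> last (a # P)"
        using that Pl[of c] by (auto simp: hh split: if_splits)
      show "?h c \<le> int (length (a # P))" if "c \<le> b"
        using that P0[of c] Pg[of c] by (cases "P = []") (auto simp: hh)
      show "?h c < int (length (a # P))" if "Q \<noteq> []" "hd Q < c \<and> c \<le> b"
        using that Qg[of c] by (auto simp: hh)
    qed (use Pn Q0 Qn step.hyps 2 in \<open>auto simp: hh height_le\<close>)
    moreover have "cancel (sign_word p m a b) = map (Pair Plus) (a # P) @ map (Pair Minus) Q"
      using c w 2 by simp
    ultimately show ?thesis by blast
  next
    case 3
    have hh: "?h c = (if c \<le> a then 0 else ?h' c - 1)" for c using 3 h by simp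
    have "reduced p m a b [] (a # Q)"
      unfolding reduced_def using P0 3 step.hyps by (fastforce simp: hh)
    moreover have "cancel (sign_word p m a b) = map (Pair Plus) [] @ map (Pair Minus) (a # Q)"
      using c w 3 by (cases Q) simp_all
    ultimately show ?thesis by blast
  next
    case 4
    have hh: "?h c = (if c \<le> a then 0 else ?h' c - 1)" for c using 4 h by simp
    \<comment> \<open>Deleting the first plus keeps the last one, if any is left, and lowers the
      number of pluses by 1, as the minus does with the heights beyond \<open>a\<close>.\<close>
    have "reduced p m a b P' Q"
      unfolding reduced_def
    proof (intro conjI impI allI)
      fix c
      show "?h c \<le> 0" if "P' = []" "c \<le> b" using that Pg[of c] 4 by (auto simp: hh)
      show "?h c < int (length P')" if "P' \<noteq> []" "c \<le> last P'"
        using that Pl[of c] 4 by (auto simp: hh)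
      show "?h c \<le> int (length P')" if "P' \<noteq> []" "c \<le> b"
        using that Pg[of c] 4 by (auto simp: hh)
      show "?h c < int (length P')" if "Q \<noteq> []" "hd Q < c \<and> c \<le> b"
        using that Qg[of c] Qn 4 by (auto simp: hh)
    qed (use Pn Q0 Qn step.hyps 4 in \<open>auto simp: hh height_le\<close>)
    moreover have "cancel (sign_word p m a b) = map (Pair Plus) P' @ map (Pair Minus) Q"
      using c w 4 by simp
    ultimately show ?thesis by blast
  qed
qed

lemma reduced_le:
  assumes "reduced p m a b P Q" "c \<le> b"
  shows "height p m a c \<le> int (length P)"
  using assms by (cases "P = []") (auto simp: reduced_def)

lemma signs_of_reduced:
  "[c. (s, c) \<leftarrow> map (Pair Plus) P @ map (Pair Minus) Q, s = Plus] = P"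
  "[c. (s, c) \<leftarrow> map (Pair Plus) P @ map (Pair Minus) Q, s = Minus] = Q"
proof -
  have "[c. (s, c) \<leftarrow> map (Pair Plus) P, s = Plus] = P" "[c. (s, c) \<leftarrow> map (Pair Plus) P, s = Minus] = []"
    by (induction P) simp_all
  moreover have "[c. (s, c) \<leftarrow> map (Pair Minus) Q, s = Plus] = []" "[c. (s, c) \<leftarrow> map (Pair Minus) Q, s = Minus] = Q"
    by (induction Q) simp_all
  ultimately show "[c. (s, c) \<leftarrow> map (Pair Plus) P @ map (Pair Minus) Q, s = Plus] = P"
    "[c. (s, c) \<leftarrow> map (Pair Plus) P @ map (Pair Minus) Q, s = Minus] = Q"
    by (simp_all only: map_append concat_append append_Nil append_Nil2)
qed

lemma sum_of_bool_interval:
  assumes "0 \<le> l"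
  shows "(\<Sum>k\<in>{1..<Suc c}. of_bool (l < int k \<and> int k \<le> m)) = max 0 (min (int c) m - l)"
  using assms by (induction c) (auto simp: max_def min_def)

section \<open>Column heights and row peaks\<close>

context pattern begin

definition colheight :: "nat \<Rightarrow> nat \<Rightarrow> int" where
  "colheight i c = height (\<lambda>k. in_column (decode (M, X)) k i) (\<lambda>k. in_column (decode (M, X)) k (Suc i)) 1 (Suc c)"

lemma in_column_decode: "in_column (decode (M, X)) c j \<longleftrightarrow> (\<exists>r. lft M X r j < int c \<and> int c \<le> M r j)"
  by (simp add: in_column_def decode_iff)

lemma decode_col_unique:
  assumes "j \<in> decode (M, X) (r, c)" "j \<in> decode (M, X) (r', c)"
  shows "r = r'"
proof -
  have "\<not> r < r'" if "j \<in> decode (M, X) (r, c)" "j \<in> decode (M, X) (r', c)" for r r'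
    using that M_le_lft'[of r r' j] decode_range[OF that(1)] by (auto simp: decode_iff)
  then show ?thesis using assms by (metis linorder_neqE_nat)
qed

text \<open>A letter occurs in at most one row of a column, so counting columns may be exchanged
  with counting boxes row by row.\<close>

lemma sum_in_column:
  "(\<Sum>k\<in>{1..<Suc c}. of_bool (in_column (decode (M, X)) k j))
    = (\<Sum>r\<in>{1..n}. max 0 (min (int c) (M r j) - lft M X r j))"
proof -
  have "of_bool (in_column (decode (M, X)) k j)
      = (\<Sum>r\<in>{1..n}. of_bool (lft M X r j < int k \<and> int k \<le> M r j) :: int)" for k
  proof (cases "in_column (decode (M, X)) k j")
    case True
    then obtain r where r: "j \<in> decode (M, X) (r, k)" by (auto simp: in_column_def)
    have "r \<in> {1..n}" using decode_range[OF r] r M_zero_row[of r j] by (cases "r \<le> n") (auto simp: decode_iff)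
    moreover have "\<not> (lft M X r' j < int k \<and> int k \<le> M r' j)" if "r' \<noteq> r" for r'
      using decode_col_unique[OF r, of r'] that by (auto simp: decode_iff)
    ultimately have "(\<Sum>r\<in>{1..n}. of_bool (lft M X r j < int k \<and> int k \<le> M r j) :: int)
        = (\<Sum>r'\<in>{1..n}. if r' = r then 1 else 0)"
      using r by (intro sum.cong) (auto simp: decode_iff)
    then show ?thesis using True \<open>r \<in> {1..n}\<close> by simp
  next
    case False
    then show ?thesis by (auto simp: in_column_decode intro!: sum.neutral[symmetric])
  qed
  then have "(\<Sum>k\<in>{1..<Suc c}. of_bool (in_column (decode (M, X)) k j))
      = (\<Sum>r\<in>{1..n}. \<Sum>k\<in>{1..<Suc c}. of_bool (lft M X r j < int k \<and> int k \<le> M r j) :: int)"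
    by (simp only: sum.swap[of _ "{1..n}"])
  then show ?thesis by (simp only: sum_of_bool_interval[OF lft_nonneg])
qed

lemma colheight_rows:
  "colheight i c = (\<Sum>r\<in>{1..n}. max 0 (min (int c) (M r i) - lft M X r i)
     - max 0 (min (int c) (M r (Suc i)) - lft M X r (Suc i)))"
  by (simp only: colheight_def height_def sum_subtractf sum_in_column)

text \<open>At column \<open>lft M X r (Suc i)\<close> all letters \<open>i\<close> and
  \<open>i + 1\<close> of lower rows have been read, those of higher rows lie further right, and of
  row \<open>r\<close> exactly the boxes with \<open>i\<close> but not \<open>i + 1\<close> have
  been met.\<close>

lemma colheight_peak:
  assumes r: "1 \<le> r" "r \<le> n" and i: "1 \<le> i"
  shows "colheight i (nat (lft M X r (Suc i))) = peak n i M X r"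
proof -
  let ?c = "lft M X r (Suc i)"
  let ?g = "\<lambda>k. max 0 (min ?c (M k i) - lft M X k i) - max 0 (min ?c (M k (Suc i)) - lft M X k (Suc i))"
  have c: "?c \<le> M r i" using lft_le_pred[of r "Suc i"] by simp
  have below: "?g k = cnt M X i k - cnt M X (Suc i) k" if "r < k" for k
  proof -
    have "M k (Suc i) \<le> ?c" using that r by (intro M_le_lft') auto
    then show ?thesis
      using M_mono1[of k i] lft_le[of k i] lft_le[of k "Suc i"] by (simp add: cnt_def)
  qed
  have above: "?g k = 0" if "1 \<le> k" "k < r" for k
  proof -
    have "M r i \<le> lft M X k i" "M r (Suc i) \<le> lft M X k (Suc i)" using that i by (auto intro: M_le_lft')
    then show ?thesis using c lft_le[of r "Suc i"] by simp
  qed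
  have here: "?g r = rplus M X i r"
    using c lft_le[of r i] lft_le[of r "Suc i"] by (simp add: rplus_def)
  have sp: "{1..n} = {1..<r} \<union> ({r} \<union> {r<..n})" using r by auto
  have "(\<Sum>k\<in>{1..n}. ?g k) = (\<Sum>k\<in>{1..<r}. ?g k) + (?g r + (\<Sum>k\<in>{r<..n}. ?g k))"
    unfolding sp by (subst sum.union_disjoint; (subst sum.union_disjoint)?; auto)
  also have "(\<Sum>k\<in>{1..<r}. ?g k) = 0" using above by (intro sum.neutral) auto
  also have "(\<Sum>k\<in>{r<..n}. ?g k) = (\<Sum>k\<in>{r<..n}. cnt M X i k - cnt M X (Suc i) k)"
    using below by (intro sum.cong) auto
  finally show ?thesis
    using here by (simp add: colheight_rows peak_def lft_nonneg)
qed

text \<open>Row 1 is read last, so the whole word ends \<open>rminus M X i 1\<close> below its peak.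
  If no minus survives, the end is at maximal height, which rules out \<open>erow\<close>.\<close>

lemma colheight_total:
  assumes "1 \<le> n"
  shows "colheight i (nat (M 1 n)) = peak n i M X 1 - rminus M X i 1"
proof -
  have le: "M k j \<le> M 1 n" if "1 \<le> k" for k j
  proof -
    have "M k j \<le> M 1 j" using that by (intro M_antimono) auto
    also have "\<dots> \<le> M 1 n" using M_mono[of j n 1] M_stable[of j 1] by (cases "j \<le> n") auto
    finally show ?thesis .
  qed
  have "colheight i (nat (M 1 n)) = (\<Sum>k\<in>{1..n}. cnt M X i k - cnt M X (Suc i) k)"
    unfolding colheight_rows
  proof (intro sum.cong refl)
    fix k assume "k \<in> {1..n}"
    then show "max 0 (min (int (nat (M 1 n))) (M k i) - lft M X k i) - max 0 (min (int (nat (M 1 n))) (M k (Suc i)) - lft M X k (Suc i))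
        = cnt M X i k - cnt M X (Suc i) k"
      using le[of k i] le[of k "Suc i"] lft_le[of k i] lft_le[of k "Suc i"] M_nonneg[of 1 n]
      by (simp add: cnt_def)
  qed
  also have "{1..n} = insert 1 {1<..n}" using assms by auto
  finally show ?thesis
    by (simp add: peak_def rminus_def rplus_def cnt_def max_def)
qed

text \<open>Both branches of \<open>frow_act\<close> look alike in the tableau: \<open>i\<close>
  leaves column \<open>M r i\<close> and \<open>i + 1\<close> enters column
  \<open>lft M X r (Suc i)\<close>. The two columns coincide or, if \<open>X r (Suc i)\<close>, are
  adjacent.\<close>

lemma decode_frow_act:
  assumes f: "frow n i M X r" and i: "1 \<le> i"
  shows "j \<in> decode (frow_act i r (M, X)) (r', c) \<longleftrightarrow>
    (if r' = r \<and> j = i then j \<in> decode (M, X) (r, c) \<and> int c \<noteq> M r i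
     else if r' = r \<and> j = Suc i then j \<in> decode (M, X) (r, c) \<or> int c = lft M X r (Suc i)
     else j \<in> decode (M, X) (r', c))"
proof (cases "M r i = M r (i - 1)")
  case True
  then have eq: "frow_act i r (M, X) = (M, X(r := (X r)(i := False, Suc i := True)))"
    by (simp add: frow_act_def)
  note x = frow_X[OF f i True]
  show ?thesis using x i True M_mono1[of r i] by (auto simp: eq decode_iff lft_def)
next
  case False
  then have eq: "frow_act i r (M, X) = (M(r := (M r)(i := M r i - 1)), X)"
    by (simp add: frow_act_def)
  have ml: "lft M X r i \<le> M r i" by (rule lft_le)
  consider "r' \<noteq> r" | "r' = r" "j = i" | "r' = r" "j = Suc i"
    | "r' = r" "j \<noteq> i" "j \<noteq> Suc i" "j - 1 \<noteq> i" by (cases j) auto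
  then show ?thesis
  proof cases
    case 3
    have "M r i - of_bool (X r (Suc i)) \<le> M r (Suc i)" using lft_le[of r "Suc i"] by (simp add: lft_def)
    then show ?thesis using 3 i by (auto simp: eq decode_iff lft_def)
  qed (use i ml in \<open>simp_all add: eq decode_iff lft_def, auto?\<close>)
qed

lemma decode_erow_act:
  fixes i r :: nat
  assumes i: "1 \<le> i"
  defines "sw \<equiv> X r (Suc i) \<and> \<not> X r i \<and> M r i = M r (i - 1)"
  shows "j \<in> decode (erow_act i r (M, X)) (r', c) \<longleftrightarrow>
    (if r' = r \<and> j = i then j \<in> decode (M, X) (r, c) \<or> int c = (if sw then M r i else M r i + 1)
     else if r' = r \<and> j = Suc i then j \<in> decode (M, X) (r, c) \<and> int c \<noteq> lft M X r (Suc i) + 1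
     else j \<in> decode (M, X) (r', c))"
proof (cases sw)
  case True
  then have eq: "erow_act i r (M, X) = (M, X(r := (X r)(i := True, Suc i := False)))"
    by (simp add: erow_act_def sw_def)
  show ?thesis using True i M_mono1[of r i] by (auto simp: eq decode_iff lft_def sw_def)
next
  case False
  then have eq: "erow_act i r (M, X) = (M(r := (M r)(i := M r i + 1)), X)"
    by (auto simp: erow_act_def sw_def)
  have ml: "lft M X r i \<le> M r i" by (rule lft_le)
  consider "r' \<noteq> r" | "r' = r" "j = i" | "r' = r" "j = Suc i"
    | "r' = r" "j \<noteq> i" "j \<noteq> Suc i" "j - 1 \<noteq> i" by (cases j) auto
  then show ?thesis
  proof cases
    case 3
    have "M r i - of_bool (X r (Suc i)) \<le> M r (Suc i)" using lft_le[of r "Suc i"] by (simp add: lft_def)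
    then show ?thesis using 3 i by (auto simp: eq decode_iff lft_def)
  qed (use i ml False in \<open>simp_all add: eq decode_iff lft_def, auto?\<close>)
qed

end

section \<open>The column rule carried out on patterns\<close>

context pattern begin

lemma cancel_signature:
  assumes N: "M 1 n = int (ncols la)"
  obtains P Q where "[c. (s, c) \<leftarrow> cancel (signature la i (decode (M, X))), s = Plus] = P"
    "[c. (s, c) \<leftarrow> cancel (signature la i (decode (M, X))), s = Minus] = Q"
    "P = [] \<or> 1 \<le> last P \<and> last P \<le> ncols la \<and> in_column (decode (M, X)) (last P) i \<and>
       \<not> in_column (decode (M, X)) (last P) (Suc i) \<and> colheight i (last P) = int (length P) \<and>
       (\<forall>c < last P. colheight i c < int (length P))"
    "Q = [] \<and> colheight i (ncols la) = int (length P) \<or>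
       Q \<noteq> [] \<and> 1 \<le> hd Q \<and> hd Q \<le> ncols la \<and> \<not> in_column (decode (M, X)) (hd Q) i \<and>
       in_column (decode (M, X)) (hd Q) (Suc i) \<and> colheight i (hd Q - 1) = int (length P) \<and>
       (\<forall>c. hd Q \<le> c \<and> c \<le> ncols la \<longrightarrow> colheight i c < int (length P))"
    "\<And>c. c \<le> ncols la \<Longrightarrow> colheight i c \<le> int (length P)"
proof -
  let ?T = "decode (M, X)"
  let ?p = "\<lambda>c. in_column ?T c i" and ?m = "\<lambda>c. in_column ?T c (Suc i)"
  have sig: "signature la i ?T = sign_word ?p ?m 1 (Suc (ncols la))"
    by (simp add: signature_def sign_word_def)
  obtain P Q where c: "cancel (signature la i ?T) = map (Pair Plus) P @ map (Pair Minus) Q"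
    and r: "reduced ?p ?m 1 (Suc (ncols la)) P Q"
    unfolding sig using cancel_sign_word[of 1 "Suc (ncols la)" ?p ?m] by auto
  have H: "height ?p ?m 1 (Suc c) = colheight i c" for c by (simp add: colheight_def)
  show ?thesis
  proof (rule that)
    show "[c. (s, c) \<leftarrow> cancel (signature la i ?T), s = Plus] = P"
      "[c. (s, c) \<leftarrow> cancel (signature la i ?T), s = Minus] = Q"
      unfolding c by (rule signs_of_reduced)+
    show "P = [] \<or> 1 \<le> last P \<and> last P \<le> ncols la \<and> ?p (last P) \<and> \<not> ?m (last P) \<and>
       colheight i (last P) = int (length P) \<and> (\<forall>c < last P. colheight i c < int (length P))"
      using r unfolding reduced_def by (auto simp flip: H)
    show "Q = [] \<and> colheight i (ncols la) = int (length P) \<or>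
       Q \<noteq> [] \<and> 1 \<le> hd Q \<and> hd Q \<le> ncols la \<and> \<not> ?p (hd Q) \<and> ?m (hd Q) \<and>
       colheight i (hd Q - 1) = int (length P) \<and>
       (\<forall>c. hd Q \<le> c \<and> c \<le> ncols la \<longrightarrow> colheight i c < int (length P))"
      using r unfolding reduced_def by (auto simp flip: H)
    show "colheight i c \<le> int (length P)" if "c \<le> ncols la" for c
      using reduced_le[OF r, of "Suc c"] that unfolding H by simp
  qed
qed

lemma M_le_ncols:
  assumes N: "M 1 n = int (ncols la)"
  shows "1 \<le> r \<Longrightarrow> M r j \<le> int (ncols la)"
proof -
  assume r: "1 \<le> r"
  have "M r j \<le> M 1 j" using r by (intro M_antimono) auto
  also have "\<dots> \<le> M 1 n" using M_mono[of j n 1] M_stable[of j 1] by (cases "j \<le> n") auto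
  finally show ?thesis using N by simp
qed

lemma row_of_column:
  assumes "in_column (decode (M, X)) c j"
  obtains r where "1 \<le> r" "r \<le> n" "1 \<le> j" "lft M X r j < int c" "int c \<le> M r j"
proof -
  obtain r where r: "j \<in> decode (M, X) (r, c)" using assms by (auto simp: in_column_def)
  then have "r \<le> n" using lft_nonneg[of r j] M_zero_row[of r j] by (cases "r \<le> n") (auto simp: decode_iff)
  then show ?thesis using that decode_range[OF r] r by (auto simp: decode_iff)
qed

lemma colheight_Suc: "colheight i (Suc c) = colheight i c
    + of_bool (in_column (decode (M, X)) (Suc c) i) - of_bool (in_column (decode (M, X)) (Suc c) (Suc i))"
  by (simp add: colheight_def height_Suc)

lemma f_op_decode:
  assumes N: "M 1 n = int (ncols la)" and i: "1 \<le> i"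
  shows "f_op la i (decode (M, X)) = map_option decode (f_pat n i (M, X))"
proof -
  let ?T = "decode (M, X)" and ?h = "colheight i"
  obtain P where P: "[c. (s, c) \<leftarrow> cancel (signature la i ?T), s = Plus] = P"
    and Pn: "P = [] \<or> 1 \<le> last P \<and> last P \<le> ncols la \<and> in_column ?T (last P) i \<and>
       \<not> in_column ?T (last P) (Suc i) \<and> ?h (last P) = int (length P) \<and>
       (\<forall>c < last P. ?h c < int (length P))"
    and Ph: "\<And>c. c \<le> ncols la \<Longrightarrow> ?h c \<le> int (length P)"
    by (rule cancel_signature[OF N, of i]) (rule that; assumption)
  have lft_N: "nat (lft M X k (Suc i)) \<le> ncols la" if "1 \<le> k" for k
    using lft_le[of k "Suc i"] M_le_ncols[OF N that, of "Suc i"] by simp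
  show ?thesis
  proof (cases "P = []")
    case True
    have "\<not> frow n i M X r" for r
      using Ph[OF lft_N[of r]] colheight_peak[of r i] i True by (auto simp: frow_def)
    then show ?thesis using True P by (simp add: f_op_def Let_def f_pat_None)
  next
    case False
    define c where "c = last P"
    have c: "1 \<le> c" "c \<le> ncols la" "in_column ?T c i" "\<not> in_column ?T c (Suc i)"
      "?h c = int (length P)" "\<And>c'. c' < c \<Longrightarrow> ?h c' < ?h c" "\<And>c'. c' \<le> ncols la \<Longrightarrow> ?h c' \<le> ?h c"
      using Pn Ph False by (auto simp: c_def)
    obtain r where r: "1 \<le> r" "r \<le> n" "lft M X r i < int c" "int c \<le> M r i"
      using row_of_column[OF c(3)] by metis
    have nc: "\<not> (lft M X k (Suc i) < int c \<and> int c \<le> M k (Suc i))" for k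
      using c(4) by (auto simp: in_column_decode)
    \<comment> \<open>Otherwise \<open>i\<close> also occurs in column \<open>c + 1\<close> of row
      \<open>r\<close>. As the height is maximal at \<open>c\<close>, that column contains
      \<open>i + 1\<close> as well, in some row \<open>k\<close>. For \<open>k = r\<close> it would
      lie too far left, for \<open>k < r\<close> it would stand above a smaller letter, and for
      \<open>k > r\<close> column \<open>c\<close> would contain \<open>i + 1\<close> too.\<close>
    have cl: "int c = lft M X r (Suc i)"
    proof (rule ccontr)
      assume "int c \<noteq> lft M X r (Suc i)"
      then have lt: "int c < lft M X r (Suc i)" using nc[of r] r M_mono1[of r i] by linarith
      then have Mr: "int (Suc c) \<le> M r i" using lft_le_pred[of r "Suc i"] by simp
      then have "in_column ?T (Suc c) i" using r by (auto simp: in_column_decode intro!: exI[of _ r])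
      moreover have "?h (Suc c) \<le> ?h c"
        using c(7)[of "Suc c"] Mr M_le_ncols[OF N r(1), of i] by simp
      ultimately have "in_column ?T (Suc c) (Suc i)"
        by (cases "in_column ?T (Suc c) (Suc i)") (simp_all add: colheight_Suc)
      then obtain k where k: "1 \<le> k" "lft M X k (Suc i) < int (Suc c)" "int (Suc c) \<le> M k (Suc i)"
        using row_of_column by metis
      consider "k = r" | "k < r" | "r < k" by linarith
      then show False
      proof cases
        case 1
        then show ?thesis using k lt by simp
      next
        case 2
        then show ?thesis using k Mr M_le_lft'[of k r "Suc i"] M_mono1[of r i] by simp
      next
        case 3
        then have "lft M X k (Suc i) < int c"
          using M_le_lft'[of r k i] lft_le_pred[of k "Suc i"] r i by simp
        then show ?thesis using nc[of k] k by simp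
      qed
    qed
    have pk: "peak n i M X r = ?h c"
      using colheight_peak[OF r(1,2) i] by (simp flip: cl)
    have f: "frow n i M X r"
      unfolding frow_def
    proof (intro conjI allI impI)
      fix k
      show "peak n i M X k < peak n i M X r" if k: "r < k \<and> k \<le> n"
      proof -
        have "lft M X k (Suc i) < int c"
          using k M_le_lft'[of r k i] lft_le_pred[of k "Suc i"] r i by simp
        then have "nat (lft M X k (Suc i)) < c" using lft_nonneg[of k "Suc i"] by linarith
        then show ?thesis using c(6)[of "nat (lft M X k (Suc i))"] colheight_peak[of k i] k r i by (simp add: pk)
      qed
      show "peak n i M X k \<le> peak n i M X r" if k: "1 \<le> k \<and> k < r"
        using c(7)[OF lft_N[of k]] colheight_peak[of k i] k r i by (simp add: pk)
    qed (use r pk c(5) False in auto)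
    have iT: "j \<in> ?T (r, c') \<longleftrightarrow> lft M X r j < int c' \<and> int c' \<le> M r j" for j c' by (rule decode_iff)
    have row: "(THE r. i \<in> ?T (r, c)) = r"
      using decode_col_unique r(3,4) by (intro the_equality) (auto simp: iT)
    \<comment> \<open>The second alternative is that the box to the right contains \<open>i\<close>
      along with a nonminimal \<open>i + 1\<close>, which is the second case of
      \<open>f_op\<close>.\<close>
    have Mc: "M r i = int c \<or> M r i = int (Suc c)"
      using cl r(4) by (auto simp: lft_def split: if_splits)
    have nxt: "i \<in> ?T (r, c + 1) \<longleftrightarrow> M r i \<noteq> int c" using Mc r(3) by (auto simp: iT)
    have act: "j \<in> decode (frow_act i r (M, X)) (r', c') \<longleftrightarrow>
      (if r' = r \<and> j = i then j \<in> ?T (r, c') \<and> int c' \<noteq> M r i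
       else if r' = r \<and> j = Suc i then j \<in> ?T (r, c') \<or> c' = c else j \<in> ?T (r', c'))" for j r' c'
      unfolding decode_frow_act[OF f i] by (simp flip: cl)
    have eq: "(if i \<notin> ?T (r, c + 1) then ?T((r, c) := insert (i + 1) (?T (r, c) - {i}))
        else ?T((r, c + 1) := ?T (r, c + 1) - {i}, (r, c) := insert (i + 1) (?T (r, c))))
        = decode (frow_act i r (M, X))" (is "?L = ?R")
    proof
      fix b :: box
      obtain r' c' where b: "b = (r', c')" by fastforce
      show "?L b = ?R b"
      proof (rule set_eqI)
        fix j
        show "j \<in> ?L b \<longleftrightarrow> j \<in> ?R b"
          unfolding b act nxt using Mc i by (auto split: if_splits)
      qed
    qed
    show ?thesis
      using False unfolding f_op_def Let_def P c_def[symmetric] row f_pat_frow[OF f] eq by simp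
  qed
qed

lemma e_op_decode:
  assumes N: "M 1 n = int (ncols la)" and i: "1 \<le> i" "i < n"
  shows "e_op la i (decode (M, X)) = map_option decode (e_pat n i (M, X))"
proof -
  let ?T = "decode (M, X)" and ?h = "colheight i"
  obtain P Q where Q: "[c. (s, c) \<leftarrow> cancel (signature la i ?T), s = Minus] = Q"
    and Qn: "Q = [] \<and> ?h (ncols la) = int (length P) \<or>
       Q \<noteq> [] \<and> 1 \<le> hd Q \<and> hd Q \<le> ncols la \<and> \<not> in_column ?T (hd Q) i \<and>
       in_column ?T (hd Q) (Suc i) \<and> ?h (hd Q - 1) = int (length P) \<and>
       (\<forall>c. hd Q \<le> c \<and> c \<le> ncols la \<longrightarrow> ?h c < int (length P))"
    and Ph: "\<And>c. c \<le> ncols la \<Longrightarrow> ?h c \<le> int (length (P :: nat list))"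
    by (rule cancel_signature[OF N, of i]) (rule that; assumption)
  have lft_N: "nat (lft M X k (Suc i)) \<le> ncols la" if "1 \<le> k" for k
    using lft_le[of k "Suc i"] M_le_ncols[OF N that, of "Suc i"] by simp
  show ?thesis
  proof (cases "Q = []")
    case True
    have "\<not> erow n i M X r" for r
    proof
      assume e: "erow n i M X r"
      then have r: "1 \<le> r" "r \<le> n" by (auto simp: erow_def)
      have "peak n i M X r \<le> ?h (ncols la)"
        using Ph[OF lft_N[OF r(1)]] colheight_peak[OF r i(1)] Qn True by simp
      also have "\<dots> = peak n i M X 1 - rminus M X i 1"
        using colheight_total[of i] N i by simp
      finally show False
        using e rminus_nonneg[of i 1] r by (cases "r = 1") (auto simp: erow_def)
    qed
    then show ?thesis using True Q by (simp add: e_op_def Let_def e_pat_None)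
  next
    case False
    obtain b where hd: "hd Q = Suc b" using Qn False by (cases "hd Q") auto
    define c where "c = Suc b"
    have c: "c \<le> ncols la" "\<not> in_column ?T c i" "in_column ?T c (Suc i)"
      "\<And>c'. c' \<le> ncols la \<Longrightarrow> ?h c' \<le> ?h b" "\<And>c'. c \<le> c' \<Longrightarrow> c' \<le> ncols la \<Longrightarrow> ?h c' < ?h b"
      "0 \<le> ?h b"
      using Qn Ph False by (auto simp: c_def hd)
    obtain r where r: "1 \<le> r" "r \<le> n" "lft M X r (Suc i) < int c" "int c \<le> M r (Suc i)"
      using row_of_column[OF c(3)] by metis
    have nc: "\<not> (lft M X k i < int c \<and> int c \<le> M k i)" for k
      using c(2) by (auto simp: in_column_decode)
    have MX: "lft M X r (Suc i) = M r i - of_bool (X r (Suc i))" by (simp add: lft_def)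
    have ml: "lft M X r i \<le> M r i" "M r (i - 1) \<le> M r i" using lft_le M_mono[of "i - 1" i r] by auto
    define sw where "sw \<longleftrightarrow> X r (Suc i) \<and> \<not> X r i \<and> M r i = M r (i - 1)"
    \<comment> \<open>Either \<open>i + 1\<close> does not occur to the left of column
      \<open>c\<close> in row \<open>r\<close>, or the box on the left contains both
      \<open>i\<close> and \<open>i + 1\<close>. In the latter case column \<open>b\<close> carries
      no sign, so the heights before and after it agree and both alternatives yield the same
      peak.\<close>
    have key: "int c = (if sw then M r i else M r i + 1) \<and>
        (lft M X r (Suc i) = int b \<or> 
         lft M X r (Suc i) = int b - 1 \<and> in_column ?T b i \<and> in_column ?T b (Suc i) \<and> 1 \<le> b)"
    proof (cases "lft M X r (Suc i) = int b")
      case True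
      show ?thesis
      proof (cases "X r (Suc i)")
        case x: True
        then have "M r i = int c" using True MX by (simp add: c_def)
        then have "M r i \<le> lft M X r i" using nc[of r] by linarith
        then have "\<not> X r i \<and> M r i = M r (i - 1)" using ml by (cases "X r i") (auto simp: lft_def)
        then show ?thesis using True x \<open>M r i = int c\<close> by (simp add: sw_def)
      next
        case False
        then show ?thesis using True MX by (simp add: sw_def c_def)
      qed
    next
      case False
      then have lt: "lft M X r (Suc i) < int b" using r(3) by (simp add: c_def)
      have b1: "1 \<le> b" using lt lft_nonneg[of r "Suc i"] by linarith
      then obtain b' where b': "b = Suc b'" by (cases b) auto
      have cb: "in_column ?T b (Suc i)"
        using lt r(4) by (auto simp: in_column_decode c_def intro!: exI[of _ r])
      moreover have "?h b' \<le> ?h b" using c(1,4) by (simp add: c_def b')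
      ultimately have ib: "in_column ?T b i"
        by (cases "in_column ?T b i") (simp_all add: b' colheight_Suc)
      then obtain k where k: "1 \<le> k" "lft M X k i < int b" "int b \<le> M k i"
        using row_of_column by metis
      then have Mk: "M k i = int b" using nc[of k] by (simp add: c_def)
      have "k = r"
      proof (rule ccontr)
        assume "k \<noteq> r"
        then consider "k < r" | "r < k" by linarith
        then show False
        proof cases
          case 1
          then show ?thesis
            using M_le_lft'[of k r "Suc i"] lft_le_pred[of k "Suc i"] k Mk r(4) by (simp add: c_def)
        next
          case 2
          then show ?thesis
            using M_le_lft'[of r k "Suc i"] M_mono1[of k i] Mk lt r by simp
        qed
      qed
      then have x: "X r (Suc i)" "lft M X r (Suc i) = int b - 1" "lft M X r i < M r i"
        using lt MX Mk k by (auto split: if_splits)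
      then have "\<not> sw" by (auto simp: sw_def lft_def)
      then show ?thesis using Mk \<open>k = r\<close> x ib cb b1 by (simp add: c_def)
    qed
    have pk: "peak n i M X r = ?h b"
    proof (cases "lft M X r (Suc i) = int b")
      case True
      then show ?thesis using colheight_peak[OF r(1,2) i(1)] by simp
    next
      case False
      then obtain b' where b': "b = Suc b'" "lft M X r (Suc i) = int b'" using key by (cases b) auto
      then show ?thesis using colheight_peak[OF r(1,2) i(1)] key False by (simp add: colheight_Suc)
    qed
    have e: "erow n i M X r"
      unfolding erow_def
    proof (intro conjI allI impI)
      show "0 < rminus M X i r"
      proof (cases sw)
        case True
        then show ?thesis using M_mono1[of r i] by (simp add: rminus_def lft_def sw_def)
      next
        case False
        then show ?thesis using key r(4) by (simp add: rminus_def)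
      qed
      fix k
      show "peak n i M X k \<le> peak n i M X r" if k: "r < k \<and> k \<le> n"
        using c(4)[OF lft_N[of k]] colheight_peak[of k i] k r i by (simp add: pk)
      show "peak n i M X k < peak n i M X r" if k: "1 \<le> k \<and> k < r"
      proof -
        have "int c \<le> lft M X k (Suc i)" using k M_le_lft'[of k r "Suc i"] r(4) by simp
        then have "c \<le> nat (lft M X k (Suc i))" by linarith
        then show ?thesis using c(5)[OF _ lft_N[of k]] colheight_peak[of k i] k r i by (simp add: pk)
      qed
    qed (use r pk c(6) in auto)
    have iT: "j \<in> ?T (r, c') \<longleftrightarrow> lft M X r j < int c' \<and> int c' \<le> M r j" for j c' by (rule decode_iff)
    have row: "(THE r. i + 1 \<in> ?T (r, c)) = r"
      using decode_col_unique r(3,4) by (intro the_equality) (auto simp: iT)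
    have prev: "i + 1 \<in> ?T (r, c - 1) \<longleftrightarrow> lft M X r (Suc i) \<noteq> int b"
      using key r(4) by (auto simp: iT c_def)
    have act: "j \<in> decode (erow_act i r (M, X)) (r', c') \<longleftrightarrow>
      (if r' = r \<and> j = i then j \<in> ?T (r, c') \<or> c' = c
       else if r' = r \<and> j = Suc i then j \<in> ?T (r, c') \<and> int c' \<noteq> lft M X r (Suc i) + 1
       else j \<in> ?T (r', c'))" for j r' c'
    proof -
      have c: "int c' = (if sw then M r i else M r i + 1) \<longleftrightarrow> c' = c" using key by auto
      show ?thesis unfolding decode_erow_act[OF i(1), of j r r' c', folded sw_def] c ..
    qed
    have eq: "(if i + 1 \<notin> ?T (r, c - 1) then ?T((r, c) := insert i (?T (r, c) - {i + 1}))
        else ?T((r, c - 1) := ?T (r, c - 1) - {i + 1}, (r, c) := insert i (?T (r, c))))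
        = decode (erow_act i r (M, X))" (is "?L = ?R")
    proof
      fix x :: box
      obtain r' c' where x: "x = (r', c')" by fastforce
      show "?L x = ?R x"
      proof (rule set_eqI)
        fix j
        show "j \<in> ?L x \<longleftrightarrow> j \<in> ?R x"
          unfolding x act prev using key by (auto simp: c_def split: if_splits)
      qed
    qed
    show ?thesis
      using False unfolding e_op_def Let_def Q hd c_def[symmetric] row e_pat_erow[OF e] eq by simp
  qed
qed

end

section \<open>The decomposition\<close>

text \<open>For \<open>p = q = n\<close> a positive label would need a row beyond \<open>n\<close>,
  where a pattern has no boxes. So nothing is recorded and the outer shape is
  \<open>la\<close>.\<close>

lemma stage_first:
  "stage n (row_len la) n n = {(M, X, U). (M, X) \<in> patterns n la \<and> U = (\<lambda>_. 0)}"
proof -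
  have "(M, X, U) \<in> stage n (row_len la) n n \<longleftrightarrow> (M, X) \<in> patterns n la \<and> U = (\<lambda>_. 0)" for M X U
  proof
    assume s: "(M, X, U) \<in> stage n (row_len la) n n"
    then interpret pattern n M X by (simp add: stage_def)
    have U: "0 < U (r, c) \<longleftrightarrow> row_len la r < c \<and> int c \<le> M r n" and a: "int (row_len la r) \<le> M r n" for r c
      using s by (simp_all add: stage_def skew_increasing_def)
    have U0: "U (r, c) = 0" for r c
    proof (rule ccontr)
      assume "U (r, c) \<noteq> 0"
      moreover have "0 < U (r, c) \<longrightarrow> U (r, c) + n + of_bool (n < r) \<le> r"
        using s by (simp add: stage_def)
      ultimately have "n < r" "0 < M r n" using U[of r c] by auto
      then show False using M_zero_row[of r n] by simp
    qed
    have "M r n = int (row_len la r)" for r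
      using U[of r "nat (M r n)"] a[of r] by (auto simp: U0)
    then show "(M, X) \<in> patterns n la \<and> U = (\<lambda>_. 0)"
      using pattern_axioms U0 by (auto simp: patterns_def)
  next
    assume p: "(M, X) \<in> patterns n la \<and> U = (\<lambda>_. 0)"
    then interpret pattern n M X by (simp add: patterns_def)
    show "(M, X, U) \<in> stage n (row_len la) n n"
      using p pattern_axioms X_row_less(2)
      by (auto simp: stage_def skew_increasing_def patterns_def)
  qed
  then show ?thesis by auto
qed

lemma SVT_isomorphic_stage:
  assumes "is_partition la"
  shows "isomorphic_crystals n (stage_crystal n (row_len la) n n) (SVT_crystal n la)"
  unfolding isomorphic_crystals_def
proof (intro exI)
  let ?C = "stage_crystal n (row_len la) n n" and ?\<psi> = "\<lambda>(M, X, U :: box \<Rightarrow> nat). decode (M, X)"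
  have E: "elems ?C = {(M, X, U). (M, X) \<in> patterns n la \<and> U = (\<lambda>_. 0)}"
    by (simp add: stage_crystal_def stage_first)
  have "bij_betw (\<lambda>(M, X, U). (M, X)) (elems ?C) (patterns n la)"
    unfolding E by (rule bij_betw_byWitness[where f' = "\<lambda>(M, X). (M, X, \<lambda>_. 0)"]) auto
  from bij_betw_trans[OF this bij_betw_decode[OF assms]]
  have b: "bij_betw ?\<psi> (elems ?C) (SVT n la)" by (simp add: comp_def case_prod_unfold)
  show "crystal_isomorphism n ?C (SVT_crystal n la) ?\<psi>"
    unfolding crystal_isomorphism_def commutes_on_def
  proof (intro conjI ballI)
    show "bij_betw ?\<psi> (elems ?C) (elems (SVT_crystal n la))" using b by (simp add: SVT_crystal_def)
    fix x assume x: "x \<in> elems ?C"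
    obtain M X U where xx: "x = (M, X, U)" by (cases x)
    have p: "pattern n M X" and N: "M 1 n = int (ncols la)"
      using x by (auto simp: E xx patterns_def ncols_row_len)
    show "wt (SVT_crystal n la) (?\<psi> x) = wt ?C x"
      by (simp add: xx SVT_crystal_def stage_crystal_def pattern.content_decode[OF p])
    fix i assume "i \<in> {1..<n}"
    then have i: "1 \<le> i" "i < n" by auto
    show "set_option (e_of ?C i x) \<subseteq> elems ?C" "set_option (f_of ?C i x) \<subseteq> elems ?C"
      using partial_inversesD[OF partial_inverses_stage i x] by auto
    show "map_option ?\<psi> (e_of ?C i x) = e_of (SVT_crystal n la) i (?\<psi> x)"
      using pattern.e_op_decode[OF p N i]
      by (simp add: xx stage_crystal_def SVT_crystal_def option.map_comp comp_def case_prod_unfold)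
    show "map_option ?\<psi> (f_of ?C i x) = f_of (SVT_crystal n la) i (?\<psi> x)"
      using pattern.f_op_decode[OF p N i(1)]
      by (simp add: xx stage_crystal_def SVT_crystal_def option.map_comp comp_def case_prod_unfold)
  qed
qed

section \<open>Partitions and row lengths\<close>

lemma row_len_pos_iff:
  assumes "is_partition mu" shows "0 < row_len mu r \<longleftrightarrow> 1 \<le> r \<and> r \<le> length mu"
proof -
  have "mu ! (r - 1) \<noteq> 0" if "1 \<le> r" "r \<le> length mu"
  proof -
    have "mu ! (r - 1) \<in> set mu" using that by simp
    then show ?thesis using assms by (metis is_partition_def)
  qed
  then show ?thesis by (auto simp: row_len_def)
qed

lemma partition_eqI:
  assumes "is_partition mu" "is_partition nu" "\<And>r. row_len mu r = row_len nu r"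
  shows "mu = nu"
proof (rule nth_equalityI)
  have "1 \<le> r \<and> r \<le> length mu \<longleftrightarrow> 1 \<le> r \<and> r \<le> length nu" for r
    using row_len_pos_iff assms by metis
  from this[of "length mu"] this[of "length nu"] show l: "length mu = length nu" by linarith
  show "mu ! k = nu ! k" if "k < length mu" for k
    using assms(3)[of "Suc k"] that l by (simp add: row_len_def)
qed

lemma ex_partition:
  assumes anti: "\<And>r. 1 \<le> r \<Longrightarrow> \<rho> (Suc r) \<le> \<rho> r" and z: "\<rho> 0 = 0" "\<And>r. n < r \<Longrightarrow> \<rho> r = (0 :: nat)"
  shows "\<exists>mu. is_partition mu \<and> (\<forall>r. row_len mu r = \<rho> r)"
proof -
  have le: "\<rho> r' \<le> \<rho> r" if "r \<le> r'" "1 \<le> r" for r r'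
    using that(1)
  proof (induction r' rule: dec_induct)
    case (step k)
    then show ?case using anti[of k] that(2) by simp
  qed simp
  define S where "S = {r. 0 < \<rho> r}"
  have "S \<subseteq> {..n}"
  proof
    fix r assume "r \<in> S"
    then show "r \<in> {..n}" using z(2)[of r] by (cases "r \<le> n") (auto simp: S_def)
  qed
  then have fin: "finite S" "0 \<notin> S" by (auto simp: S_def z(1) dest: finite_subset)
  have "S = {1..card S}"
  proof (rule down_closed_interval[OF fin])
    fix c c' assume "c \<in> S" "1 \<le> c'" "c' < c"
    then show "c' \<in> S" using le[of c' c] by (simp add: S_def)
  qed
  then have S: "0 < \<rho> r \<longleftrightarrow> 1 \<le> r \<and> r \<le> card S" for r
  proof -
    have "0 < \<rho> r \<longleftrightarrow> r \<in> S" by (simp add: S_def)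
    also have "\<dots> \<longleftrightarrow> r \<in> {1..card S}" using \<open>S = {1..card S}\<close> by (rule arg_cong)
    finally show ?thesis by simp
  qed
  define mu where "mu = map \<rho> [1..<Suc (card S)]"
  have nth: "mu ! k = \<rho> (Suc k)" if "k < card S" for k
    using that by (simp add: mu_def del: upt_Suc)
  have len: "length mu = card S" by (simp add: mu_def)
  have "is_partition mu"
    unfolding is_partition_def
  proof
    show "sorted_wrt (\<ge>) mu"
      unfolding sorted_wrt_iff_nth_less using le by (auto simp: len nth)
    have "\<rho> r \<noteq> 0" if "r \<in> {1..<Suc (card S)}" for r using S[of r] that by simp
    then show "0 \<notin> set mu" unfolding mu_def set_map set_upt by (metis imageE)
  qed
  moreover have "row_len mu r = \<rho> r" for r
    using S[of r] by (auto simp: row_len_def len nth)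
  ultimately show ?thesis by blast
qed

definition shape_of :: "nat \<Rightarrow> (nat \<Rightarrow> nat \<Rightarrow> int) \<Rightarrow> nat list" where
  "shape_of n M = (THE mu. is_partition mu \<and> (\<forall>r. M r n = int (row_len mu r)))"

lemma shape_of_eq:
  assumes "is_partition mu" "\<And>r. M r n = int (row_len mu r)"
  shows "shape_of n M = mu"
  unfolding shape_of_def
proof (rule the_equality)
  fix nu assume "is_partition nu \<and> (\<forall>r. M r n = int (row_len nu r))"
  then show "nu = mu" using assms by (intro partition_eqI) auto
qed (use assms in simp)

lemma (in pattern) shape_of:
  "is_partition (shape_of n M)" "M r n = int (row_len (shape_of n M) r)"
proof -
  obtain mu where mu: "is_partition mu" "\<And>r. row_len mu r = nat (M r n)"
    using ex_partition[of "\<lambda>r. nat (M r n)" n] M_antimono[of _ _ n] M_row0 M_zero_row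
    by (metis (no_types, lifting) le_SucI le_refl nat_0 nat_mono)
  then have *: "M r n = int (row_len mu r)" for r by (simp add: M_nonneg)
  then show "is_partition (shape_of n M)" "M r n = int (row_len (shape_of n M) r)"
    using mu shape_of_eq[OF mu(1), of M n] by simp_all
qed

section \<open>The last stage and flagged tableaux\<close>

lemma skew_diagram: "(r, c) \<in> diagram mu - diagram la \<longleftrightarrow> row_len la r < c \<and> c \<le> row_len mu r"
  by (auto simp: diagram_row_len)

text \<open>Containment of the shapes has to be stated separately, because
  \<open>increasing_tableaux\<close> is defined for arbitrary pairs of shapes, whereas
  \<open>skew_increasing\<close> includes it.\<close>

lemma skew_increasing_iff:
  assumes M: "\<And>r. M r n = int (row_len mu r)"
  shows "skew_increasing n (row_len la) M U \<longleftrightarrow>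
    diagram la \<subseteq> diagram mu \<and> U \<in> increasing_tableaux la mu"
proof -
  have sub: "diagram la \<subseteq> diagram mu \<longleftrightarrow> (\<forall>r. row_len la r \<le> row_len mu r)"
  proof
    assume *: "diagram la \<subseteq> diagram mu"
    show "\<forall>r. row_len la r \<le> row_len mu r"
    proof
      fix r
      show "row_len la r \<le> row_len mu r"
        using * diagram_row_len[of r "row_len la r" la] diagram_row_len[of r "row_len la r" mu]
        by (cases "row_len la r = 0") auto
    qed
  next
    assume *: "\<forall>r. row_len la r \<le> row_len mu r"
    show "diagram la \<subseteq> diagram mu"
    proof (clarify)
      fix r c assume "(r, c) \<in> diagram la"
      then show "(r, c) \<in> diagram mu" using *[rule_format, of r] by (simp add: diagram_row_len)
    qed
  qed
  have supp: "(\<forall>b\<in>diagram mu - diagram la. 0 < U b) \<and> (\<forall>b. b \<notin> diagram mu - diagram la \<longrightarrow> U b = 0)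
      \<longleftrightarrow> (\<forall>r c. 0 < U (r, c) \<longleftrightarrow> row_len la r < c \<and> c \<le> row_len mu r)" (is "?A \<longleftrightarrow> ?B")
  proof -
    have "?A \<longleftrightarrow> (\<forall>b. 0 < U b \<longleftrightarrow> b \<in> diagram mu - diagram la)" by (metis gr0I less_irrefl)
    then show ?thesis by (simp only: split_paired_All skew_diagram)
  qed
  show ?thesis
  proof (cases ?B)
    case True
    then have S: "(r, c) \<in> diagram mu - diagram la \<longleftrightarrow> 0 < U (r, c)" for r c
      by (simp only: skew_diagram)
    show ?thesis
      using True supp unfolding skew_increasing_def increasing_tableaux_def Let_def mem_Collect_eq S
      by (simp add: M sub)
  next
    case False
    then have "\<not> skew_increasing n (row_len la) M U" by (auto simp: skew_increasing_def M)
    moreover have "U \<notin> increasing_tableaux la mu"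
      using False supp unfolding increasing_tableaux_def Let_def mem_Collect_eq by blast
    ultimately show ?thesis by simp
  qed
qed

text \<open>For \<open>p = 1\<close> and \<open>q = n\<close> marks could only be in row 0 or row
  \<open>n\<close>, which are never marked. Boxes of the skew shape have
  \<open>1 \<le> r \<le> n\<close>, so the stage bound becomes the flag bound and the subtraction in
  \<open>r - 1\<close> is genuine.\<close>

lemma stage_last_iff:
  assumes p: "pattern n M X" and M: "\<And>r. M r n = int (row_len mu r)"
  shows "(M, X, U) \<in> stage n (row_len la) 1 n \<longleftrightarrow> (\<forall>r j. \<not> X r j) \<and>
    diagram la \<subseteq> diagram mu \<and> U \<in> flagged_increasing_tableaux la mu"
proof -
  interpret pattern n M X by fact
  have x: "(\<forall>r j. X r j \<longrightarrow> r < 1 \<or> r = n) \<longleftrightarrow> (\<forall>r j. \<not> X r j)"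
    using X_row_less(2) X_range by (metis less_irrefl not_le)
  have flag: "(\<forall>r c. 0 < U (r, c) \<longrightarrow> U (r, c) + 1 + of_bool (n < r) \<le> r) \<longleftrightarrow>
      (\<forall>(r, c)\<in>diagram mu - diagram la. U (r, c) \<le> r - 1)" if "skew_increasing n (row_len la) M U"
  proof -
    have S: "0 < U (r, c) \<longleftrightarrow> (r, c) \<in> diagram mu - diagram la" for r c
      unfolding skew_diagram using that by (simp add: skew_increasing_def M)
    have "1 \<le> r \<and> r \<le> n" if "(r, c) \<in> diagram mu - diagram la" for r c
      using that M_zero_row[of r n] M_row0[of n] M[of r] unfolding skew_diagram
      by (cases "r \<le> n"; cases r) auto
    then have "(0 < U (r, c) \<longrightarrow> U (r, c) + 1 + of_bool (n < r) \<le> r) \<longleftrightarrow>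
      ((r, c) \<in> diagram mu - diagram la \<longrightarrow> U (r, c) \<le> r - 1)" for r c
      unfolding S by fastforce
    then show ?thesis by (simp only: Ball_def split_paired_All case_prod_conv)
  qed
  have st: "(M, X, U) \<in> stage n (row_len la) 1 n \<longleftrightarrow> skew_increasing n (row_len la) M U \<and>
      (\<forall>r j. \<not> X r j) \<and> (\<forall>r c. 0 < U (r, c) \<longrightarrow> U (r, c) + 1 + of_bool (n < r) \<le> r)"
    unfolding stage_def mem_Collect_eq case_prod_conv x using p by blast
  have sk: "skew_increasing n (row_len la) M U \<longleftrightarrow>
      diagram la \<subseteq> diagram mu \<and> U \<in> increasing_tableaux la mu"
    by (rule skew_increasing_iff) (rule M)
  show ?thesis
    unfolding st flagged_increasing_tableaux_def mem_Collect_eq using flag sk by blast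
qed

lemma finite_diagram: "finite (diagram mu)"
proof -
  have "diagram mu \<subseteq> (SIGMA r:{..length mu}. {..row_len mu r})"
    by (auto simp: diagram_row_len row_len_def split: if_splits)
  then show ?thesis by (rule finite_subset) simp
qed

text \<open>Ensures that the cardinality \<open>num_flagged\<close> really counts: the flag
  condition bounds all entries by the number of rows.\<close>

lemma finite_flagged: "finite (flagged_increasing_tableaux la mu)"
proof (rule finite_subset)
  let ?S = "diagram mu - diagram la"
  show "flagged_increasing_tableaux la mu
      \<subseteq> {U. \<forall>b. (b \<in> ?S \<longrightarrow> U b \<in> {..length mu}) \<and> (b \<notin> ?S \<longrightarrow> U b = 0)}"
  proof (intro subsetI CollectI allI conjI impI)
    fix U :: "box \<Rightarrow> nat" and b :: box
    assume U: "U \<in> flagged_increasing_tableaux la mu"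
    obtain r c where b: "b = (r, c)" by fastforce
    show "U b \<in> {..length mu}" if "b \<in> ?S"
    proof -
      have "U (r, c) \<le> r - 1" using U that unfolding flagged_increasing_tableaux_def b by blast
      moreover have "r \<le> length mu" using that by (simp add: b diagram_def)
      ultimately show ?thesis by (simp add: b)
    qed
    show "U b = 0" if "b \<notin> ?S"
      using that U unfolding flagged_increasing_tableaux_def increasing_tableaux_def Let_def mem_Collect_eq
      by blast
  qed
  show "finite {U. \<forall>b. (b \<in> ?S \<longrightarrow> U b \<in> {..length mu}) \<and> (b \<notin> ?S \<longrightarrow> U b = (0 :: nat))}"
    using finite_diagram by (intro finite_set_of_finite_funs) auto
qed

lemma stage_isomorphic_sum:
  "isomorphic_crystals n (stage_crystal n (row_len la) 1 n)
     (direct_sum {mu. is_partition mu \<and> diagram la \<subseteq> diagram mu}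
        (\<lambda>mu. multiple (num_flagged la mu) (B_crystal n mu)))"
proof -
  let ?F = "flagged_increasing_tableaux la"
  let ?C = "stage_crystal n (row_len la) 1 n"
  let ?D = "direct_sum {mu. is_partition mu \<and> diagram la \<subseteq> diagram mu}
    (\<lambda>mu. multiple (num_flagged la mu) (B_crystal n mu))"
  have "\<exists>h. bij_betw h (?F mu) {..<num_flagged la mu}" for mu
    using ex_bij_betw_finite_nat[OF finite_flagged[of la mu]]
    by (simp add: num_flagged_def atLeast0LessThan)
  \<comment> \<open>Any numbering of the flagged tableaux serves as index of the copies, since the
    operators change neither the shape nor the recording tableau.\<close>
  then obtain h where h: "\<And>mu. bij_betw (h mu) (?F mu) {..<num_flagged la mu}" by metis
  define \<psi> where "\<psi> = (\<lambda>(M, X, U). (shape_of n M, h (shape_of n M) U, decode (M, X)))"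
  have elD: "(mu, k, T) \<in> elems ?D \<longleftrightarrow> is_partition mu \<and> diagram la \<subseteq> diagram mu \<and>
      k < num_flagged la mu \<and> T \<in> SSYT n mu" for mu k T
    by (auto simp: direct_sum_def multiple_def B_crystal_def)
  have elC: "elems ?C = stage n (row_len la) 1 n" by (simp add: stage_crystal_def)
  have opD: "e_of ?D i (mu, k, T) = map_option (\<lambda>T. (mu, k, T)) (e_op mu i T)"
    "f_of ?D i (mu, k, T) = map_option (\<lambda>T. (mu, k, T)) (f_op mu i T)"
    "wt ?D (mu, k, T) = content n T" for i mu k T
    by (simp_all add: direct_sum_def multiple_def B_crystal_def SVT_crystal_def option.map_comp comp_def)
  have inC: "pattern n M X \<and> is_partition (shape_of n M) \<and> (\<forall>r. M r n = int (row_len (shape_of n M) r)) \<and>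
      (\<forall>r j. \<not> X r j) \<and> diagram la \<subseteq> diagram (shape_of n M) \<and> U \<in> ?F (shape_of n M)"
    if "(M, X, U) \<in> stage n (row_len la) 1 n" for M X U
  proof -
    have p: "pattern n M X" using that by (simp add: stage_def)
    then show ?thesis
      using pattern.shape_of[OF p] stage_last_iff[OF p pattern.shape_of(2)[OF p]] that by blast
  qed
  have bij: "bij_betw \<psi> (elems ?C) (elems ?D)"
    unfolding bij_betw_def
  proof
    show "inj_on \<psi> (elems ?C)"
    proof (rule inj_onI)
      fix x y assume xy: "x \<in> elems ?C" "y \<in> elems ?C" "\<psi> x = \<psi> y"
      obtain M X U M' X' U' where eq: "x = (M, X, U)" "y = (M', X', U')" by (cases x; cases y)
      note c = inC[OF xy(1)[unfolded elC eq]] inC[OF xy(2)[unfolded elC eq]]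
      have s: "shape_of n M = shape_of n M'" "h (shape_of n M) U = h (shape_of n M) U'"
        "decode (M, X) = decode (M', X')"
        using xy(3) by (auto simp: eq \<psi>_def)
      have "(M, X) = (M', X')" using pattern.encode_decode c s(3) by metis
      moreover have "U = U'"
        using c s(1,2) h[of "shape_of n M"] by (auto simp: bij_betw_def inj_on_def)
      ultimately show "x = y" by (simp add: eq)
    qed
    show "\<psi> ` elems ?C = elems ?D"
    proof
      show "\<psi> ` elems ?C \<subseteq> elems ?D"
      proof
        fix y assume "y \<in> \<psi> ` elems ?C"
        then obtain x where x0: "x \<in> elems ?C" "y = \<psi> x" by blast
        obtain M X U where xx: "x = (M, X, U)" by (cases x)
        have x: "(M, X, U) \<in> stage n (row_len la) 1 n" "y = \<psi> (M, X, U)"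
          using x0 unfolding elC xx by auto
        note c = inC[OF x(1)]
        have "decode (M, X) \<in> SSYT n (shape_of n M)" using pattern.decode_SSYT_iff c by blast
        moreover have "h (shape_of n M) U < num_flagged la (shape_of n M)"
          using c bij_betwE[OF h[of "shape_of n M"]] by blast
        ultimately show "y \<in> elems ?D" using c by (simp add: x(2) \<psi>_def elD)
      qed
      show "elems ?D \<subseteq> \<psi> ` elems ?C"
      proof
        fix y assume y: "y \<in> elems ?D"
        obtain mu k T where yy: "y = (mu, k, T)" by (cases y)
        note d = y[unfolded yy elD]
        obtain M X where e: "encode T = (M, X)" by fastforce
        have T: "T \<in> SVT n mu" using d by (simp add: SSYT_def)
        have P: "(M, X) \<in> patterns n mu" "decode (M, X) = T"
          using encode_SVT[OF T _ e] d by auto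
        then have p: "pattern n M X" and M: "\<And>r. M r n = int (row_len mu r)"
          by (auto simp: patterns_def)
        have "k \<in> h mu ` ?F mu" using d h[of mu] by (simp add: bij_betw_def)
        then obtain U where U: "U \<in> ?F mu" "h mu U = k" by blast
        have "decode (M, X) \<in> SSYT n mu" using P(2) d by simp
        then have "\<forall>r j. \<not> X r j" unfolding pattern.decode_SSYT_iff[OF p M] .
        then have "(M, X, U) \<in> stage n (row_len la) 1 n"
          unfolding stage_last_iff[OF p M] using d U(1) by blast
        moreover have "\<psi> (M, X, U) = y"
          using shape_of_eq[of mu M n] M d P(2) U(2) by (simp add: \<psi>_def yy)
        ultimately show "y \<in> \<psi> ` elems ?C" unfolding elC by (metis image_eqI)
      qed
    qed
  qed
  have "crystal_isomorphism n ?C ?D \<psi>"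
    unfolding crystal_isomorphism_def commutes_on_def
  proof (intro conjI ballI)
    show "bij_betw \<psi> (elems ?C) (elems ?D)" by (rule bij)
    fix x assume x: "x \<in> elems ?C"
    obtain M X U where xx: "x = (M, X, U)" by (cases x)
    note c = inC[OF x[unfolded elC xx]]
    then have p: "pattern n M X" and N: "M 1 n = int (ncols (shape_of n M))"
      by (simp_all add: ncols_row_len)
    show "wt ?D (\<psi> x) = wt ?C x"
      by (simp add: xx \<psi>_def opD stage_crystal_def pattern.content_decode[OF p])
    fix i assume "i \<in> {1..<n}"
    then have i: "1 \<le> i" "i < n" by auto
    show "set_option (e_of ?C i x) \<subseteq> elems ?C" "set_option (f_of ?C i x) \<subseteq> elems ?C"
      using partial_inversesD[OF partial_inverses_stage i x] by auto
    have sh: "shape_of n M' = shape_of n M" if "\<And>r. M' r n = M r n" for M' :: "nat \<Rightarrow> nat \<Rightarrow> int"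
      using that by (simp add: shape_of_def)
    show "map_option \<psi> (e_of ?C i x) = e_of ?D i (\<psi> x)"
    proof (cases "e_pat n i (M, X)")
      case None
      then show ?thesis
        using pattern.e_op_decode[OF p N i] by (simp add: xx \<psi>_def opD stage_crystal_def)
    next
      case (Some y)
      obtain M' X' where y: "y = (M', X')" by fastforce
      have "shape_of n M' = shape_of n M"
        using e_pat_frame(1)[OF i Some[unfolded y]] by (rule sh)
      then show ?thesis
        using pattern.e_op_decode[OF p N i] Some
        by (simp add: xx \<psi>_def opD stage_crystal_def y)
    qed
    show "map_option \<psi> (f_of ?C i x) = f_of ?D i (\<psi> x)"
    proof (cases "f_pat n i (M, X)")
      case None
      then show ?thesis
        using pattern.f_op_decode[OF p N i(1)] by (simp add: xx \<psi>_def opD stage_crystal_def)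
    next
      case (Some y)
      obtain M' X' where y: "y = (M', X')" by fastforce
      have "shape_of n M' = shape_of n M"
        using f_pat_frame(1)[OF p i Some[unfolded y]] by (rule sh)
      then show ?thesis
        using pattern.f_op_decode[OF p N i(1)] Some
        by (simp add: xx \<psi>_def opD stage_crystal_def y)
    qed
  qed
  then show ?thesis by (auto simp: isomorphic_crystals_def)
qed

theorem theorem3p12:
  fixes la :: "nat list" and n :: nat
  assumes "is_partition la" and "n \<ge> 2"
  shows "isomorphic_crystals n (SVT_crystal n la)
           (direct_sum {mu. is_partition mu \<and> diagram la \<subseteq> diagram mu}
              (\<lambda>mu. multiple (num_flagged la mu) (B_crystal n mu)))"
proof -
  have "isomorphic_crystals n (stage_crystal n (row_len la) n n) (stage_crystal n (row_len la) 1 n)"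
    using stages_isomorphic[of "row_len la" n] row_len_antimono[OF assms(1)] assms(2) by simp
  then show ?thesis
    using isomorphic_crystals_sym[OF SVT_isomorphic_stage[OF assms(1)]] stage_isomorphic_sum
    by (blast intro: isomorphic_crystals_trans)
qed

end
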